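(* Let $G$ be a finite abelian group. If there is an odd prime $p$ such that the Sylow $p$-subgroup of $G$ is neither cyclic nor elementary abelian of rank $2$, then $G$ admits a proper Cayley digraph with Cayley index $p$ whose automorphism group contains a nonabelian regular subgroup.
   Context: A digraph has vertex set and arc set of ordered pairs of distinct vertices (no loops); it is proper if some arc $(u,v)$ has $(v,u)$ not an arc. For $S\subseteq G\setminus\{1\}$, the Cayley digraph $\mathrm{Cay}(G,S)$ has vertex set $G$ and arcs $(u,v)$ whenever $vu^{-1}\in S$. $G$ acts on it by right multiplication, and the Cayley index is $|\mathrm{Aut}(\mathrm{Cay}(G,S)):G|$, where $\mathrm{Aut}$ is the group of arc-preserving vertex permutations. A subgroup is regular if it acts regularly on the vertex set. *)

theory Defs
  imports "HOL-Algebra.Algebra" "Graph_Theory.Pair_Digraph"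
begin

definition sylow_subgroup :: "nat \<Rightarrow> 'a set \<Rightarrow> ('a, 'b) monoid_scheme \<Rightarrow> bool" where
  "sylow_subgroup p P G \<longleftrightarrow> subgroup P G \<and> card P = p ^ multiplicity p (order G)"

definition elementary_abelian :: "nat \<Rightarrow> nat \<Rightarrow> ('a, 'b) monoid_scheme \<Rightarrow> bool" where
  "elementary_abelian p n G \<longleftrightarrow> G \<cong> product_group {..<n} (\<lambda>_. integer_mod_group p)"

definition proper_digraph :: "'a pair_pre_digraph \<Rightarrow> bool" where
  "proper_digraph D \<longleftrightarrow> (\<exists>u v. (u, v) \<in> parcs D \<and> (v, u) \<notin> parcs D)"

definition cayley_digraph :: "('a, 'b) monoid_scheme \<Rightarrow> 'a set \<Rightarrow> 'a pair_pre_digraph" where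
  "cayley_digraph G S =
    \<lparr>pverts = carrier G,
     parcs = {(u, v). u \<in> carrier G \<and> v \<in> carrier G \<and> v \<otimes>\<^bsub>G\<^esub> inv\<^bsub>G\<^esub> u \<in> S}\<rparr>"

lemma (in group) pair_digraph_cayley_digraph:
  assumes "finite (carrier G)" "S \<subseteq> carrier G - {\<one>}"
  shows "pair_digraph (cayley_digraph G S)"
proof
  show "finite (parcs (cayley_digraph G S))"
    using assms(1)
    by (auto simp: cayley_digraph_def intro: finite_subset[of _ "carrier G \<times> carrier G"])
qed (use assms in \<open>auto simp: cayley_digraph_def\<close>)

text \<open>The group operation, inherited from \<^const>\<open>BijGroup\<close>, is composition of functions,
  and automorphisms are extensional, so distinct elements are distinct vertex permutations.\<close>

definition aut_group :: "'a pair_pre_digraph \<Rightarrow> ('a \<Rightarrow> 'a) monoid" where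
  "aut_group D = BijGroup (pverts D)
    \<lparr>carrier := {f \<in> carrier (BijGroup (pverts D)).
       \<forall>u \<in> pverts D. \<forall>v \<in> pverts D. (u, v) \<in> parcs D \<longleftrightarrow> (f u, f v) \<in> parcs D}\<rparr>"

lemma carrier_aut_group:
  "f \<in> carrier (aut_group D) \<longleftrightarrow> f \<in> Bij (pverts D) \<and>
    (\<forall>u \<in> pverts D. \<forall>v \<in> pverts D. (u, v) \<in> parcs D \<longleftrightarrow> (f u, f v) \<in> parcs D)"
  by (simp add: aut_group_def BijGroup_def)

lemma subgroup_aut_group: "subgroup (carrier (aut_group D)) (BijGroup (pverts D))"
proof (rule group.subgroupI[OF group_BijGroup])
  show "carrier (aut_group D) \<subseteq> carrier (BijGroup (pverts D))"
    by (auto simp: aut_group_def)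
  have "\<one>\<^bsub>BijGroup (pverts D)\<^esub> \<in> carrier (aut_group D)"
    by (auto simp: carrier_aut_group BijGroup_def id_Bij)
  then show "carrier (aut_group D) \<noteq> {}" by blast
next
  fix f assume f: "f \<in> carrier (aut_group D)"
  then have fB: "f \<in> Bij (pverts D)" by (simp add: carrier_aut_group)
  then have im: "f ` pverts D = pverts D" by (simp add: Bij_def bij_betw_def)
  have "(u, v) \<in> parcs D \<longleftrightarrow>
      (inv_into (pverts D) f u, inv_into (pverts D) f v) \<in> parcs D"
    if "u \<in> pverts D" "v \<in> pverts D" for u v
  proof -
    have "inv_into (pverts D) f u \<in> pverts D" "inv_into (pverts D) f v \<in> pverts D"
      "f (inv_into (pverts D) f u) = u" "f (inv_into (pverts D) f v) = v"
      using that by (simp_all add: im inv_into_into f_inv_into_f)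
    moreover have "\<And>x y. x \<in> pverts D \<Longrightarrow> y \<in> pverts D \<Longrightarrow> (x, y) \<in> parcs D \<longleftrightarrow> (f x, f y) \<in> parcs D"
      using f by (simp add: carrier_aut_group)
    ultimately show ?thesis by simp
  qed
  then show "inv\<^bsub>BijGroup (pverts D)\<^esub> f \<in> carrier (aut_group D)"
    using fB by (simp add: inv_BijGroup carrier_aut_group restrict_inv_into_Bij)
next
  fix f g assume "f \<in> carrier (aut_group D)" "g \<in> carrier (aut_group D)"
  then show "f \<otimes>\<^bsub>BijGroup (pverts D)\<^esub> g \<in> carrier (aut_group D)"
    using Bij_imp_funcset[of g "pverts D"]
    by (auto simp: carrier_aut_group BijGroup_def compose_Bij compose_eq Pi_iff)
qed

lemma group_aut_group: "group (aut_group D)"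
  using group.subgroup_imp_group[OF group_BijGroup subgroup_aut_group, of D]
  by (simp add: aut_group_def)

definition right_translations :: "('a, 'b) monoid_scheme \<Rightarrow> ('a \<Rightarrow> 'a) set" where
  "right_translations G = (\<lambda>g. \<lambda>x \<in> carrier G. x \<otimes>\<^bsub>G\<^esub> g) ` carrier G"

lemma (in group) subgroup_right_translations:
  "subgroup (right_translations G) (aut_group (cayley_digraph G S))" (is "subgroup _ ?A")
proof -
  let ?r = "\<lambda>g. \<lambda>x \<in> carrier G. x \<otimes> g"
  have bij: "?r g \<in> Bij (carrier G)" if g: "g \<in> carrier G" for g
    unfolding Bij_def using g
    by (auto intro!: bij_betwI[where g = "\<lambda>x. x \<otimes> inv g"] simp: m_assoc)
  have quot: "(v \<otimes> g) \<otimes> inv (u \<otimes> g) = v \<otimes> inv u"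
    if "u \<in> carrier G" "v \<in> carrier G" "g \<in> carrier G" for u v g
  proof -
    have "g \<otimes> (inv g \<otimes> inv u) = inv u"
      using that by (simp flip: m_assoc)
    then show ?thesis using that by (simp add: inv_mult_group m_assoc)
  qed
  have aut: "?r g \<in> carrier ?A" if "g \<in> carrier G" for g
    using that bij by (auto simp: carrier_aut_group cayley_digraph_def quot)
  have mult: "?r g \<otimes>\<^bsub>?A\<^esub> ?r h = ?r (h \<otimes> g)"
    if "g \<in> carrier G" "h \<in> carrier G" for g h
    using that bij
    by (auto simp: aut_group_def BijGroup_def cayley_digraph_def compose_def m_assoc
        intro!: restrict_ext)
  have one: "?r \<one> = \<one>\<^bsub>?A\<^esub>"
    by (auto simp: aut_group_def BijGroup_def cayley_digraph_def intro!: restrict_ext)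
  show ?thesis
  proof (rule group.subgroupI[OF group_aut_group])
    show "right_translations G \<subseteq> carrier ?A" "right_translations G \<noteq> {}"
      using aut by (auto simp: right_translations_def)
  next
    fix f assume "f \<in> right_translations G"
    then obtain g where g: "g \<in> carrier G" "f = ?r g" by (auto simp: right_translations_def)
    have "inv\<^bsub>?A\<^esub> f = ?r (inv g)"
      using g aut[of g] aut[of "inv g"] mult[of "inv g" g] one
      by (intro group.inv_equality[OF group_aut_group]) auto
    then show "inv\<^bsub>?A\<^esub> f \<in> right_translations G"
      using g by (auto simp: right_translations_def)
  next
    fix f h assume "f \<in> right_translations G" "h \<in> right_translations G"
    then show "f \<otimes>\<^bsub>?A\<^esub> h \<in> right_translations G"
      using mult by (auto simp: right_translations_def)
  qed
qed

text \<open>In the index \<open>|Aut(Cay(G,S)) : G|\<close> the group \<open>G\<close> stands for its image under the right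
  regular representation.\<close>

definition cayley_index :: "('a, 'b) monoid_scheme \<Rightarrow> 'a set \<Rightarrow> nat" where
  "cayley_index G S = card (rcosets\<^bsub>aut_group (cayley_digraph G S)\<^esub> right_translations G)"

locale regular_action = transitive_action +
  assumes trivial_stabilizer: "x \<in> E \<Longrightarrow> stabilizer G \<phi> x = {\<one>}"

definition regular_subgroup :: "('a \<Rightarrow> 'a) set \<Rightarrow> 'a pair_pre_digraph \<Rightarrow> bool" where
  "regular_subgroup H D \<longleftrightarrow> subgroup H (aut_group D) \<and>
    regular_action (aut_group D\<lparr>carrier := H\<rparr>) (pverts D) (\<lambda>h. h)"

end

theory Submission
  imports Defs "HOL-Number_Theory.Cong"
begin

text \<open>Let \<open>F = G\<^sup>p\<close>. Since the Sylow subgroup is neither cyclic nor elementary abelian of rank 2,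
  there are homomorphisms \<open>\<phi>, \<psi> : G \<rightarrow> Z\<^sub>p\<close> with dual elements \<open>a, b\<close> and independent elements
  \<open>y, z\<close> of order \<open>p\<close> such that \<open>\<alpha> x = x y\<^bsup>\<phi> x\<^esup> z\<^bsup>\<psi> x\<^esup>\<close> is an automorphism of order \<open>p\<close>
  (\<open>\<alpha> - 1\<close> has rank 2; with rank 1 the orbits outside the fixed points would be cosets of one
  subgroup of order \<open>p\<close>, which forces too many automorphisms of the digraph). If the stabilizer of
  \<open>1\<close> in the automorphism group of \<open>Cay(G, S)\<close> is \<open>\<langle>\<alpha>\<rangle>\<close>, the Cayley index is \<open>p\<close>, and the maps
  \<open>u \<mapsto> \<alpha>\<^bsup>\<phi> x\<^esup> u x\<close>, for \<open>x \<in> G\<close>, form a nonabelian regular subgroup.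

  Such an \<open>S\<close> is found first on a small subgroup as a union of \<open>\<alpha>\<close>-orbits of \<open>a\<close>, \<open>b\<close>, \<open>a b\<close>, and \<open>y\<close>.
  It is then extended from a subgroup \<open>M\<close> to \<open>\<langle>M, c\<rangle>\<close> with \<open>\<alpha> c = c\<close> by adding \<open>c (M - 1)\<close>: as long as \<open>S\<close>
  has less than half the size of \<open>M\<close>, out-degrees inside the out-neighbourhood of \<open>1\<close> separate the old
  arcs from the new ones. For index 2 the complement is taken afterwards, to keep \<open>S\<close> small. Every
  element of \<open>G\<close> lies in \<open>\<langle>a, b\<rangle>\<close> times the fixed points of \<open>\<alpha>\<close>, so this process reaches \<open>G\<close>.\<close>

section \<open>Stabilizers of the identity in Cayley digraphs\<close>

text \<open>The twisted maps are closed under composition because \<phi> is constant modulo p on the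
  orbits of \<alpha>, so their exponents add; they fail to commute because \<phi> vanishes on
  \<open>b\<close> while \<alpha> moves \<open>b\<close>. The obstacle in choosing \<open>y\<close>
  and \<open>z\<close> is that \<phi> must kill both and \<psi> must kill \<open>z\<close>. If every
  element of order p in the Sylow subgroup is a p-th power in \<open>G\<close>, all homomorphisms to
  Z_p kill it, and a noncyclic Sylow subgroup has two independent ones. Otherwise an element of
  order p that is not a p-th power serves as both \<open>b\<close> and \<open>y\<close>, and
  \<open>z\<close> is found in the common kernel of \<phi> and \<psi>, which meets the Sylow
  subgroup nontrivially because that group is not Z_p x Z_p. Rigidity of the base digraphs goes from
  local to global. A stabilizer element, recentred at a vertex, acts on the generators as a power of
  \<alpha> whose exponent could a priori vary with the vertex. Following two commuting generators in
  both orders gives equations that force a single exponent.\<close>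

context comm_group begin

text \<open>\<open>diff_map f x\<close> is \<open>f\<close> conjugated by translations so that it again fixes \<open>\<one>\<close>.\<close>

definition diff_map :: "('a \<Rightarrow> 'a) \<Rightarrow> 'a \<Rightarrow> 'a \<Rightarrow> 'a" where
  "diff_map f x s = inv (f x) \<otimes> f (x \<otimes> s)"

text \<open>The definition asks for \<open>f\<close> to preserve arcs: those leaving \<open>x\<close> end in \<open>x s\<close> with \<open>s \<in> S\<close>.\<close>

definition cay_stab :: "'a set \<Rightarrow> 'a set \<Rightarrow> ('a \<Rightarrow> 'a) set" where
  "cay_stab M S = {f. bij_betw f M M \<and> f \<one> = \<one> \<and> (\<forall>x\<in>M. \<forall>s\<in>M. s \<in> S \<longleftrightarrow> diff_map f x s \<in> S)}"

lemma cay_stabD: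
  assumes "f \<in> cay_stab M S"
  shows "bij_betw f M M" "f \<one> = \<one>" "\<And>x s. x \<in> M \<Longrightarrow> s \<in> M \<Longrightarrow> diff_map f x s \<in> S \<longleftrightarrow> s \<in> S"
    "\<And>x. x \<in> M \<Longrightarrow> f x \<in> M"
  using assms by (auto simp: cay_stab_def bij_betw_def)

lemma cay_stab_mult:
  assumes "subgroup M G" "f \<in> cay_stab M S" "x \<in> M" "s \<in> M"
  shows "f (x \<otimes> s) = f x \<otimes> diff_map f x s"
proof -
  have "f x \<in> carrier G" "f (x \<otimes> s) \<in> carrier G"
    using assms cay_stabD(4)[OF assms(2)] by (auto dest: subgroup.mem_carrier subgroup.m_closed)
  then show ?thesis by (simp add: diff_map_def m_assoc[symmetric])
qed

lemma cay_stab_image: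
  assumes "subgroup M G" "f \<in> cay_stab M S" "s \<in> M"
  shows "f s \<in> S \<longleftrightarrow> s \<in> S"
proof -
  have "diff_map f \<one> s = f s"
    using assms cay_stabD(2,4)[OF assms(2)] subgroup.mem_carrier[OF assms(1)]
    by (simp add: diff_map_def)
  then show ?thesis
    using cay_stabD(3)[OF assms(2), of \<one> s] assms by (auto simp: subgroup.one_closed)
qed

text \<open>Recentring at \<open>x\<close> and then at \<open>u\<close> is recentring at
  \<open>x \<otimes> u\<close>, so the arc condition is inherited. Hence whatever is proved at the
  identity for all stabilizer elements holds at every vertex.\<close>

lemma diff_map_cay_stab:
  assumes M: "subgroup M G" and f: "f \<in> cay_stab M S" and x: "x \<in> M"
  shows "diff_map f x \<in> cay_stab M S"
proof -
  note fD = cay_stabD[OF f]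
  have c[simp]: "u \<in> M \<Longrightarrow> u \<in> carrier G" for u using M by (auto dest: subgroup.mem_carrier)
  have m[simp]: "u \<in> M \<Longrightarrow> v \<in> M \<Longrightarrow> u \<otimes> v \<in> M" "u \<in> M \<Longrightarrow> inv u \<in> M" for u v
    using M by (auto intro: subgroup.m_closed subgroup.m_inv_closed)
  have sh: "bij_betw (\<lambda>s. u \<otimes> s) M M" if "u \<in> M" for u
    by (rule bij_betwI[where g = "\<lambda>s. inv u \<otimes> s"]) (use that in \<open>auto simp: m_assoc[symmetric]\<close>)
  have "bij_betw ((\<lambda>s. inv (f x) \<otimes> s) \<circ> f \<circ> (\<lambda>s. x \<otimes> s)) M M"
    using sh[of "inv (f x)"] sh[of x] fD x by (intro bij_betw_trans) auto
  moreover have "(\<lambda>s. inv (f x) \<otimes> s) \<circ> f \<circ> (\<lambda>s. x \<otimes> s) = diff_map f x"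
    by (auto simp: diff_map_def fun_eq_iff)
  moreover have "diff_map f x \<one> = \<one>" using x fD(4) by (simp add: diff_map_def)
  moreover have "diff_map (diff_map f x) u s = diff_map f (x \<otimes> u) s" if "u \<in> M" "s \<in> M" for u s
  proof -
    have "f (x \<otimes> u) \<in> carrier G" "f (x \<otimes> u \<otimes> s) \<in> carrier G" "f x \<in> carrier G"
      using that x fD(4) by auto
    then show ?thesis
      using that x by (simp add: diff_map_def inv_mult_group m_assoc[symmetric])
        (simp add: m_assoc)
  qed
  ultimately show ?thesis
    using fD(3) x by (simp add: cay_stab_def)
qed

text \<open>A recentred map is injective on \<open>M\<close> and fixes the identity, so preserving
  the complement of \<open>S\<close> in \<open>M - {\<one>}\<close> is the same as preserving
  \<open>S\<close>.\<close>

lemma cay_stab_compl: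
  assumes M: "subgroup M G" and f: "f \<in> cay_stab M (M - {\<one>} - S)" and S: "S \<subseteq> M - {\<one>}"
  shows "f \<in> cay_stab M S"
proof -
  have "s \<in> S \<longleftrightarrow> diff_map f x s \<in> S" if "x \<in> M" "s \<in> M" for x s
  proof -
    have D: "diff_map f x \<in> cay_stab M (M - {\<one>} - S)" using diff_map_cay_stab[OF M f that(1)] .
    have "diff_map f x s = \<one> \<longleftrightarrow> s = \<one>"
      using cay_stabD[OF D] that subgroup.one_closed[OF M] by (metis bij_betw_inv_into_left)
    moreover have "diff_map f x s \<in> M" using cay_stabD(4)[OF D that(2)] .
    moreover have "diff_map f x s \<in> M - {\<one>} - S \<longleftrightarrow> s \<in> M - {\<one>} - S"
      using cay_stabD(3)[OF f that] .
    ultimately show ?thesis using S that by blast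
  qed
  then show ?thesis using cay_stabD(1,2)[OF f] unfolding cay_stab_def by blast
qed

text \<open>Once the new arcs are told apart from the old ones, cosets of \<open>M\<close> are
  respected, because a new arc leads into the next coset. In the coset of \<open>c\<close> only
  \<open>c\<close> itself is missing from the connection set, so multiplication by \<open>c\<close>
  commutes with \<open>f\<close>, and \<open>f\<close> is determined by its restriction to
  \<open>M\<close>. Natural exponents of \<open>c\<close> allow a plain induction.\<close>

lemma cay_stab_extend:
  fixes al :: "'a \<Rightarrow> 'a"
  assumes M: "subgroup M G" and finM: "finite M" and S: "S \<subseteq> M - {\<one>}"
    and small: "2 * card S + 2 < card M"
    and stab: "\<And>f. f \<in> cay_stab M S \<Longrightarrow> \<exists>i::nat. \<forall>x\<in>M. f x = (al ^^ i) x"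
    and al: "al \<in> hom G G" and c: "c \<in> carrier G" "c \<notin> M" "al c = c"
    and M': "subgroup M' G" "finite M'" "M' = (\<lambda>(m, k). m \<otimes> c [^] (k::nat)) ` (M \<times> UNIV)"
    and f: "f \<in> cay_stab M' (S \<union> (\<otimes>) c ` (M - {\<one>}))"
  shows "\<exists>i::nat. \<forall>x\<in>M'. f x = (al ^^ i) x"
proof -
  define T where "T = (\<otimes>) c ` (M - {\<one>})"
  define S' where "S' = S \<union> T"
  have f: "f \<in> cay_stab M' S'" using f by (simp add: S'_def T_def)
  have MM': "x \<in> M'" if "x \<in> M" for x
    unfolding M'(3) using that subgroup.mem_carrier[OF M that]
    by (intro rev_image_eqI[of "(x, 0)"]) auto
  have cM': "c \<in> M'"
    unfolding M'(3) using subgroup.one_closed[OF M] c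
    by (intro rev_image_eqI[of "(\<one>, 1)"]) auto
  have car[simp]: "x \<in> M' \<Longrightarrow> x \<in> carrier G" for x using M'(1) by (rule subgroup.mem_carrier)
  have carM[simp]: "x \<in> M \<Longrightarrow> x \<in> carrier G" for x using M by (rule subgroup.mem_carrier)
  have cl[simp]: "x \<otimes> w \<in> M" "inv x \<in> M" "\<one> \<in> M" if "x \<in> M" "w \<in> M" for x w
    using M that by (auto intro: subgroup.m_closed subgroup.m_inv_closed subgroup.one_closed)
  have cl'[simp]: "x \<otimes> w \<in> M'" "inv x \<in> M'" "\<one> \<in> M'" if "x \<in> M'" "w \<in> M'" for x w
    using M' that by (auto intro: subgroup.m_closed subgroup.m_inv_closed subgroup.one_closed)
  have one[simp]: "\<one> \<in> M" "\<one> \<in> M'" using M M'(1) by (auto intro: subgroup.one_closed)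
  have cmem: "c \<otimes> x \<notin> M" if "x \<in> M" for x
  proof
    assume "c \<otimes> x \<in> M"
    then have "c \<otimes> x \<otimes> inv x \<in> M" using that by simp
    then show False using c that by (simp add: m_assoc)
  qed
  have Tc: "t \<in> T \<longleftrightarrow> (\<exists>x\<in>M. x \<noteq> \<one> \<and> t = c \<otimes> x)" for t by (auto simp: T_def)
  have TM: "t \<notin> M" if "t \<in> T" for t using that cmem by (auto simp: Tc)
  have TM': "t \<in> M'" if "t \<in> T" for t using that cM' MM' by (auto simp: Tc)
  have SM: "s \<in> M" "s \<noteq> \<one>" if "s \<in> S" for s using that S by auto
  have S'M': "S' \<subseteq> M'" using SM MM' TM' by (auto simp: S'_def)
  have S'car[simp]: "u \<in> S' \<Longrightarrow> u \<in> carrier G" for u using S'M' by auto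
  have finS: "finite S" using S finM by (auto intro: finite_subset)
  have finS': "finite S'" using S'M' M'(2) by (rule finite_subset)
  have mem_S: "s \<in> S" if "s \<in> S'" "s \<in> M" for s using that TM by (auto simp: S'_def)
  \<comment> \<open>The out-degree of \<open>s\<close> in the digraph induced on \<open>S'\<close>: at least \<open>card M - 2\<close> on \<open>S\<close>, at most
    \<open>2 * card S\<close> on \<open>T\<close>.\<close>
  define d where "d s = card {u \<in> S'. s \<otimes> u \<in> S'}" for s
  have fT: "g s \<in> T" if g: "g \<in> cay_stab M' S'" and s: "s \<in> T" for g s
  proof (rule ccontr)
    assume "g s \<notin> T"
    have sM': "s \<in> M'" using TM' s by blast
    have "g s \<in> S'" using cay_stab_image[OF M'(1) g sM'] s by (simp add: S'_def)
    then have gs: "g s \<in> S" using \<open>g s \<notin> T\<close> by (simp add: S'_def)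
    define D where "D = diff_map g s"
    have D: "D \<in> cay_stab M' S'" unfolding D_def by (rule diff_map_cay_stab[OF M'(1) g sM'])
    \<comment> \<open>Recentring at \<open>s\<close> carries the out-neighbours of \<open>s\<close>
      inside \<open>S'\<close> to those of \<open>g s\<close>, so the two induced out-degrees
      agree.\<close>
    have "D ` {u \<in> S'. s \<otimes> u \<in> S'} = {u \<in> S'. g s \<otimes> u \<in> S'}"
    proof (intro equalityI subsetI)
      fix v assume "v \<in> D ` {u \<in> S'. s \<otimes> u \<in> S'}"
      then obtain u where u: "u \<in> S'" "s \<otimes> u \<in> S'" "v = D u" by auto
      then have "g (s \<otimes> u) \<in> S'" using cay_stab_image[OF M'(1) g, of "s \<otimes> u"] S'M' by blast
      then show "v \<in> {u \<in> S'. g s \<otimes> u \<in> S'}"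
        using u cay_stab_image[OF M'(1) D, of u] cay_stab_mult[OF M'(1) g sM', of u] S'M'
        by (auto simp: D_def)
    next
      fix v assume v: "v \<in> {u \<in> S'. g s \<otimes> u \<in> S'}"
      then obtain u where u: "u \<in> M'" "v = D u"
        using cay_stabD(1)[OF D] S'M' by (auto simp: bij_betw_def)
      have "g (s \<otimes> u) = g s \<otimes> v" using cay_stab_mult[OF M'(1) g sM' u(1)] u by (simp add: D_def)
      then have "s \<otimes> u \<in> S'" using v cay_stab_image[OF M'(1) g, of "s \<otimes> u"] sM' u by auto
      moreover have "u \<in> S'" using v u cay_stab_image[OF M'(1) D, of u] by auto
      ultimately show "v \<in> D ` {u \<in> S'. s \<otimes> u \<in> S'}" using u by blast
    qed
    moreover have "inj_on D {u \<in> S'. s \<otimes> u \<in> S'}"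
      by (rule inj_on_subset[of D M']) (use cay_stabD(1)[OF D] S'M' in \<open>auto simp: bij_betw_def\<close>)
    ultimately have "d (g s) = d s"
      unfolding d_def using card_image[of D "{u \<in> S'. s \<otimes> u \<in> S'}"] by simp
    moreover have "d s \<le> card S + card S"
    proof -
      obtain x where x: "x \<in> M" "s = c \<otimes> x" using s unfolding Tc by blast
      \<comment> \<open>Two successive elements of \<open>T\<close> multiply into the coset of c^2,
        which is not the coset of \<open>c\<close>; so one of the two must come from
        \<open>S\<close>.\<close>
      have "u \<in> S \<or> s \<otimes> u \<in> S" if "u \<in> S'" "s \<otimes> u \<in> S'" for u
      proof (rule ccontr)
        assume "\<not> (u \<in> S \<or> s \<otimes> u \<in> S)"
        then have "u \<in> T" "s \<otimes> u \<in> T" using that by (auto simp: S'_def)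
        then obtain v w where vw: "v \<in> M" "w \<in> M" "u = c \<otimes> v" "s \<otimes> u = c \<otimes> w"
          unfolding Tc by blast
        then have "c \<otimes> (c \<otimes> (x \<otimes> v)) = c \<otimes> w" using x c by (simp add: m_ac)
        then have "c \<otimes> (x \<otimes> v) = w" using x c vw by (subst (asm) l_cancel) auto
        then show False using cmem[of "x \<otimes> v"] x vw by auto
      qed
      then have "{u \<in> S'. s \<otimes> u \<in> S'} \<subseteq> S \<union> {u \<in> S'. s \<otimes> u \<in> S}" by auto
      then have "d s \<le> card (S \<union> {u \<in> S'. s \<otimes> u \<in> S})"
        unfolding d_def using finS finS' by (intro card_mono) auto
      also have "\<dots> \<le> card S + card {u \<in> S'. s \<otimes> u \<in> S}" by (rule card_Un_le)
      also have "card {u \<in> S'. s \<otimes> u \<in> S} \<le> card S"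
        using finS S'M' sM' by (intro card_inj_on_le[where f = "(\<otimes>) s"]) (auto simp: inj_on_def)
      finally show ?thesis by simp
    qed
    moreover have "card M - 2 \<le> d (g s)"
    proof -
      have r: "g s \<in> M" "g s \<noteq> \<one>" using SM gs by auto
      \<comment> \<open>An element of \<open>M\<close> permutes the coset of \<open>c\<close>. Two
        points are lost: \<open>c\<close>, which is not in \<open>T\<close>, and the one that is
        sent to \<open>c\<close>.\<close>
      have "card ((\<otimes>) c ` (M - {\<one>, inv (g s)})) = card (M - {\<one>, inv (g s)})"
        using c by (intro card_image) (auto simp: inj_on_def)
      moreover have "card M - 2 \<le> card (M - {\<one>, inv (g s)})"
      proof -
        have "card {\<one>, inv (g s)} \<le> 2" by (rule card_insert_le_m1) auto
        then show ?thesis using diff_card_le_card_Diff[of "{\<one>, inv (g s)}" M] by simp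
      qed
      moreover have "(\<otimes>) c ` (M - {\<one>, inv (g s)}) \<subseteq> {u \<in> S'. g s \<otimes> u \<in> S'}"
      proof -
        have "g s \<otimes> (c \<otimes> x) \<in> T" if "x \<in> M" "x \<noteq> \<one>" "x \<noteq> inv (g s)" for x
        proof -
          have "g s \<otimes> x \<noteq> \<one>" using that r inv_equality[of x "g s"] by (auto simp: m_comm)
          moreover have "g s \<otimes> (c \<otimes> x) = c \<otimes> (g s \<otimes> x)" using that r c by (simp add: m_ac)
          ultimately show ?thesis using r that by (auto simp: Tc)
        qed
        then show ?thesis by (auto simp: S'_def Tc)
      qed
      then have "card ((\<otimes>) c ` (M - {\<one>, inv (g s)})) \<le> d (g s)"
        unfolding d_def using finS' by (intro card_mono) auto
      ultimately show ?thesis by simp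
    qed
    ultimately show False using small by simp
  qed
  have ex: "\<exists>t\<in>M. t \<noteq> \<one> \<and> t \<noteq> r" for r
  proof (rule ccontr)
    assume "\<not> ?thesis"
    then have "M \<subseteq> {\<one>, r}" by auto
    then have "card M \<le> card {\<one>, r}" by (intro card_mono) auto
    also have "\<dots> \<le> 2" by (rule card_insert_le_m1) auto
    finally show False using small by simp
  qed
  \<comment> \<open>From the vertex \<open>inv (c \<otimes> t)\<close> the two \<open>T\<close>-arcs
    given by \<open>c \<otimes> t\<close> and \<open>c \<otimes> (t \<otimes> m)\<close> end in
    \<open>\<one>\<close> and \<open>m\<close>. Their images therefore lie in one coset of
    \<open>M\<close>, that of \<open>g \<one> = \<one>\<close>.\<close>
  have fM: "g m \<in> M" if g: "g \<in> cay_stab M' S'" and m: "m \<in> M" for g m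
  proof -
    obtain t where t: "t \<in> M" "t \<noteq> \<one>" "t \<noteq> inv m" using ex by blast
    define x where "x = inv (c \<otimes> t)"
    have x: "x \<in> M'" using t cM' MM' by (simp add: x_def)
    have "x \<otimes> (c \<otimes> t) = \<one>" using t c by (simp add: x_def)
    have "t \<otimes> m \<noteq> \<one>" using t m inv_equality[of t m] by auto
    then have T: "c \<otimes> t \<in> T" "c \<otimes> (t \<otimes> m) \<in> T" using t m by (auto simp: Tc)
    have D: "diff_map g x \<in> cay_stab M' S'" by (rule diff_map_cay_stab[OF M'(1) g x])
    obtain v w where vw: "v \<in> M" "w \<in> M" "diff_map g x (c \<otimes> t) = c \<otimes> v"
      "diff_map g x (c \<otimes> (t \<otimes> m)) = c \<otimes> w"
      using fT[OF D T(1)] fT[OF D T(2)] unfolding Tc by blast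
    have "\<one> = g x \<otimes> (c \<otimes> v)"
      using cay_stab_mult[OF M'(1) g x, of "c \<otimes> t"] cay_stabD(2)[OF g] T TM' vw \<open>x \<otimes> (c \<otimes> t) = \<one>\<close>
      by simp
    moreover have "x \<otimes> (c \<otimes> (t \<otimes> m)) = m"
      using t m c x \<open>x \<otimes> (c \<otimes> t) = \<one>\<close> by (metis carM l_one m_assoc m_closed car)
    then have "g m = g x \<otimes> (c \<otimes> w)"
      using cay_stab_mult[OF M'(1) g x, of "c \<otimes> (t \<otimes> m)"] T TM' vw by simp
    moreover have "g x \<in> carrier G" using cay_stabD(4)[OF g x] by simp
    ultimately have "g m = g x \<otimes> (c \<otimes> v) \<otimes> (inv v \<otimes> w)"
      using vw c by (simp add: m_assoc[symmetric]) (simp add: m_assoc)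
    then have "g m = inv v \<otimes> w" using \<open>\<one> = g x \<otimes> (c \<otimes> v)\<close>[symmetric] vw by simp
    then show ?thesis using vw by simp
  qed
  \<comment> \<open>As \<open>c\<close> is not in \<open>T\<close>, it is reached instead from
    \<open>inv t\<close>, which \<open>g\<close> keeps in \<open>M\<close>, along the
    \<open>T\<close>-arc given by \<open>c \<otimes> t\<close>.\<close>
  have fc: "inv c \<otimes> g c \<in> M" if g: "g \<in> cay_stab M' S'" for g
  proof -
    obtain t where t: "t \<in> M" "t \<noteq> \<one>" using ex by blast
    have D: "diff_map g (inv t) \<in> cay_stab M' S'"
      using diff_map_cay_stab[OF M'(1) g] t MM' by simp
    obtain v where v: "v \<in> M" "diff_map g (inv t) (c \<otimes> t) = c \<otimes> v"
      using fT[OF D, of "c \<otimes> t"] t unfolding Tc by blast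
    have "inv t \<otimes> (c \<otimes> t) = c" using t c by (simp add: m_ac)
    then have "g c = g (inv t) \<otimes> (c \<otimes> v)"
      using cay_stab_mult[OF M'(1) g, of "inv t" "c \<otimes> t"] v t cM' MM' by simp
    moreover have "g (inv t) \<in> M" using fM[OF g] t by simp
    ultimately have "inv c \<otimes> g c = g (inv t) \<otimes> v"
      using c v by (simp add: m_assoc[symmetric] m_comm[of _ c]) 
    then show ?thesis using \<open>g (inv t) \<in> M\<close> v by simp
  qed
  \<comment> \<open>Non-membership in \<open>S'\<close> singles out \<open>c\<close> within its
    coset of \<open>M\<close>.\<close>
  have Dc: "diff_map g x c = c" if g: "g \<in> cay_stab M' S'" and x: "x \<in> M'" for g x
  proof -
    have D: "diff_map g x \<in> cay_stab M' S'" by (rule diff_map_cay_stab[OF M'(1) g x])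
    have cS': "c \<notin> S'" using c SM cmem by (auto simp: S'_def Tc)
    then have "diff_map g x c \<notin> S'" using cay_stabD(3)[OF g x cM'] by simp
    moreover define v where "v = inv c \<otimes> diff_map g x c"
    have "v \<in> M" using fc[OF D] by (simp add: v_def)
    moreover have "diff_map g x c \<in> carrier G" using cay_stabD(4)[OF D cM'] by simp
    then have "diff_map g x c = c \<otimes> v" using c by (simp add: v_def m_assoc[symmetric])
    ultimately have "v = \<one>" by (auto simp: S'_def Tc)
    then show ?thesis using \<open>diff_map g x c = c \<otimes> v\<close> c by simp
  qed
  have "f \<in> cay_stab M S"
  proof -
    have "inj_on f M"
      by (rule inj_on_subset[of f M']) (use cay_stabD(1)[OF f] MM' in \<open>auto simp: bij_betw_def\<close>)
    moreover have "f ` M \<subseteq> M" using fM[OF f] by auto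
    ultimately have "bij_betw f M M" using finM by (simp add: bij_betw_def endo_inj_surj)
    moreover have "s \<in> S \<longleftrightarrow> diff_map f x s \<in> S" if "x \<in> M" "s \<in> M" for x s
    proof -
      have "diff_map f x s \<in> M"
        using fM diff_map_cay_stab[OF M'(1) f MM'] that by blast
      then show ?thesis
        using cay_stabD(3)[OF f, of x s] that mem_S MM' by (auto simp: S'_def dest: TM)
    qed
    ultimately show ?thesis using cay_stabD(2)[OF f] unfolding cay_stab_def by blast
  qed
  then obtain i where i: "\<forall>x\<in>M. f x = (al ^^ i) x" using stab by blast
  have alc: "(al ^^ i) c = c" for i by (induction i) (auto simp: c)
  have ali: "(al ^^ i) \<in> hom G G" for i
  proof (induction i)
    case (Suc i)
    then show ?case using al by (auto simp: hom_def Pi_def)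
  qed (auto simp: hom_def)
  have step: "g (m \<otimes> c [^] k) = (al ^^ i) m \<otimes> c [^] k"
    if "g \<in> cay_stab M' S'" "\<forall>x\<in>M. g x = (al ^^ i) x" "m \<in> M" for g m and k :: nat
    using that
  proof (induction k arbitrary: g)
    case 0
    then show ?case using hom_in_carrier[OF ali[of i], of m] by simp
  next
    case (Suc k)
    define D where "D = diff_map g c"
    have D: "D \<in> cay_stab M' S'"
      unfolding D_def by (rule diff_map_cay_stab[OF M'(1) Suc.prems(1) cM'])
    have "g (\<one> \<otimes> c) = g \<one> \<otimes> c"
      using cay_stab_mult[OF M'(1) Suc.prems(1) one(2) cM'] Dc[OF Suc.prems(1) one(2)] by simp
    then have gc: "g c = c" using c cay_stabD(2)[OF Suc.prems(1)] by simp
    have gD: "g (c \<otimes> u) = c \<otimes> D u" if "u \<in> M'" for u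
      using cay_stab_mult[OF M'(1) Suc.prems(1) cM' that] gc by (simp add: D_def)
    \<comment> \<open>Evaluating \<open>g\<close> at \<open>x \<otimes> c\<close> in both orders
      shows that recentring at \<open>c\<close> does not change \<open>g\<close> on
      \<open>M\<close>, so the induction may pass from \<open>g\<close> to \<open>D\<close>.\<close>
    have "D x = (al ^^ i) x" if x: "x \<in> M" for x
    proof -
      have "g (x \<otimes> c) = g x \<otimes> c"
        using cay_stab_mult[OF M'(1) Suc.prems(1) MM'[OF x] cM'] Dc[OF Suc.prems(1) MM'[OF x]] by simp
      then have "c \<otimes> D x = c \<otimes> g x"
        using gD[OF MM'[OF x]] x c fM[OF Suc.prems(1) x] by (simp add: m_comm)
      then have "D x = g x"
        using c fM[OF Suc.prems(1) x] cay_stabD(4)[OF D MM'[OF x]] by simp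
      then show ?thesis using Suc.prems x by simp
    qed
    then have "D (m \<otimes> c [^] k) = (al ^^ i) m \<otimes> c [^] k"
      using Suc.IH[OF D] Suc.prems by blast
    moreover have "m \<otimes> c [^] k \<in> M'" using M'(3) Suc.prems by auto
    moreover have "(al ^^ i) m \<in> carrier G" using hom_in_carrier[OF ali[of i], of m] Suc.prems by simp
    moreover have "m \<otimes> c [^] Suc k = c \<otimes> (m \<otimes> c [^] k)" using c Suc.prems by (simp add: m_ac)
    ultimately show ?case
      using gD[of "m \<otimes> c [^] k"] c by (simp add: m_ac)
  qed
  have pow: "(al ^^ i) (c [^] k) = c [^] k" for k :: nat
    using hom_mult[OF ali[of i]] c alc
    by (induction k) (auto simp: hom_one[OF ali group_axioms group_axioms])
  have "f x = (al ^^ i) x" if x: "x \<in> M'" for x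
  proof -
    obtain m k where mk: "m \<in> M" "x = m \<otimes> c [^] (k::nat)" using x unfolding M'(3) by auto
    then have "(al ^^ i) x = (al ^^ i) m \<otimes> c [^] k" using hom_mult[OF ali[of i]] c pow by simp
    then show ?thesis using step[OF f i mk(1)] mk by simp
  qed
  then show ?thesis by blast
qed

end

section \<open>The automorphism \<open>\<alpha>\<close>\<close>

lemma (in group) mod_hom_int_pow:
  fixes f :: "'a \<Rightarrow> int" and i :: int
  assumes f: "\<And>x w. x \<in> carrier G \<Longrightarrow> w \<in> carrier G \<Longrightarrow> [f (x \<otimes> w) = f x + f w] (mod m)"
    and x: "x \<in> carrier G"
  shows "[f (x [^] i) = i * f x] (mod m)"
proof (induction i rule: int_induct[where k = 0])
  case base
  have "[0 + f \<one> = f \<one> + f \<one>] (mod m)" using f[of \<one> \<one>] by simp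
  then have "[0 = f \<one>] (mod m)" by (simp only: cong_add_rcancel)
  then show ?case by (simp add: cong_sym)
next
  case (step1 i)
  have "[f (x [^] i \<otimes> x) = i * f x + f x] (mod m)"
    using x step1 by (intro cong_trans[OF f] cong_add) auto
  then show ?case using x by (simp add: int_pow_mult distrib_right)
next
  case (step2 i)
  have "x [^] (i - 1) \<otimes> x = x [^] i" using x by (simp add: int_pow_diff m_assoc)
  then have "[f (x [^] (i - 1)) + f x = i * f x] (mod m)"
    using f[of "x [^] (i - 1)" x] x step2 by (metis cong_sym cong_trans int_pow_closed)
  then have "[f (x [^] (i - 1)) + f x = (i - 1) * f x + f x] (mod m)"
    by (simp add: algebra_simps)
  then show ?case by (simp only: cong_add_rcancel)
qed

text \<open>For \<open>y = b\<close> the map \<open>\<alpha> - 1\<close> is nilpotent of index 3 (this needs a direct factor of order \<open>p\<close>);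
  for \<open>\<psi> y = 0\<close> its square is 0.\<close>

locale unipotent_data = comm_group G for G (structure) +
  fixes p :: nat and \<phi> \<psi> :: "'a \<Rightarrow> int" and a b y z :: 'a
  assumes fin: "finite (carrier G)" and prime: "Factorial_Ring.prime p" and odd: "odd p"
    and carr [simp]: "a \<in> carrier G" "b \<in> carrier G" "y \<in> carrier G" "z \<in> carrier G"
    and phi_mult: "\<And>x w. x \<in> carrier G \<Longrightarrow> w \<in> carrier G \<Longrightarrow> [\<phi> (x \<otimes> w) = \<phi> x + \<phi> w] (mod int p)"
    and psi_mult: "\<And>x w. x \<in> carrier G \<Longrightarrow> w \<in> carrier G \<Longrightarrow> [\<psi> (x \<otimes> w) = \<psi> x + \<psi> w] (mod int p)"
    and phi_vals: "[\<phi> a = 1] (mod int p)" "[\<phi> b = 0] (mod int p)" "[\<phi> y = 0] (mod int p)"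
      "[\<phi> z = 0] (mod int p)"
    and psi_vals: "[\<psi> a = 0] (mod int p)" "[\<psi> b = 1] (mod int p)" "[\<psi> z = 0] (mod int p)"
    and yp: "y [^] p = \<one>" and zp: "z [^] p = \<one>"
    and indep: "\<And>i j :: int. y [^] i \<otimes> z [^] j = \<one> \<Longrightarrow> int p dvd i \<and> int p dvd j"
    and alternatives: "y = b \<or> [\<psi> y = 0] (mod int p)"
begin

definition al :: "'a \<Rightarrow> 'a" where
  "al x = x \<otimes> y [^] \<phi> x \<otimes> z [^] \<psi> x"

lemma p3: "3 \<le> p"
proof -
  have "p \<noteq> 2" using odd by auto
  then show ?thesis using prime prime_ge_2_nat[of p] by linarith
qed

lemma pow_cong:
  assumes "[i = j] (mod int p)"
  shows "y [^] i = y [^] j" "z [^] i = z [^] j"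
proof -
  obtain k where k: "i = j + int p * k" using assms by (metis cong_iff_lin cong_sym)
  have "y [^] (int p * k) = \<one>" "z [^] (int p * k) = \<one>"
    by (simp_all add: int_pow_pow[symmetric] int_pow_int yp zp)
  then show "y [^] i = y [^] j" "z [^] i = z [^] j" by (simp_all add: k int_pow_mult)
qed

lemma yz_eq:
  "y [^] i \<otimes> z [^] j = y [^] k \<otimes> z [^] l \<longleftrightarrow> [i = k] (mod int p) \<and> [j = l] (mod int p)"
  for i j k l :: int
proof
  assume eq: "y [^] i \<otimes> z [^] j = y [^] k \<otimes> z [^] l"
  have "y [^] (i - k) \<otimes> z [^] (j - l) = (y [^] i \<otimes> z [^] j) \<otimes> inv (y [^] k \<otimes> z [^] l)"
    by (simp add: int_pow_diff inv_mult m_ac)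
  also have "\<dots> = \<one>" by (simp add: eq)
  finally show "[i = k] (mod int p) \<and> [j = l] (mod int p)"
    using indep by (simp add: cong_iff_dvd_diff)
next
  assume "[i = k] (mod int p) \<and> [j = l] (mod int p)"
  then show "y [^] i \<otimes> z [^] j = y [^] k \<otimes> z [^] l" using pow_cong by metis
qed

lemma al_carrier [simp]: "x \<in> carrier G \<Longrightarrow> al x \<in> carrier G"
  by (simp add: al_def)

lemma al_mult:
  assumes "x \<in> carrier G" "w \<in> carrier G"
  shows "al (x \<otimes> w) = al x \<otimes> al w"
proof -
  have "y [^] \<phi> (x \<otimes> w) = y [^] (\<phi> x + \<phi> w)" "z [^] \<psi> (x \<otimes> w) = z [^] (\<psi> x + \<psi> w)"
    using assms phi_mult psi_mult pow_cong by blast+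
  then show ?thesis using assms by (simp add: al_def int_pow_mult m_ac)
qed

lemma al_hom: "al \<in> hom G G"
  by (auto simp: hom_def al_mult)

lemma al_int_pow: "x \<in> carrier G \<Longrightarrow> al (x [^] (i::int)) = al x [^] i"
  by (rule hom_int_pow[OF al_hom _ group_axioms group_axioms])

lemma al_fixed:
  assumes "x \<in> carrier G" "[\<phi> x = 0] (mod int p)" "[\<psi> x = 0] (mod int p)"
  shows "al x = x"
  using assms pow_cong(1)[of "\<phi> x" 0] pow_cong(2)[of "\<psi> x" 0] by (simp add: al_def)

lemma al_z: "al z = z" by (simp add: al_fixed phi_vals psi_vals)

lemma al_y: "al y = y \<otimes> z [^] \<psi> y"
  using pow_cong(1)[OF phi_vals(3)] by (simp add: al_def)

text \<open>Written additively with N = \<alpha> - 1, this is \<alpha>^n = 1 + n N + (n choose 2)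
  N^2. Since \<phi> kills \<open>y\<close> and \<alpha> fixes \<open>z\<close>, N^2 sends
  \<open>x\<close> to a power of \<open>z\<close> with exponent \<psi>(y) \<phi>(x), and N^3 =
  0.\<close>

lemma al_pow_formula:
  assumes x: "x \<in> carrier G"
  shows "(al ^^ n) x =
    x \<otimes> y [^] (int n * \<phi> x) \<otimes> z [^] (int n * \<psi> x + \<psi> y * int (n choose 2) * \<phi> x)"
proof (induction n)
  case 0
  then show ?case using x by (simp add: binomial_eq_0)
next
  case (Suc n)
  have ch: "int (Suc n choose 2) = int (n choose 2) + int n"
    by (simp add: numeral_2_eq_2)
  have "al (y [^] (int n * \<phi> x)) = y [^] (int n * \<phi> x) \<otimes> z [^] (\<psi> y * (int n * \<phi> x))"
    by (simp add: al_int_pow al_y int_pow_distrib int_pow_pow)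
  then have "(al ^^ Suc n) x = al x \<otimes> (y [^] (int n * \<phi> x) \<otimes> z [^] (\<psi> y * (int n * \<phi> x)))
      \<otimes> z [^] (int n * \<psi> x + \<psi> y * int (n choose 2) * \<phi> x)"
    using x by (simp add: Suc al_mult al_int_pow al_z)
  also have "\<dots> = x \<otimes> (y [^] \<phi> x \<otimes> y [^] (int n * \<phi> x)) \<otimes>
      (z [^] \<psi> x \<otimes> z [^] (\<psi> y * (int n * \<phi> x)) \<otimes>
       z [^] (int n * \<psi> x + \<psi> y * int (n choose 2) * \<phi> x))"
    using x by (simp add: al_def m_ac)
  also have "\<dots> = x \<otimes> y [^] (int (Suc n) * \<phi> x) \<otimes>
      z [^] (int (Suc n) * \<psi> x + \<psi> y * int (Suc n choose 2) * \<phi> x)"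
    unfolding ch using x by (simp add: int_pow_mult[symmetric] algebra_simps)
  finally show ?case .
qed

lemma al_pow_carrier [simp]: "x \<in> carrier G \<Longrightarrow> (al ^^ n) x \<in> carrier G"
  by (induction n) auto

lemma al_pow_mult: "x \<in> carrier G \<Longrightarrow> w \<in> carrier G \<Longrightarrow> (al ^^ n) (x \<otimes> w) = (al ^^ n) x \<otimes> (al ^^ n) w"
  by (induction n) (auto simp: al_mult)

text \<open>For odd p the binomial coefficient (p choose 2) is divisible by p, so the quadratic term
  of the formula disappears too.\<close>

lemma al_period: "x \<in> carrier G \<Longrightarrow> (al ^^ p) x = x"
proof -
  assume x: "x \<in> carrier G"
  have "p dvd p choose 2"
  proof -
    obtain k where "p = 2 * k + 1" using odd by (elim oddE)
    then have "p choose 2 = p * k" by (simp add: choose_two)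
    then show ?thesis by simp
  qed
  then have "int p dvd int (p choose 2)" by simp
  then have "[int p * \<phi> x = 0] (mod int p)"
    "[int p * \<psi> x + \<psi> y * int (p choose 2) * \<phi> x = 0] (mod int p)"
    by (auto simp: cong_0_iff)
  then show ?thesis using x pow_cong[of _ 0] by (simp add: al_pow_formula)
qed

lemma al_pow_cong:
  assumes x: "x \<in> carrier G" and "[i = j] (mod p)"
  shows "(al ^^ i) x = (al ^^ j) x"
proof -
  have "(al ^^ (p * k)) x = x" if "x \<in> carrier G" for x k
    using that by (induction k) (auto simp: funpow_add al_period)
  then have "(al ^^ i) x = (al ^^ (i mod p)) x" for i
    using x funpow_add[of "i mod p" "p * (i div p)" al] by simp
  then show ?thesis using assms(2) unfolding cong_def by metis
qed

lemma al_inj: "inj_on al (carrier G)"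
proof (rule inj_onI)
  fix x w assume "x \<in> carrier G" "w \<in> carrier G" "al x = al w"
  then have "(al ^^ (p - 1)) (al x) = (al ^^ (p - 1)) (al w)" by simp
  moreover have "(al ^^ (p - 1)) (al x) = (al ^^ p) x" for x
    using p3 by (metis Suc_diff_1 funpow_swap1 funpow.simps(2) comp_apply prime prime_gt_0_nat)
  ultimately show "x = w" using \<open>x \<in> carrier G\<close> \<open>w \<in> carrier G\<close> by (simp add: al_period)
qed

text \<open>The invariant of the enlargement process. An element of \<open>S\<close> without its
  inverse gives properness; \<open>y\<close> and \<open>z\<close> in \<open>M\<close> make
  \<open>M\<close> invariant under \<open>al\<close>; \<open>a\<close> and \<open>b\<close> in
  \<open>M\<close> allow a new element to be corrected to a fixed point of \<open>al\<close>.
  Agreement with a power of \<open>al\<close> is required on \<open>M\<close> only, since members of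
  \<open>cay_stab\<close> are arbitrary elsewhere.\<close>

definition good :: "'a set \<Rightarrow> 'a set \<Rightarrow> bool" where
  "good M S \<longleftrightarrow> subgroup M G \<and> {a, b, y, z} \<subseteq> M \<and> S \<subseteq> M - {\<one>} \<and> al ` S = S \<and>
     (\<exists>s\<in>S. inv s \<notin> S) \<and> 2 \<le> card S \<and> 2 * card S + 2 < card M \<and>
     (\<forall>f\<in>cay_stab M S. \<exists>i::nat. \<forall>x\<in>M. f x = (al ^^ i) x)"

text \<open>The new set \<open>S1\<close> has |S| + |M| - 1 elements, so 2|S1| + 2 = 2|S| + 2|M| <
  3|M|, which suffices when the index is at least 3. For index 2 the complement has |M| - |S|
  elements, and 2(|M| - |S|) + 2 < 2|M| holds as soon as |S| is at least 2; this is why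
  \<open>good\<close> demands that.\<close>

lemma good_extend:
  assumes g: "good M S" and c: "c \<in> carrier G" "c \<notin> M" "al c = c"
  shows "\<exists>M' S'. good M' S' \<and> card M < card M'"
proof -
  have M: "subgroup M G" and gens: "{a, b, y, z} \<subseteq> M" and SM: "S \<subseteq> M - {\<one>}" and alS: "al ` S = S"
    and asym: "\<exists>s\<in>S. inv s \<notin> S" and ge2: "2 \<le> card S" and small: "2 * card S + 2 < card M"
    and stab: "\<And>f. f \<in> cay_stab M S \<Longrightarrow> \<exists>i::nat. \<forall>x\<in>M. f x = (al ^^ i) x"
    using g by (auto simp: good_def)
  define M' where "M' = (\<lambda>(m, k). m \<otimes> c [^] (k::nat)) ` (M \<times> UNIV)"
  define S1 where "S1 = S \<union> (\<otimes>) c ` (M - {\<one>})"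
  have [simp]: "x \<in> M \<Longrightarrow> x \<in> carrier G" for x using M by (rule subgroup.mem_carrier)
  have cl[simp]: "\<one> \<in> M" "x \<in> M \<Longrightarrow> w \<in> M \<Longrightarrow> x \<otimes> w \<in> M" "x \<in> M \<Longrightarrow> inv x \<in> M"
    "x \<in> M \<Longrightarrow> x [^] (i::int) \<in> M" for x w i
    using M by (auto intro: subgroup.m_closed subgroup.m_inv_closed subgroup.one_closed subgroup_int_pow_closed)
  have M'I: "m \<in> M \<Longrightarrow> m \<otimes> c [^] (k::nat) \<in> M'" for m k by (auto simp: M'_def)
  have subM': "subgroup M' G"
  proof (rule subgroupI)
    show "M' \<subseteq> carrier G" using c by (auto simp: M'_def)
    show "M' \<noteq> {}" using M'I[of \<one> 0] by auto
    fix u assume "u \<in> M'"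
    then obtain m k where u: "m \<in> M" "u = m \<otimes> c [^] (k::nat)" by (auto simp: M'_def)
    have o: "order G > 0" using fin by (simp add: order_gt_0_iff_finite)
    \<comment> \<open>The exponents of \<open>c\<close> in \<open>M'\<close> are natural numbers, so
      the inverse of a power of \<open>c\<close> is written with the exponent multiplied by
      \<open>order G - 1\<close>.\<close>
    have "inv m \<otimes> c [^] (k * (order G - 1)) \<otimes> u =
        (inv m \<otimes> m) \<otimes> (c [^] (k * (order G - 1)) \<otimes> c [^] k)"
      using u c by (simp only: m_ac m_closed nat_pow_closed inv_closed \<open>\<And>x. x \<in> M \<Longrightarrow> x \<in> carrier G\<close>)
    also have "\<dots> = c [^] (k * (order G - 1) + k)"
      using u c by (simp add: nat_pow_mult)
    also have "\<dots> = c [^] (order G * k)"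
      using o by (cases "order G") (auto simp: algebra_simps)
    also have "\<dots> = \<one>" using c by (simp add: nat_pow_pow[symmetric] pow_order_eq_1)
    finally have "inv u = inv m \<otimes> c [^] (k * (order G - 1))"
      using u c by (intro inv_equality) auto
    then show "inv u \<in> M'" using M'I u by simp
    fix v assume "v \<in> M'"
    then obtain n l where v: "n \<in> M" "v = n \<otimes> c [^] (l::nat)" by (auto simp: M'_def)
    have "u \<otimes> v = (m \<otimes> n) \<otimes> c [^] (k + l)" using u v c by (simp add: nat_pow_mult[symmetric] m_ac)
    then show "u \<otimes> v \<in> M'" using M'I u v by simp
  qed
  have MM': "M \<subseteq> M'" using M'I[of _ 0] by auto
  have cM': "c \<in> M'" using M'I[of \<one> 1] c by simp
  have finM': "finite M'" using subM' fin by (meson finite_subset subgroup.subset)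
  have finM: "finite M" using MM' finM' by (rule finite_subset)
  have [simp]: "x \<in> M' \<Longrightarrow> x \<in> carrier G" for x using subM' by (rule subgroup.mem_carrier)
  have cl'[simp]: "x \<in> M' \<Longrightarrow> w \<in> M' \<Longrightarrow> x \<otimes> w \<in> M'" "x \<in> M' \<Longrightarrow> inv x \<in> M'"
    "x \<in> M' \<Longrightarrow> x [^] (i::int) \<in> M'" for x w i
    using subM' by (auto intro: subgroup.m_closed subgroup.m_inv_closed subgroup_int_pow_closed)
  have cmem: "c \<otimes> x \<notin> M" if "x \<in> M" for x
  proof
    assume "c \<otimes> x \<in> M"
    then have "c \<otimes> x \<otimes> inv x \<in> M" using that by simp
    then show False using c that by (simp add: m_assoc)
  qed
  have cne: "c \<otimes> x \<noteq> \<one>" if "x \<in> M" for x using cmem[OF that] by auto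
  have S1sub: "S1 \<subseteq> M' - {\<one>}" using SM MM' cM' cne by (auto simp: S1_def)
  have S1M: "S1 \<inter> M = S" using SM cmem by (auto simp: S1_def)
  have cardS1: "card S1 = card S + card M - 1"
  proof -
    have "card ((\<otimes>) c ` (M - {\<one>})) = card (M - {\<one>})"
      using c by (intro card_image) (auto simp: inj_on_def)
    moreover have "S \<inter> (\<otimes>) c ` (M - {\<one>}) = {}" using SM cmem by auto
    moreover have "finite S" using SM finM by (auto intro: finite_subset)
    ultimately have "card S1 = card S + card (M - {\<one>})"
      unfolding S1_def using finM by (subst card_Un_disjoint) auto
    also have "card (M - {\<one>}) = card M - 1" by (simp add: card_Diff_singleton)
    finally show ?thesis using small by simp
  qed
  have alinj: "al ` N = N" if "al ` N \<subseteq> N" "N \<subseteq> M'" for N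
  proof (rule endo_inj_surj)
    show "finite N" using that finM' by (auto intro: finite_subset)
    show "inj_on al N" using that subgroup.subset[OF subM'] by (intro inj_on_subset[OF al_inj]) auto
  qed (use that in auto)
  have one: "al \<one> = \<one>" using hom_one[OF al_hom group_axioms group_axioms] .
  have alne: "al x \<noteq> \<one>" if "x \<noteq> \<one>" "x \<in> carrier G" for x
    using inj_onD[OF al_inj, of x \<one>] that one by auto
  have alM: "al x \<in> M" if "x \<in> M" for x using that gens by (simp add: al_def)
  have alM': "al x \<in> M'" if "x \<in> M'" for x
  proof -
    have "y \<in> M'" "z \<in> M'" using gens MM' by auto
    then show ?thesis using that by (simp add: al_def)
  qed
  have alS1: "al ` S1 = S1"
  proof (rule alinj)
    have "al (c \<otimes> m) \<in> (\<otimes>) c ` (M - {\<one>})" if "m \<in> M" "m \<noteq> \<one>" for m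
      using that c alM alne by (auto simp: al_mult)
    then show "al ` S1 \<subseteq> S1" using alS by (auto simp: S1_def)
  qed (use S1sub in auto)
  have stab1: "\<exists>i::nat. \<forall>x\<in>M'. f x = (al ^^ i) x" if "f \<in> cay_stab M' S1" for f
    using cay_stab_extend[OF M finM SM small stab al_hom c subM' finM' M'_def] that
    by (simp add: S1_def)
  have "card M dvd card M'"
  proof -
    interpret H: group "G\<lparr>carrier := M'\<rparr>" using subgroup_imp_group[OF subM'] .
    have "subgroup M (G\<lparr>carrier := M'\<rparr>)" using subgroup_incl[OF M subM' MM'] .
    from H.lagrange[OF this] have "card M' = card (rcosets\<^bsub>G\<lparr>carrier := M'\<rparr>\<^esub> M) * card M"
      by (simp add: order_def)
    then show ?thesis by (rule dvdI[OF trans]) (rule mult.commute)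
  qed
  then obtain k where k: "card M' = card M * k" by auto
  have lt: "card M < card M'" using MM' cM' c finM' by (intro psubset_card_mono) auto
  then have "k \<noteq> 0" "k \<noteq> 1" using k by auto
  then have "k = 2 \<or> 3 \<le> k" by linarith
  then show ?thesis
  proof
    assume "3 \<le> k"
    then have "card M * 3 \<le> card M'" unfolding k by (rule mult_left_mono) simp
    moreover have "\<exists>s\<in>S1. inv s \<notin> S1"
    proof -
      obtain s where "s \<in> S" "inv s \<notin> S" using asym by auto
      moreover have "inv s \<in> M" using \<open>s \<in> S\<close> SM by auto
      ultimately show ?thesis using S1M by (intro bexI[of _ s]) auto
    qed
    moreover have "2 \<le> card S1" "2 * card S1 + 2 < card M * 3" using ge2 small cardS1 by auto
    moreover have "{a, b, y, z} \<subseteq> M'" using gens MM' by blast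
    ultimately have "good M' S1"
      unfolding good_def using subM' S1sub alS1 stab1 by (intro conjI ballI) auto
    then show ?thesis using lt by blast
  next
    assume "k = 2"
    define S2 where "S2 = M' - {\<one>} - S1"
    have S2sub: "S2 \<subseteq> M' - {\<one>}" by (auto simp: S2_def)
    have "card S2 = card M' - 1 - card S1"
      unfolding S2_def using S1sub finM' subgroup.one_closed[OF subM']
      by (simp add: card_Diff_subset finite_subset card_Diff_singleton)
    then have cS2: "card S2 = card M - card S" using cardS1 k \<open>k = 2\<close> small by simp
    have alS2: "al ` S2 = S2"
    proof (rule alinj)
      show "al ` S2 \<subseteq> S2"
      proof
        fix u assume "u \<in> al ` S2"
        then obtain s where s: "s \<in> M'" "s \<noteq> \<one>" "s \<notin> S1" "u = al s" by (auto simp: S2_def)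
        have "al s \<notin> S1"
        proof
          assume "al s \<in> S1"
          then obtain t where "t \<in> S1" "al s = al t" using alS1 by blast
          moreover have "t \<in> carrier G" "s \<in> carrier G" using \<open>t \<in> S1\<close> s(1) S1sub by auto
          ultimately have "s = t" using inj_onD[OF al_inj, of s t] by blast
          then show False using s(3) \<open>t \<in> S1\<close> by blast
        qed
        then show "u \<in> S2" using s alM' alne by (auto simp: S2_def)
      qed
    qed (auto simp: S2_def)
    have "\<exists>s\<in>S2. inv s \<notin> S2"
    proof -
      \<comment> \<open>Passing to the complement exchanges the roles of \<open>s\<close> and
        \<open>inv s\<close>.\<close>
      obtain s where s: "s \<in> S" "inv s \<notin> S" using asym by auto
      then have "inv s \<in> M" "s \<in> carrier G" "s \<noteq> \<one>" using SM by auto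
      then have "inv s \<in> S2" using s S1M MM' by (auto simp: S2_def inv_eq_1_iff)
      moreover have "inv (inv s) \<notin> S2" using s \<open>s \<in> carrier G\<close> by (simp add: S2_def S1_def)
      ultimately show ?thesis by blast
    qed
    moreover have "\<exists>i::nat. \<forall>x\<in>M'. f x = (al ^^ i) x" if "f \<in> cay_stab M' S2" for f
      using stab1 cay_stab_compl[OF subM' _ S1sub] that unfolding S2_def by blast
    moreover have "2 \<le> card S2" "2 * card S2 + 2 < card M'" using cS2 k \<open>k = 2\<close> ge2 small by auto
    moreover have "{a, b, y, z} \<subseteq> M'" using gens MM' by blast
    ultimately have "good M' S2"
      unfolding good_def using subM' S2sub alS2 by (intro conjI ballI) auto
    then show ?thesis using lt by blast
  qed
qed

lemma phi_int_pow: "x \<in> carrier G \<Longrightarrow> [\<phi> (x [^] (i::int)) = i * \<phi> x] (mod int p)"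
  and psi_int_pow: "x \<in> carrier G \<Longrightarrow> [\<psi> (x [^] (i::int)) = i * \<psi> x] (mod int p)"
  using mod_hom_int_pow[OF phi_mult] mod_hom_int_pow[OF psi_mult] by blast+

lemma good_carrier:
  assumes "good M S"
  shows "\<exists>S. good (carrier G) S"
  using assms
proof (induction "card (carrier G) - card M" arbitrary: M S rule: less_induct)
  case less
  have M: "subgroup M G" and gens: "a \<in> M" "b \<in> M" using less.prems by (auto simp: good_def)
  have Mc: "M \<subseteq> carrier G" using M by (rule subgroup.subset)
  show ?case
  proof (cases "M = carrier G")
    case False
    then obtain x where x: "x \<in> carrier G" "x \<notin> M" using Mc by auto
    \<comment> \<open>Dividing out the \<open>a\<close>- and \<open>b\<close>-coordinates of
      \<open>x\<close> makes both homomorphisms vanish, so \<open>al\<close> fixes \<open>c\<close>;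
      the correcting factor lies in \<open>M\<close>, so \<open>c\<close> is still outside.\<close>
    define c where "c = x \<otimes> (a [^] (- \<phi> x) \<otimes> b [^] (- \<psi> x))"
    have m: "a [^] (- \<phi> x) \<otimes> b [^] (- \<psi> x) \<in> M"
      using M gens by (intro subgroup.m_closed subgroup_int_pow_closed)
    have "[\<phi> c = \<phi> x + (- \<phi> x * 1 + - \<psi> x * 0)] (mod int p)"
      unfolding c_def using x phi_vals phi_int_pow carr
      by (intro cong_trans[OF phi_mult] cong_add cong_refl cong_trans[OF phi_int_pow] cong_mult) auto
    moreover have "[\<psi> c = \<psi> x + (- \<phi> x * 0 + - \<psi> x * 1)] (mod int p)"
      unfolding c_def using x psi_vals psi_int_pow carr
      by (intro cong_trans[OF psi_mult] cong_add cong_refl cong_trans[OF psi_int_pow] cong_mult) auto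
    moreover have cc: "c \<in> carrier G" using x by (simp add: c_def)
    ultimately have "al c = c" by (intro al_fixed) auto
    moreover have "c \<notin> M"
    proof
      assume "c \<in> M"
      then have "c \<otimes> inv (a [^] (- \<phi> x) \<otimes> b [^] (- \<psi> x)) \<in> M"
        using subgroup.m_closed[OF M _ subgroup.m_inv_closed[OF M m]] by blast
      then show False using x by (simp add: c_def m_assoc del: int_pow_neg)
    qed
    ultimately obtain M' S' where "good M' S'" "card M < card M'"
      using good_extend[OF less.prems cc] by blast
    moreover have "card M' \<le> card (carrier G)"
      using \<open>good M' S'\<close> fin by (auto simp: good_def intro: card_mono dest: subgroup.subset)
    ultimately show ?thesis using less.hyps[of M' S'] by simp
  qed (use less.prems in blast)
qed

end

section \<open>Digraphs on the base subgroup\<close>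

text \<open>Inverses in a finite group are powers, so right multiplication by generators reaches
  everything. The claim is strengthened to an arbitrary starting point \<open>w\<close>, so that
  products of words can be composed.\<close>

lemma (in group) finite_generate_induct:
  assumes fin: "finite (carrier G)" and S: "S \<subseteq> carrier G" and x: "x \<in> generate G S"
    and one: "P \<one>" and step: "\<And>w s. w \<in> generate G S \<Longrightarrow> P w \<Longrightarrow> s \<in> S \<Longrightarrow> P (w \<otimes> s)"
  shows "P x"
proof -
  have sub: "subgroup (generate G S) G" by (rule generate_is_subgroup[OF S])
  have [simp]: "u \<in> generate G S \<Longrightarrow> u \<in> carrier G" for u by (rule subgroup.mem_carrier[OF sub])
  have "\<forall>w\<in>generate G S. P w \<longrightarrow> P (w \<otimes> x)" using x
  proof induction
    case (inv h)
    have hc: "h \<in> carrier G" and hg: "h \<in> generate G S" using inv S by (auto intro: generate.incl)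
    have pow: "\<forall>w\<in>generate G S. P w \<longrightarrow> P (w \<otimes> h [^] n)" for n :: nat
    proof (induction n)
      case (Suc n)
      show ?case
      proof (intro ballI impI)
        fix w assume w: "w \<in> generate G S" "P w"
        have "h [^] n \<in> generate G S" by (induction n) (auto intro: generate.one generate.eng hg)
        then have "P (w \<otimes> h [^] n \<otimes> h)" using Suc w inv by (blast intro: step generate.eng)
        then show "P (w \<otimes> h [^] Suc n)" using w hc by (simp add: m_assoc)
      qed
    qed auto
    have "order G > 0" using fin by (simp add: order_gt_0_iff_finite)
    then have "h [^] (order G - 1) \<otimes> h = \<one>"
      using hc pow_order_eq_1[OF hc] by (metis Suc_diff_1 nat_pow_Suc)
    then have "inv h = h [^] (order G - 1)" using hc by (intro inv_equality) auto
    then show ?case using pow by simp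
  next
    case (eng h1 h2)
    show ?case
    proof (intro ballI impI)
      fix w assume "w \<in> generate G S" "P w"
      then have "P (w \<otimes> h1 \<otimes> h2)" using eng by (blast intro: generate.eng)
      then show "P (w \<otimes> (h1 \<otimes> h2))" using eng \<open>w \<in> generate G S\<close> by (simp add: m_assoc)
    qed
  qed (auto intro: step)
  then have "P (\<one> \<otimes> x)" using one by (blast intro: generate.one)
  then show ?thesis using x by simp
qed

context comm_group begin

text \<open>The cocycle identity for recentring. Applied to \<open>u \<otimes> v\<close> and to
  \<open>v \<otimes> u\<close>, it links the action at \<open>x\<close> with the actions at two
  neighbouring vertices.\<close>

lemma diff_map_mult:
  assumes "subgroup M G" "f \<in> cay_stab M S" "x \<in> M" "u \<in> M" "v \<in> M"
  shows "diff_map f x (u \<otimes> v) = diff_map f x u \<otimes> diff_map f (x \<otimes> u) v"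
proof -
  have [simp]: "w \<in> M \<Longrightarrow> w \<in> carrier G" for w using assms(1) by (rule subgroup.mem_carrier)
  have m: "x \<otimes> u \<in> M" "x \<otimes> u \<otimes> v \<in> M" using assms by (auto intro: subgroup.m_closed)
  have fM: "w \<in> M \<Longrightarrow> f w \<in> carrier G" for w using cay_stabD(4)[OF assms(2), of w] by simp
  have "diff_map f x (u \<otimes> v) = inv (f x) \<otimes> f (x \<otimes> u \<otimes> v)"
    using assms by (simp add: diff_map_def m_assoc)
  also have "\<dots> = inv (f x) \<otimes> (f (x \<otimes> u) \<otimes> (inv (f (x \<otimes> u)) \<otimes> f (x \<otimes> u \<otimes> v)))"
    using fM[OF m(1)] fM[OF m(2)] by (simp add: m_assoc[symmetric])
  also have "\<dots> = diff_map f x u \<otimes> diff_map f (x \<otimes> u) v"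
    using fM[OF m(1)] fM[OF m(2)] fM[OF assms(3)] by (simp add: diff_map_def m_assoc)
  finally show ?thesis .
qed

text \<open>Being a product of two elements of \<open>S\<close> means that an out-neighbour of the
  identity has an arc from another out-neighbour, which is visible in the digraph. That
  \<open>f\<close> maps such elements to such elements follows directly; finiteness gives the
  converse.\<close>

lemma cay_stab_products:
  assumes M: "subgroup M G" and f: "f \<in> cay_stab M S" and S: "S \<subseteq> M" "finite S" and s: "s \<in> S"
  shows "(\<exists>t\<in>S. \<exists>u\<in>S. f s = t \<otimes> u) \<longleftrightarrow> (\<exists>t\<in>S. \<exists>u\<in>S. s = t \<otimes> u)"
proof -
  define N where "N = {s \<in> S. \<exists>t\<in>S. \<exists>u\<in>S. s = t \<otimes> u}"
  have fS: "f s \<in> S" if "s \<in> S" for s using cay_stab_image[OF M f, of s] that S by blast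
  have "f ` N \<subseteq> N"
  proof
    fix v assume "v \<in> f ` N"
    then obtain t u where tu: "t \<in> S" "u \<in> S" "t \<otimes> u \<in> S" "v = f (t \<otimes> u)" by (auto simp: N_def)
    then have "v = f t \<otimes> diff_map f t u" using cay_stab_mult[OF M f, of t u] S by blast
    moreover have "diff_map f t u \<in> S" using cay_stabD(3)[OF f, of t u] tu S by blast
    moreover have "v \<in> S" using fS tu by blast
    ultimately show "v \<in> N" using fS[OF tu(1)] unfolding N_def by blast
  qed
  moreover have inj: "inj_on f S"
    by (rule inj_on_subset[of f M]) (use cay_stabD(1)[OF f] S in \<open>auto simp: bij_betw_def\<close>)
  moreover have "N \<subseteq> S" "finite N" using S by (auto simp: N_def)
  ultimately have "f ` N = N" using inj_on_subset by (intro endo_inj_surj) blast+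
  then have "f s \<in> N \<longleftrightarrow> f s \<in> f ` N" by (rule arg_cong[OF sym])
  also have "\<dots> \<longleftrightarrow> s \<in> N" using inj s \<open>N \<subseteq> S\<close> by (rule inj_on_image_mem_iff)
  finally show ?thesis using s fS by (simp add: N_def)
qed

end

section \<open>Orbits of \<open>al\<close> and the residues that tell them apart\<close>

context unipotent_data begin

definition orb :: "'a \<Rightarrow> 'a set" where
  "orb x = range (\<lambda>i. (al ^^ i) x)"

lemma orb_I [simp]: "(al ^^ i) x \<in> orb x"
  by (simp add: orb_def)

lemma orb_self [simp]: "x \<in> orb x"
  using orb_I[of 0 x] by simp

lemma orb_E: "u \<in> orb x \<Longrightarrow> (\<And>i. u = (al ^^ i) x \<Longrightarrow> thesis) \<Longrightarrow> thesis"
  by (auto simp: orb_def)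

lemma orb_lessThan: "x \<in> carrier G \<Longrightarrow> orb x = (\<lambda>i. (al ^^ i) x) ` {..<p}"
proof -
  assume x: "x \<in> carrier G"
  have "(al ^^ i) x \<in> (\<lambda>i. (al ^^ i) x) ` {..<p}" for i
    using al_pow_cong[OF x, of i "i mod p"] p3 by (intro image_eqI[of _ _ "i mod p"]) (auto simp: cong_def)
  then show ?thesis by (auto simp: orb_def)
qed

lemma orb_finite: "x \<in> carrier G \<Longrightarrow> finite (orb x)"
  by (simp add: orb_lessThan)

lemma orb_card: "x \<in> carrier G \<Longrightarrow> card (orb x) \<le> p"
  using card_image_le[of "{..<p}" "\<lambda>i. (al ^^ i) x"] by (simp add: orb_lessThan)

lemma orb_subset: "x \<in> carrier G \<Longrightarrow> orb x \<subseteq> carrier G"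
  by (auto simp: orb_def)

lemma al_orb: "x \<in> carrier G \<Longrightarrow> al ` orb x = orb x"
proof
  show "al ` orb x \<subseteq> orb x" using orb_I[of "Suc _" x] by (auto simp: orb_def)
  assume x: "x \<in> carrier G"
  show "orb x \<subseteq> al ` orb x"
  proof
    fix u assume "u \<in> orb x"
    then obtain i where i: "u = (al ^^ i) x" by (rule orb_E)
    have "u = (al ^^ (Suc (i + (p - 1)))) x"
      unfolding i using p3 by (intro al_pow_cong[OF x]) (simp add: cong_def)
    then show "u \<in> al ` orb x" by (intro image_eqI[of _ _ "(al ^^ (i + (p - 1))) x"]) auto
  qed
qed

lemma small_cong:
  assumes "[i = j] (mod int p)" "\<bar>i - j\<bar> < 3"
  shows "i = j"
proof (rule ccontr)
  assume "i \<noteq> j"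
  then have "int p \<le> \<bar>i - j\<bar>"
    using assms(1) by (intro zdvd_imp_le) (auto simp: cong_iff_dvd_diff)
  then show False using assms(2) p3 by simp
qed

text \<open>\<open>al\<close> multiplies by powers of \<open>y\<close> and \<open>z\<close>, both
  killed by \<phi>.\<close>

lemma phi_al_pow: "x \<in> carrier G \<Longrightarrow> [\<phi> ((al ^^ n) x) = \<phi> x] (mod int p)"
proof (induction n)
  case (Suc n)
  let ?u = "(al ^^ n) x"
  have u: "?u \<in> carrier G" using Suc.prems by simp
  have "[\<phi> (al ?u) = (\<phi> ?u + \<phi> ?u * 0) + \<psi> ?u * 0] (mod int p)"
    unfolding al_def[of ?u] using u phi_vals phi_int_pow carr
    by (intro cong_trans[OF phi_mult] cong_add cong_refl cong_trans[OF phi_int_pow] cong_mult) auto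
  then show ?case using cong_trans[OF _ Suc.IH[OF Suc.prems]] by simp
qed auto

text \<open>One application of \<open>al\<close> changes \<psi> by \<phi>(x) \<psi>(y); either
  hypothesis makes this product vanish.\<close>

lemma psi_al_pow:
  "x \<in> carrier G \<Longrightarrow> [\<phi> x = 0] (mod int p) \<or> [\<psi> y = 0] (mod int p) \<Longrightarrow> [\<psi> ((al ^^ n) x) = \<psi> x] (mod int p)"
proof (induction n)
  case (Suc n)
  let ?u = "(al ^^ n) x"
  have u: "?u \<in> carrier G" using Suc.prems by simp
  have "[\<psi> (al ?u) = (\<psi> ?u + \<phi> ?u * \<psi> y) + \<psi> ?u * 0] (mod int p)"
    unfolding al_def[of ?u] using u psi_vals psi_int_pow carr
    by (intro cong_trans[OF psi_mult] cong_add cong_refl cong_trans[OF psi_int_pow] cong_mult) auto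
  moreover have "[\<phi> ?u * \<psi> y = 0] (mod int p)"
    using Suc.prems(2)
  proof
    assume "[\<phi> x = 0] (mod int p)"
    then have "[\<phi> ?u = 0] (mod int p)" by (rule cong_trans[OF phi_al_pow[OF Suc.prems(1)]])
    then show ?thesis using cong_mult[OF _ cong_refl, of "\<phi> ?u" 0] by simp
  next
    assume "[\<psi> y = 0] (mod int p)"
    then show ?thesis using cong_mult[OF cong_refl, of "\<psi> y" 0] by simp
  qed
  then have "[\<psi> ?u + \<phi> ?u * \<psi> y + \<psi> ?u * 0 = \<psi> ?u + 0 + \<psi> ?u * 0] (mod int p)"
    by (intro cong_add cong_refl)
  ultimately have "[\<psi> (al ?u) = \<psi> ?u + 0 + \<psi> ?u * 0] (mod int p)"
    by (rule cong_trans)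
  then show ?case using cong_trans[OF _ Suc.IH[OF Suc.prems]] by simp
qed auto

text \<open>The products of powers of \<open>a\<close>, \<open>b\<close>, \<open>z\<close> with
  exponents below p are distinct: \<phi> and \<psi> read off the first two exponents, and
  \<open>z\<close> has order p.\<close>

lemma card_ge_cube:
  assumes M: "subgroup M G" and gens: "a \<in> M" "b \<in> M" "z \<in> M"
  shows "p * p * p \<le> card M"
proof -
  define h where "h = (\<lambda>(i, j, k). a [^] int i \<otimes> b [^] int j \<otimes> z [^] int k)"
  let ?I = "{..<p} \<times> {..<p} \<times> {..<p}"
  have phi: "[\<phi> (h (i, j, k)) = int i] (mod int p)" for i j k
  proof -
    have "[\<phi> (h (i, j, k)) = (int i * 1 + int j * 0) + int k * 0] (mod int p)"
      unfolding h_def prod.case using phi_vals carr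
      by (intro cong_trans[OF phi_mult] cong_add cong_trans[OF phi_int_pow] cong_mult cong_refl) auto
    then show ?thesis by simp
  qed
  have psi: "[\<psi> (h (i, j, k)) = int j] (mod int p)" for i j k
  proof -
    have "[\<psi> (h (i, j, k)) = (int i * 0 + int j * 1) + int k * 0] (mod int p)"
      unfolding h_def prod.case using psi_vals carr
      by (intro cong_trans[OF psi_mult] cong_add cong_trans[OF psi_int_pow] cong_mult cong_refl) auto
    then show ?thesis by simp
  qed
  have lt: "i = i'" if "[int i = int i'] (mod int p)" "i < p" "i' < p" for i i'
    using that by (simp add: cong_int_iff cong_less_modulus_unique_nat)
  have "inj_on h ?I"
  proof (rule inj_onI, clarsimp)
    fix i j k i' j' k'
    assume ij: "i < p" "j < p" "k < p" "i' < p" "j' < p" "k' < p" and eq: "h (i, j, k) = h (i', j', k')"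
    have "i = i'" using phi[of i j k] phi[of i' j' k'] eq ij by (intro lt) (metis cong_sym cong_trans)
    moreover have "j = j'" using psi[of i j k] psi[of i' j' k'] eq ij by (intro lt) (metis cong_sym cong_trans)
    ultimately have "z [^] int k = z [^] int k'" using eq by (simp add: h_def m_assoc)
    then have "y [^] (0::int) \<otimes> z [^] int k = y [^] (0::int) \<otimes> z [^] int k'" by simp
    then have "[int k = int k'] (mod int p)" unfolding yz_eq by blast
    then have "k = k'" using ij by (intro lt)
    then show "i = i' \<and> j = j' \<and> k = k'" using \<open>i = i'\<close> \<open>j = j'\<close> by simp
  qed
  moreover have "h ` ?I \<subseteq> M"
    using M gens by (auto simp: h_def intro!: subgroup.m_closed subgroup_int_pow_closed)
  moreover have "finite M" using subgroup.subset[OF M] fin by (rule finite_subset)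
  ultimately have "card ?I \<le> card M" by (rule card_inj_on_le)
  then show ?thesis by (simp add: card_cartesian_product mult.assoc)
qed

text \<open>The exponent with which \<open>f\<close>, recentred at \<open>x\<close>, acts on
  \<open>S\<close> is a local datum of the vertex \<open>x\<close>. If it does not change along
  arcs, then \<open>f\<close> is that power of \<open>al\<close> on the whole generated
  subgroup.\<close>

lemma cay_stab_eq_al_pow:
  assumes S: "S \<subseteq> carrier G" and f: "f \<in> cay_stab (generate G S) S"
    and start: "\<forall>s\<in>S. diff_map f \<one> s = (al ^^ k) s"
    and step: "\<And>x s. x \<in> generate G S \<Longrightarrow> \<forall>s\<in>S. diff_map f x s = (al ^^ k) s \<Longrightarrow> s \<in> S \<Longrightarrow>
      \<forall>t\<in>S. diff_map f (x \<otimes> s) t = (al ^^ k) t"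
  shows "\<forall>x\<in>generate G S. f x = (al ^^ k) x"
proof
  fix x assume "x \<in> generate G S"
  then have "f x = (al ^^ k) x \<and> (\<forall>s\<in>S. diff_map f x s = (al ^^ k) s)"
  proof (rule finite_generate_induct[OF fin S])
    have "(al ^^ k) \<one> = \<one>"
      by (induction k) (auto simp: hom_one[OF al_hom group_axioms group_axioms])
    then show "f \<one> = (al ^^ k) \<one> \<and> (\<forall>s\<in>S. diff_map f \<one> s = (al ^^ k) s)"
      using start cay_stabD(2)[OF f] by simp
  next
    fix w s assume w: "w \<in> generate G S" and s: "s \<in> S"
      and IH: "f w = (al ^^ k) w \<and> (\<forall>s\<in>S. diff_map f w s = (al ^^ k) s)"
    have "f (w \<otimes> s) = f w \<otimes> diff_map f w s"
      using cay_stab_mult[OF generate_is_subgroup[OF S] f w generate.incl[OF s]] .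
    also have "\<dots> = (al ^^ k) (w \<otimes> s)"
      using IH s S w generate_in_carrier[OF S w] by (subst al_pow_mult) auto
    finally show "f (w \<otimes> s) = (al ^^ k) (w \<otimes> s) \<and> (\<forall>t\<in>S. diff_map f (w \<otimes> s) t = (al ^^ k) t)"
      using step[OF w] IH s by blast
  qed
  then show "f x = (al ^^ k) x" by simp
qed

lemma al_a: "al a = a \<otimes> y"
  using pow_cong(1)[OF phi_vals(1)] pow_cong(2)[OF psi_vals(1)] by (simp add: al_def)

lemma a_pow: "(al ^^ n) a = a \<otimes> y [^] int n \<otimes> z [^] (\<psi> y * int (n choose 2))"
proof -
  have "[int n * \<phi> a = int n * 1] (mod int p)" using phi_vals by (intro cong_mult) auto
  moreover have "[int n * \<psi> a + \<psi> y * int (n choose 2) * \<phi> a = int n * 0 + \<psi> y * int (n choose 2) * 1] (mod int p)"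
    using phi_vals psi_vals by (intro cong_add cong_mult cong_refl)
  ultimately show ?thesis using pow_cong[of "int n * \<phi> a"] pow_cong(2) by (simp add: al_pow_formula)
qed

lemma ker_pow: "x \<in> carrier G \<Longrightarrow> [\<phi> x = 0] (mod int p) \<Longrightarrow> [\<psi> x = k] (mod int p) \<Longrightarrow>
  (al ^^ n) x = x \<otimes> z [^] (int n * k)"
proof -
  assume x: "x \<in> carrier G" and phi: "[\<phi> x = 0] (mod int p)" and psi: "[\<psi> x = k] (mod int p)"
  have "[int n * \<phi> x = int n * 0] (mod int p)" using phi by (intro cong_mult) auto
  moreover have "[int n * \<psi> x + \<psi> y * int (n choose 2) * \<phi> x = int n * k + \<psi> y * int (n choose 2) * 0] (mod int p)"
    using phi psi by (intro cong_add cong_mult cong_refl)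
  ultimately show ?thesis using x pow_cong(1)[of "int n * \<phi> x" 0] pow_cong(2) by (simp add: al_pow_formula)
qed

lemma a_pow_inj: "(al ^^ i) a = (al ^^ j) a \<Longrightarrow> [i = j] (mod p)"
proof -
  assume "(al ^^ i) a = (al ^^ j) a"
  then have "y [^] int i \<otimes> z [^] (\<psi> y * int (i choose 2)) = y [^] int j \<otimes> z [^] (\<psi> y * int (j choose 2))"
    by (simp add: a_pow m_assoc)
  then show ?thesis unfolding yz_eq by (simp add: cong_int_iff)
qed

lemma b_pow: "(al ^^ n) b = b \<otimes> z [^] int n"
  using ker_pow[OF carr(2) phi_vals(2) psi_vals(2)] by simp

lemma b_pow_inj: "(al ^^ i) b = (al ^^ j) b \<Longrightarrow> [i = j] (mod p)"
proof -
  assume "(al ^^ i) b = (al ^^ j) b"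
  then have "y [^] (0::int) \<otimes> z [^] int i = y [^] (0::int) \<otimes> z [^] int j"
    by (simp add: b_pow)
  then show ?thesis unfolding yz_eq by (simp add: cong_int_iff)
qed

lemma phi_mult_cong: "t \<in> carrier G \<Longrightarrow> u \<in> carrier G \<Longrightarrow> [\<phi> t = k] (mod int p) \<Longrightarrow> [\<phi> u = l] (mod int p) \<Longrightarrow>
    [\<phi> (t \<otimes> u) = k + l] (mod int p)"
  by (rule cong_trans[OF phi_mult cong_add])

lemma psi_mult_cong: "t \<in> carrier G \<Longrightarrow> u \<in> carrier G \<Longrightarrow> [\<psi> t = k] (mod int p) \<Longrightarrow> [\<psi> u = l] (mod int p) \<Longrightarrow>
    [\<psi> (t \<otimes> u) = k + l] (mod int p)"
  by (rule cong_trans[OF psi_mult cong_add])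

lemma phi_unique: "[\<phi> t = k] (mod int p) \<Longrightarrow> [\<phi> t = l] (mod int p) \<Longrightarrow> \<bar>k - l\<bar> < 3 \<Longrightarrow> k = l"
  by (rule small_cong[OF cong_trans[OF cong_sym]])

lemma psi_unique: "[\<psi> t = k] (mod int p) \<Longrightarrow> [\<psi> t = l] (mod int p) \<Longrightarrow> \<bar>k - l\<bar> < 3 \<Longrightarrow> k = l"
  by (rule small_cong[OF cong_trans[OF cong_sym]])

lemma phi_one: "[\<phi> \<one> = 0] (mod int p)"
  using phi_int_pow[of a 0] by simp

lemma psi_one: "[\<psi> \<one> = 0] (mod int p)"
  using psi_int_pow[of a 0] by simp

lemma phi_inv_a: "[\<phi> (inv a) = -1] (mod int p)"
proof -
  have "[\<phi> (inv a) = -1 * \<phi> a] (mod int p)"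
    using phi_int_pow[of a "-1"] int_pow_neg[of a 1] by simp
  then show ?thesis using cong_trans[OF _ cong_mult[OF cong_refl phi_vals(1)]] by fastforce
qed

text \<open>The step only moves forward in the orbit of \<open>a\<close>, but indices count modulo
  p, so it wraps around to every element.\<close>

lemma al_pow_shift:
  assumes step: "\<And>i. g ((al ^^ i) a) = (al ^^ (i + k)) a \<Longrightarrow> g ((al ^^ Suc i) a) = (al ^^ (Suc i + k)) a"
    and start: "g ((al ^^ i0) a) = (al ^^ (i0 + k)) a"
  shows "g ((al ^^ i) a) = (al ^^ (i + k)) a"
proof -
  have *: "g ((al ^^ (i0 + j)) a) = (al ^^ (i0 + j + k)) a" for j
  proof (induction j)
    case (Suc j)
    then show ?case using step[of "i0 + j"] by simp
  qed (simp add: start)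
  \<comment> \<open>A natural number with i0 + j congruent to i modulo p, replacing the difference i
    - i0.\<close>
  define j where "j = i + i0 * (p - 1)"
  have "i0 + j = i + i0 * p" using p3 by (cases p) (auto simp: j_def)
  then have "[i0 + j = i] (mod p)" by (simp add: cong_def)
  moreover from this have "[i0 + j + k = i + k] (mod p)" by (intro cong_add cong_refl)
  ultimately have "(al ^^ (i0 + j)) a = (al ^^ i) a" "(al ^^ (i0 + j + k)) a = (al ^^ (i + k)) a"
    by (simp_all only: al_pow_cong[OF carr(1)])
  then show ?thesis using *[of j] by simp
qed

lemma al_pow_add: "(al ^^ k) ((al ^^ i) x) = (al ^^ (i + k)) x"
  by (simp add: funpow_add add.commute[of i k])

text \<open>The bound 3p + 1 is three orbits and a fixed point; 2(3p + 1) + 2 < 9p \<le> p^3 since p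
  is at least 3. For the same reason \<phi> of \<open>inv a\<close>, which is -1, is neither 0 nor
  1, so \<open>inv a\<close> is outside \<open>S\<close>. The element \<open>z\<close> is generated
  as the quotient of \<open>al b\<close> by \<open>b\<close>.\<close>

lemma good_generate:
  assumes S: "S \<subseteq> carrier G" "finite S" and mem: "a \<in> S" "b \<in> S" "al b \<in> S"
    and y: "y \<in> S" and alS: "al ` S = S" and card: "card S \<le> 3 * p + 1"
    and phiS: "\<And>s. s \<in> S \<Longrightarrow> s \<noteq> \<one> \<and> ([\<phi> s = 0] (mod int p) \<or> [\<phi> s = 1] (mod int p))"
    and stab: "\<And>f. f \<in> cay_stab (generate G S) S \<Longrightarrow> \<exists>k. \<forall>x\<in>generate G S. f x = (al ^^ k) x"
  shows "good (generate G S) S"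
proof -
  let ?M = "generate G S"
  have M: "subgroup ?M G" by (rule generate_is_subgroup[OF S(1)])
  have SM: "S \<subseteq> ?M" by (auto intro: generate.incl)
  have "inv b \<otimes> al b = z"
    using b_pow[of 1] by (simp add: m_assoc[symmetric])
  moreover have "inv b \<otimes> al b \<in> ?M"
    using M SM mem by (auto intro: subgroup.m_closed subgroup.m_inv_closed)
  ultimately have z: "z \<in> ?M" by simp
  have "a \<noteq> b"
    using phi_unique[of a 1 0] phi_vals by auto
  then have "card {a, b} = 2" by simp
  then have "2 \<le> card S" using mem S card_mono[of S "{a, b}"] by simp
  moreover have "p * p * p \<le> card ?M" using card_ge_cube[OF M] SM mem z by blast
  moreover have "9 * p \<le> p * p * p" using mult_le_mono[OF mult_le_mono[OF p3 p3], of p p] by simp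
  moreover have "inv a \<notin> S"
  proof
    assume "inv a \<in> S"
    then show False
      using phiS[of "inv a"] phi_unique[OF phi_inv_a, of 0] phi_unique[OF phi_inv_a, of 1] by auto
  qed
  moreover from calculation have "2 * card S + 2 < card ?M" using card p3 by linarith
  ultimately show ?thesis
    unfolding good_def using M SM mem y z alS phiS stab by (intro conjI ballI) auto
qed

text \<open>Here \<open>al a = a \<otimes> b\<close>, so each element of the orbit of
  \<open>a\<close> times the matching element of the orbit of \<open>b\<close> is the next element
  of the orbit of \<open>a\<close>. By \<open>key\<close> no other product of one element from each
  orbit lies in the orbit of \<open>a\<close>, so these relations tie all indices together.\<close>

lemma good_of_y_eq_b:
  assumes yb: "y = b"
  shows "\<exists>M S. good M S"
proof -
  define S where "S = orb a \<union> orb b"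
  let ?M = "generate G S"
  let ?A = "\<lambda>i. (al ^^ i) a" and ?B = "\<lambda>i. (al ^^ i) b"
  have Sc: "S \<subseteq> carrier G" using orb_subset by (simp add: S_def)
  have M: "subgroup ?M G" by (rule generate_is_subgroup[OF Sc])
  have finS: "finite S" using orb_finite by (simp add: S_def)
  have SM: "S \<subseteq> ?M" by (auto intro: generate.incl)
  have AS: "?A i \<in> S" and BS: "?B i \<in> S" for i by (auto simp: S_def)
  have AM: "?A i \<in> ?M" and BM: "?B i \<in> ?M" for i using AS BS SM by auto
  have SE: "(\<exists>i. s = ?A i) \<or> (\<exists>i. s = ?B i)" if "s \<in> S" for s
    using that by (auto simp: S_def orb_def)
  have phiA: "[\<phi> (?A i) = 1] (mod int p)" for i by (rule cong_trans[OF phi_al_pow phi_vals(1)]) simp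
  have phiB: "[\<phi> (?B i) = 0] (mod int p)" for i by (rule cong_trans[OF phi_al_pow phi_vals(2)]) simp
  have psiB: "[\<psi> (?B i) = 1] (mod int p)" for i
    by (rule cong_trans[OF psi_al_pow psi_vals(2)]) (auto simp: phi_vals)
  have yB: "(al ^^ i) y = ?B i" for i by (rule arg_cong[OF yb])
  have A_Suc: "?A (Suc i) = ?A i \<otimes> ?B i" for i
  proof -
    have "?A (Suc i) = (al ^^ i) (al a)" by (simp add: funpow_swap1)
    then show ?thesis by (simp add: al_a al_pow_mult yB)
  qed
  have y_pow: "?B n = y \<otimes> z [^] int n" for n
    by (rule trans[OF b_pow]) (rule arg_cong[OF yb[symmetric]])
  \<comment> \<open>The exponent of \<open>y\<close> determines q. The exponent of \<open>z\<close>
    carries binomial coefficients, which are avoided by comparison with the known relation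
    \<open>A_Suc\<close>.\<close>
  have key: "[q = Suc s] (mod p) \<and> [r = s] (mod p)" if eq: "?A s \<otimes> ?B r = ?A q" for s r q
  proof -
    have "?A s \<otimes> ?B r = a \<otimes> (y [^] (int s + 1) \<otimes> z [^] (\<psi> y * int (s choose 2) + int r))"
      by (simp add: a_pow y_pow int_pow_mult m_ac)
    also have "?A s \<otimes> ?B r = a \<otimes> (y [^] int q \<otimes> z [^] (\<psi> y * int (q choose 2)))"
      unfolding eq by (simp add: a_pow m_assoc)
    finally have "y [^] int q \<otimes> z [^] (\<psi> y * int (q choose 2)) =
        y [^] (int s + 1) \<otimes> z [^] (\<psi> y * int (s choose 2) + int r)"
      by simp
    then have "[int q = int (Suc s)] (mod int p)" unfolding yz_eq by (simp add: add.commute)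
    then have q: "[q = Suc s] (mod p)" by (simp only: cong_int_iff)
    have "?A s \<otimes> ?B r = ?A s \<otimes> ?B s" unfolding eq A_Suc[symmetric] by (rule al_pow_cong[OF carr(1) q])
    then have "?B r = ?B s" by simp
    then show ?thesis using q b_pow_inj by blast
  qed
  have stab: "\<exists>k. \<forall>x\<in>?M. f x = (al ^^ k) x" if f: "f \<in> cay_stab ?M S" for f
  proof -
    \<comment> \<open>Being a product of two elements of \<open>S\<close> separates the two orbits.
      For an element of the orbit of \<open>b\<close>, \<phi> forces both factors into that orbit,
      and then \<psi> would be 2 instead of 1.\<close>
    have prodA: "\<exists>t\<in>S. \<exists>u\<in>S. ?A i = t \<otimes> u" for i
    proof -
      have "?A i = ?A (Suc (i + (p - 1)))"
        using p3 by (intro al_pow_cong) (auto simp: cong_def)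
      then show ?thesis unfolding A_Suc using AS BS by blast
    qed
    have prodB: "\<not> (\<exists>t\<in>S. \<exists>u\<in>S. ?B i = t \<otimes> u)" for i
    proof (intro notI, elim bexE)
      fix t u assume tu: "t \<in> S" "u \<in> S" "?B i = t \<otimes> u"
      have phi: "k + l = 0" if "[\<phi> t = k] (mod int p)" "[\<phi> u = l] (mod int p)" "\<bar>k + l\<bar> < 3" for k l
        using phi_unique[OF phi_mult_cong[OF _ _ that(1,2)], of 0] phiB[of i] tu Sc that(3) by auto
      have "\<exists>j. t = ?B j" "\<exists>j. u = ?B j"
        using SE[OF tu(1)] SE[OF tu(2)] phi[of 1 1] phi[of 0 1] phi[of 1 0] phiA phiB by fastforce+
      then have "[\<psi> (t \<otimes> u) = 1 + 1] (mod int p)"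
        using psi_mult_cong[OF _ _ psiB psiB] by fastforce
      then show False using psi_unique[of "t \<otimes> u" "1 + 1" 1] psiB[of i] tu(3) by simp
    qed
    have orbA: "\<exists>q. g (?A i) = ?A q" and orbB: "\<exists>q. g (?B i) = ?B q" if g: "g \<in> cay_stab ?M S" for g i
    proof -
      have "g (?A i) \<in> S" "g (?B i) \<in> S"
        using cay_stab_image[OF M g AM[of i]] cay_stab_image[OF M g BM[of i]] AS BS by auto
      then show "\<exists>q. g (?A i) = ?A q" "\<exists>q. g (?B i) = ?B q"
        using cay_stab_products[OF M g SM finS AS[of i]] cay_stab_products[OF M g SM finS BS[of i]]
          prodA[of i] prodB prodB[of i] SE prodA by metis+
    qed
    \<comment> \<open>The vertex \<open>x \<otimes> ?A (Suc i)\<close> is reached from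
      \<open>x\<close> by \<open>?A i\<close> and \<open>?B i\<close> in either order. Applying
      \<open>key\<close> to the image of each path fixes all the unknown indices.\<close>
    have step: "diff_map f x (?A (Suc i)) = ?A (Suc i + k) \<and> diff_map f (x \<otimes> ?A i) (?B i) = ?B (i + k) \<and>
        diff_map f x (?B i) = ?B (i + k) \<and> diff_map f (x \<otimes> ?B i) (?A i) = ?A (i + k)"
      if x: "x \<in> ?M" and eq: "diff_map f x (?A i) = ?A (i + k)" for x i k
    proof -
      have xA: "x \<otimes> ?A i \<in> ?M" and xB: "x \<otimes> ?B i \<in> ?M"
        using x AM BM M by (auto intro: subgroup.m_closed)
      obtain q where q: "diff_map f x (?A (Suc i)) = ?A q"
        using orbA[OF diff_map_cay_stab[OF M f x]] by blast
      obtain r where r: "diff_map f (x \<otimes> ?A i) (?B i) = ?B r"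
        using orbB[OF diff_map_cay_stab[OF M f xA]] by blast
      obtain r' where r': "diff_map f x (?B i) = ?B r'"
        using orbB[OF diff_map_cay_stab[OF M f x]] by blast
      obtain s where s: "diff_map f (x \<otimes> ?B i) (?A i) = ?A s"
        using orbA[OF diff_map_cay_stab[OF M f xB]] by blast
      have "?A (i + k) \<otimes> ?B r = ?A q"
        using diff_map_mult[OF M f x AM[of i] BM[of i]] eq q r by (simp add: A_Suc del: funpow.simps)
      then have 1: "[q = Suc (i + k)] (mod p)" "[r = i + k] (mod p)" using key by blast+
      have "?A s \<otimes> ?B r' = ?A q"
        using diff_map_mult[OF M f x BM[of i] AM[of i]] s q r'
        by (simp add: A_Suc m_comm[of "?B _"] del: funpow.simps)
      then have 2: "[q = Suc s] (mod p)" "[r' = s] (mod p)" using key by blast+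
      then have "[Suc s = Suc (i + k)] (mod p)" using 1 by (metis cong_sym cong_trans)
      then have 3: "[s = i + k] (mod p)" using cong_add_rcancel_nat[of s 1 "i + k" p] by simp
      then have 4: "[r' = i + k] (mod p)" using 2 cong_trans by blast
      show ?thesis
        using q r r' s al_pow_cong[OF carr(1) 1(1)] al_pow_cong[OF carr(2) 1(2)]
          al_pow_cong[OF carr(2) 4] al_pow_cong[OF carr(1) 3] by simp
    qed
    have all: "diff_map f x (?A i) = ?A (i + k) \<and> diff_map f x (?B i) = ?B (i + k)"
      if x: "x \<in> ?M" and start: "diff_map f x (?A j) = ?A (j + k)" for x i j k
    proof -
      have "diff_map f x (?A i) = ?A (i + k)"
        by (rule al_pow_shift[where g = "diff_map f x", OF _ start]) (use step[OF x] in blast)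
      then show ?thesis using step[OF x] by blast
    qed
    have R: "\<forall>s\<in>S. diff_map f x s = (al ^^ k) s"
      if x: "x \<in> ?M" and start: "diff_map f x (?A j) = ?A (j + k)" for x j k
    proof
      fix s assume "s \<in> S"
      then consider i where "s = ?A i" | i where "s = ?B i" using SE by blast
      then show "diff_map f x s = (al ^^ k) s"
        using all[OF x start] by cases (simp_all only: al_pow_add)
    qed
    obtain k where k: "diff_map f \<one> (?A 0) = ?A (0 + k)"
      using orbA[OF diff_map_cay_stab[OF M f subgroup.one_closed[OF M]]] by (metis add_0)
    show ?thesis
    proof (intro exI[of _ k] cay_stab_eq_al_pow[OF Sc f])
      show "\<forall>s\<in>S. diff_map f \<one> s = (al ^^ k) s" by (rule R[OF subgroup.one_closed[OF M] k])
    next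
      fix x s assume x: "x \<in> ?M" and eq: "\<forall>s\<in>S. diff_map f x s = (al ^^ k) s" and s: "s \<in> S"
      have xs: "x \<otimes> s \<in> ?M" using x s SM M by (auto intro: subgroup.m_closed)
      have eqA: "diff_map f x (?A i) = ?A (i + k)" for i using eq AS by (simp add: al_pow_add)
      show "\<forall>t\<in>S. diff_map f (x \<otimes> s) t = (al ^^ k) t"
        using SE[OF s]
      proof
        assume "\<exists>i. s = ?B i"
        then show ?thesis using step[OF x eqA] R[OF xs] by blast
      next
        assume "\<exists>i. s = ?A i"
        then obtain i where i: "s = ?A i" by blast
        \<comment> \<open>The exponent l at the new vertex is unknown at first. It is compared with
          k on \<open>?B i\<close>, whose image there is already known from the square at
          \<open>x\<close>.\<close>
        obtain l where l: "diff_map f (x \<otimes> s) (?A 0) = ?A (0 + l)"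
          using orbA[OF diff_map_cay_stab[OF M f xs]] by (metis add_0)
        have "diff_map f (x \<otimes> s) (?B i) = ?B (i + l)" using all[OF xs l] by blast
        moreover have "diff_map f (x \<otimes> s) (?B i) = ?B (i + k)" using step[OF x eqA] i by blast
        ultimately have "[i + l = i + k] (mod p)" by (intro b_pow_inj) simp
        then have "[l = k] (mod p)" by (simp add: cong_add_lcancel_nat)
        then have "?A (0 + l) = ?A (0 + k)" by (intro al_pow_cong) auto
        then show ?thesis using R[OF xs, of 0 k] l by simp
      qed
    qed
  qed
  have "good ?M S"
  proof (rule good_generate[OF Sc finS])
    show "a \<in> S" "b \<in> S" "al b \<in> S" using AS[of 0] BS[of 0] BS[of 1] by auto
    then show "y \<in> S" by (simp only: yb)
    show "al ` S = S" by (simp add: S_def image_Un al_orb)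
    have "card S \<le> card (orb a) + card (orb b)" unfolding S_def by (rule card_Un_le)
    then show "card S \<le> 3 * p + 1" using orb_card[OF carr(1)] orb_card[OF carr(2)] by simp
  next
    fix s assume "s \<in> S"
    then have "[\<phi> s = 0] (mod int p) \<and> [\<psi> s = 1] (mod int p) \<or> [\<phi> s = 1] (mod int p)"
      using SE[of s] phiA phiB psiB by blast
    moreover have "\<not> [\<phi> \<one> = 1] (mod int p)" "\<not> [\<psi> \<one> = 1] (mod int p)"
      using phi_unique[OF phi_one, of 1] psi_unique[OF psi_one, of 1] by auto
    ultimately show "s \<noteq> \<one> \<and> ([\<phi> s = 0] (mod int p) \<or> [\<phi> s = 1] (mod int p))"
      by blast
  qed (rule stab)
  then show ?thesis by blast
qed

text \<open>Now \<open>al\<close> fixes \<open>y\<close>, and multiplication by \<open>y\<close>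
  advances the orbit of \<open>a\<close>. Nothing links this to the orbit of \<open>b\<close> yet,
  so the orbit of \<open>a \<otimes> b\<close> is added: by \<open>key\<close> a product from the
  orbits of \<open>a\<close> and \<open>b\<close> lies in it only if the indices agree.\<close>

lemma good_of_psi_y_zero:
  assumes psiy: "[\<psi> y = 0] (mod int p)"
  shows "\<exists>M S. good M S"
proof -
  define S where "S = {y} \<union> (orb a \<union> orb b \<union> orb (a \<otimes> b))"
  let ?M = "generate G S"
  let ?A = "\<lambda>i. (al ^^ i) a" and ?B = "\<lambda>i. (al ^^ i) b" and ?C = "\<lambda>i. (al ^^ i) (a \<otimes> b)"
  have ab: "a \<otimes> b \<in> carrier G" by simp
  have Sc: "S \<subseteq> carrier G" using orb_subset[OF ab] orb_subset[OF carr(1)] orb_subset[OF carr(2)] by (simp add: S_def)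
  have M: "subgroup ?M G" by (rule generate_is_subgroup[OF Sc])
  have finS: "finite S" using orb_finite[OF ab] orb_finite by (simp add: S_def)
  have SM: "S \<subseteq> ?M" by (auto intro: generate.incl)
  have AS: "?A i \<in> S" and BS: "?B i \<in> S" and CS: "?C i \<in> S" and yS: "y \<in> S" for i
    by (simp_all add: S_def)
  have AM: "?A i \<in> ?M" and BM: "?B i \<in> ?M" and yM: "y \<in> ?M" for i
    using AS BS yS SM by auto
  have SE: "s = y \<or> (\<exists>i. s = ?A i) \<or> (\<exists>i. s = ?B i) \<or> (\<exists>i. s = ?C i)" if "s \<in> S" for s
    using that by (auto simp: S_def orb_def)
  have C_eq: "?C i = ?A i \<otimes> ?B i" for i by (simp add: al_pow_mult)
  have A_eq: "?A i = a \<otimes> y [^] int i" for i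
  proof -
    have "[\<psi> y * int (i choose 2) = 0 * int (i choose 2)] (mod int p)"
      using psiy by (intro cong_mult cong_refl)
    then show ?thesis using pow_cong(2)[of "\<psi> y * int (i choose 2)" 0] by (simp add: a_pow)
  qed
  have A_Suc: "?A (Suc i) = ?A i \<otimes> y" for i
    by (simp only: A_eq) (simp add: int_pow_mult m_assoc add.commute[of 1])
  have aly: "(al ^^ k) y = y" for k
    by (induction k) (auto intro!: al_fixed psiy phi_vals)
  have phiA: "[\<phi> (?A i) = 1] (mod int p)" for i by (rule cong_trans[OF phi_al_pow phi_vals(1)]) simp
  have psiA: "[\<psi> (?A i) = 0] (mod int p)" for i
    by (rule cong_trans[OF psi_al_pow psi_vals(1)]) (simp_all add: psiy)
  have phiB: "[\<phi> (?B i) = 0] (mod int p)" for i by (rule cong_trans[OF phi_al_pow phi_vals(2)]) simp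
  have psiB: "[\<psi> (?B i) = 1] (mod int p)" for i
    by (rule cong_trans[OF psi_al_pow psi_vals(2)]) (simp_all add: psiy)
  have phiC: "[\<phi> (?C i) = 1] (mod int p)" for i
    unfolding C_eq using phi_mult_cong[OF _ _ phiA[of i] phiB[of i]] by simp
  have psiC: "[\<psi> (?C i) = 1] (mod int p)" for i
    unfolding C_eq using psi_mult_cong[OF _ _ psiA[of i] psiB[of i]] by simp
  \<comment> \<open>The residues of \<phi> and \<psi> on \<open>y\<close> and on the orbits of
    \<open>a\<close>, \<open>b\<close>, \<open>a \<otimes> b\<close> are (0,0), (1,0), (0,1), (1,1);
    so the residues of an element of \<open>S\<close> identify its orbit.\<close>
  define cls where "cls u k l \<longleftrightarrow> u \<in> carrier G \<and> [\<phi> u = k] (mod int p) \<and> [\<psi> u = l] (mod int p)" for u k l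
  have cls: "cls (?A i) 1 0" "cls (?B i) 0 1" "cls (?C i) 1 1" "cls y 0 0" "cls \<one> 0 0" for i
    using phiA psiA phiB psiB phiC psiC phi_vals psiy phi_one psi_one by (auto simp: cls_def)
  have cls_mult: "cls (t \<otimes> u) (k + k') (l + l')" if "cls t k l" "cls u k' l'" for t u k l k' l'
    using that by (auto simp: cls_def intro: phi_mult_cong psi_mult_cong)
  have cls_eq: "k = k' \<and> l = l'" if "cls u k l" "cls u k' l'" "\<bar>k - k'\<bar> < 3" "\<bar>l - l'\<bar> < 3" for u k l k' l'
    using that phi_unique[of u k k'] psi_unique[of u l l'] by (auto simp: cls_def)
  have S_cls: "(cls s 0 0 \<and> s = y) \<or> (cls s 1 0 \<and> (\<exists>i. s = ?A i)) \<or> (cls s 0 1 \<and> (\<exists>i. s = ?B i)) \<or>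
      (cls s 1 1 \<and> (\<exists>i. s = ?C i))" if "s \<in> S" for s
    using SE[OF that] cls by blast
  have S_cls_y: "s = y" if "s \<in> S" "cls s 0 0" for s
    using S_cls[OF that(1)] cls_eq[OF that(2), of 1 0] cls_eq[OF that(2), of 0 1] cls_eq[OF that(2), of 1 1] by auto
  have S_cls_B: "\<exists>i. s = ?B i" if "s \<in> S" "cls s 0 1" for s
    using S_cls[OF that(1)] cls_eq[OF that(2), of 0 0] cls_eq[OF that(2), of 1 0] cls_eq[OF that(2), of 1 1] by auto
  have S_cls_C: "\<exists>i. s = ?C i" if "s \<in> S" "cls s 1 1" for s
    using S_cls[OF that(1)] cls_eq[OF that(2), of 0 0] cls_eq[OF that(2), of 1 0] cls_eq[OF that(2), of 0 1] by auto
  have S_cls_le: "k \<in> {0, 1} \<and> l \<in> {0, 1}" if "s \<in> S" "cls s k l" "\<bar>k\<bar> \<le> 2" "\<bar>l\<bar> \<le> 2" "0 \<le> k" "0 \<le> l" for s k l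
    using S_cls[OF that(1)] cls_eq[OF that(2), of 0 0] cls_eq[OF that(2), of 1 0] cls_eq[OF that(2), of 0 1]
      cls_eq[OF that(2), of 1 1] that(3-) by auto
  have key: "[r = s] (mod p) \<and> [q = s] (mod p)" if eq: "?A s \<otimes> ?B r = ?C q" for s r q
  proof -
    have "?A s \<otimes> ?B r = a \<otimes> b \<otimes> (y [^] int s \<otimes> z [^] int r)"
      by (simp add: A_eq b_pow m_ac)
    also have "?A s \<otimes> ?B r = a \<otimes> b \<otimes> (y [^] int q \<otimes> z [^] int q)"
      unfolding eq C_eq by (simp add: A_eq b_pow m_ac)
    finally have "y [^] int q \<otimes> z [^] int q = y [^] int s \<otimes> z [^] int r" by simp
    then have "[q = s] (mod p)" "[q = r] (mod p)" unfolding yz_eq cong_int_iff by auto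
    then show ?thesis by (metis cong_sym cong_trans)
  qed
  have y1: "y \<noteq> \<one>"
    using yz_eq[of 1 0 0 0] small_cong[of 1 0] by auto
  have By: "?B i \<otimes> y \<noteq> ?B j" for i j
  proof
    assume "?B i \<otimes> y = ?B j"
    then have "b \<otimes> (y [^] (1::int) \<otimes> z [^] int i) = b \<otimes> (y [^] (0::int) \<otimes> z [^] int j)"
      by (simp add: b_pow m_ac)
    then have "y [^] (1::int) \<otimes> z [^] int i = y [^] (0::int) \<otimes> z [^] int j" by simp
    then have "[1 = (0::int)] (mod int p)" unfolding yz_eq by blast
    then show False using small_cong[of 1 0] by simp
  qed
  have Cy: "?C i \<otimes> y \<noteq> ?C j" for i j
  proof
    assume "?C i \<otimes> y = ?C j"
    then have "?A (Suc i) \<otimes> ?B i = ?C j" unfolding A_Suc C_eq[of i] by (simp add: m_ac)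
    then have "[i = Suc i] (mod p)" "[j = Suc i] (mod p)" using key by blast+
    then have "[int i = int i + 1] (mod int p)" by (metis cong_int_iff of_nat_Suc add.commute)
    then show False using small_cong[of "int i" "int i + 1"] by simp
  qed
  have stab: "\<exists>k. \<forall>x\<in>?M. f x = (al ^^ k) x" if f: "f \<in> cay_stab ?M S" for f
  proof -
    \<comment> \<open>In the digraph induced on \<open>S\<close>, \<open>N\<close> singles out the orbits of \<open>a\<close> and \<open>a b\<close>; \<open>y\<close> is the only
      other vertex with more than one out-neighbour, and these form the orbit of \<open>a\<close>.\<close>
    define N where "N s \<longleftrightarrow> (\<exists>t\<in>S. \<exists>u\<in>S. s = t \<otimes> u)" for s
    have NA: "N (?A i)" for i
    proof -
      have "?A i = ?A (Suc (i + (p - 1)))"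
        using p3 by (intro al_pow_cong) (auto simp: cong_def)
      then show ?thesis unfolding A_Suc N_def using AS yS by blast
    qed
    have NC: "N (?C i)" for i unfolding C_eq N_def using AS BS by blast
    have phi_S: "(cls s 0 0 \<and> s = y) \<or> (cls s 0 1 \<and> (\<exists>i. s = ?B i))"
      if st: "s \<in> S" "t \<in> S" "cls (s \<otimes> t) 0 l" for s t l
    proof -
      obtain k m where km: "cls t k m" "k \<in> {0, 1}" using S_cls[OF st(2)] by blast
      have "\<not> cls s 1 m'" for m'
      proof
        assume "cls s 1 m'"
        then have "[\<phi> (s \<otimes> t) = 1 + k] (mod int p)" using cls_mult[OF _ km(1)] by (auto simp: cls_def)
        then show False using st(3) phi_unique[of "s \<otimes> t" "1 + k" 0] km(2) by (auto simp: cls_def)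
      qed
      then show ?thesis using S_cls[OF st(1)] by blast
    qed
    \<comment> \<open>As \<phi> vanishes on \<open>s\<close>, both factors are \<open>y\<close> or
      in the orbit of \<open>b\<close>. Comparing \<psi> leaves only
      \<open>y \<otimes> y = y\<close> and a product of \<open>y\<close> with an element of the
      orbit of \<open>b\<close> staying in that orbit; both are impossible.\<close>
    have not_N: "\<not> N s" if s: "s = y \<or> (\<exists>i. s = ?B i)" for s
    proof
      assume "N s"
      then obtain t u where tu: "t \<in> S" "u \<in> S" "s = t \<otimes> u" by (auto simp: N_def)
      have comm: "t \<otimes> u = u \<otimes> t" using tu Sc by (intro m_comm) auto
      obtain l where l: "cls s 0 l" "l = 0 \<and> s = y \<or> l = 1 \<and> (\<exists>i. s = ?B i)" using s cls by blast
      have t: "(cls t 0 0 \<and> t = y) \<or> (cls t 0 1 \<and> (\<exists>i. t = ?B i))"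
        using phi_S[OF tu(1,2)] l(1) tu(3) by simp
      have u: "(cls u 0 0 \<and> u = y) \<or> (cls u 0 1 \<and> (\<exists>i. u = ?B i))"
        using phi_S[OF tu(2,1)] l(1) tu(3) comm by simp
      have "m + n = l" if "cls t 0 m" "cls u 0 n" "m + n \<in> {0, 1, 2}" for m n
        using cls_eq[OF cls_mult[OF that(1,2)], of 0 l] l tu(3) that(3) by auto
      note sum = this
      show False
        using t
      proof
        assume t: "cls t 0 0 \<and> t = y"
        show False
          using u
        proof
          assume u: "cls u 0 0 \<and> u = y"
          have "0 + 0 = l" by (rule sum) (use t u in auto)
          then have "s = y" using l(2) by auto
          then show False using tu(3) t u y1 by simp
        next
          assume u: "cls u 0 1 \<and> (\<exists>i. u = ?B i)"
          have "0 + 1 = l" by (rule sum) (use t u in auto)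
          then obtain i j where "u = ?B j" "s = ?B i" using u l(2) by auto
          then show False using tu(3) comm t By by metis
        qed
      next
        assume t: "cls t 0 1 \<and> (\<exists>i. t = ?B i)"
        show False
          using u
        proof
          assume u: "cls u 0 0 \<and> u = y"
          have "1 + 0 = l" by (rule sum) (use t u in auto)
          then obtain i j where "t = ?B j" "s = ?B i" using t l(2) by auto
          then show False using tu(3) u By by metis
        next
          assume u: "cls u 0 1 \<and> (\<exists>i. u = ?B i)"
          have "1 + 1 = l" by (rule sum) (use t u in auto)
          then show False using l(2) by auto
        qed
      qed
    qed
    have facts: "g y = y \<and> (\<forall>i. \<exists>q. g (?A i) = ?A q) \<and> (\<forall>i. \<exists>q. g (?B i) = ?B q) \<and> (\<forall>i. \<exists>q. g (?C i) = ?C q)"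
      if g: "g \<in> cay_stab ?M S" for g
    proof -
      have gS: "g s \<in> S" "N (g s) \<longleftrightarrow> N s" if "s \<in> S" for s
        using cay_stab_image[OF M g, of s] cay_stab_products[OF M g SM finS that] SM that
        by (auto simp: N_def)
      have inj: "s = t" if "g s = g t" "s \<in> S" "t \<in> S" for s t
        using inj_onD[OF bij_betw_imp_inj_on[OF cay_stabD(1)[OF g]] that(1)] that SM by blast
      have gy: "g y = y"
      proof (rule ccontr)
        assume "g y \<noteq> y"
        moreover have "\<not> N (g y)" using gS(2)[OF yS] not_N by blast
        ultimately obtain j where j: "g y = ?B j" using SE[OF gS(1)[OF yS]] NA NC by metis
        have D: "diff_map g y \<in> cay_stab ?M S" by (rule diff_map_cay_stab[OF M g yM])
        have uniq: "u = ?A j" if u: "u \<in> S" "?B j \<otimes> u \<in> S" for u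
        proof -
          consider "u = y" | i where "u = ?A i" | i where "u = ?B i" | i where "u = ?C i"
            using SE[OF u(1)] by blast
          then show ?thesis
          proof cases
            case 1
            then have "cls (?B j \<otimes> u) 0 1" using cls_mult[OF cls(2) cls(4), of j] by simp
            then show ?thesis using S_cls_B[OF u(2)] By 1 by blast
          next
            case (2 i)
            then have "cls (?B j \<otimes> u) 1 1" using cls_mult[OF cls(2,1), of j i] by simp
            then obtain q where "?B j \<otimes> u = ?C q" using S_cls_C[OF u(2)] by blast
            then have "?A i \<otimes> ?B j = ?C q" using 2 by (simp add: m_comm)
            then have "[i = j] (mod p)" using key cong_sym by blast
            then show ?thesis using 2 al_pow_cong[OF carr(1)] by blast
          next
            case (3 i)
            then have "cls (?B j \<otimes> u) 0 2" using cls_mult[OF cls(2,2), of j i] by simp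
            then show ?thesis using S_cls_le[OF u(2)] by force
          next
            case (4 i)
            then have "cls (?B j \<otimes> u) 1 2" using cls_mult[OF cls(2,3), of j i] by simp
            then show ?thesis using S_cls_le[OF u(2)] by force
          qed
        qed
        \<comment> \<open>All of the orbit of \<open>a\<close> consists of out-neighbours of
          \<open>y\<close> inside \<open>S\<close>; if \<open>y\<close> went to \<open>?B j\<close>,
          they would all be squeezed into the single element \<open>?A j\<close>.\<close>
        have "diff_map g y (?A i) = ?A j" for i
        proof (rule uniq)
          show "diff_map g y (?A i) \<in> S" using cay_stab_image[OF M D AM] AS by blast
          have "y \<otimes> ?A i = ?A (Suc i)" unfolding A_Suc by (simp add: m_comm)
          then have "g (y \<otimes> ?A i) \<in> S" using gS(1)[OF AS] by metis
          then show "?B j \<otimes> diff_map g y (?A i) \<in> S"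
            using cay_stab_mult[OF M g yM AM] j by metis
        qed
        then have "?A 0 = ?A 1"
          using inj_onD[OF bij_betw_imp_inj_on[OF cay_stabD(1)[OF D]], of "?A 0" "?A 1"] AM by metis
        then have "[int 0 = int 1] (mod int p)" using a_pow_inj by (simp only: cong_int_iff)
        then show False using small_cong by fastforce
      qed
      have gA: "\<exists>q. g (?A i) = ?A q" for i
      proof -
        define i' where "i' = i + (p - 1)"
        define u where "u = diff_map g y (?A i')"
        have "?A i = ?A (Suc i')"
          using p3 by (intro al_pow_cong) (auto simp: cong_def i'_def)
        then have Ai: "?A i = y \<otimes> ?A i'" unfolding A_Suc by (simp add: m_comm)
        then have "g (?A i) = y \<otimes> u" using cay_stab_mult[OF M g yM AM] gy by (simp add: u_def)
        moreover have "g (?A i) \<in> S" by (rule gS(1)[OF AS])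
        ultimately have yu: "y \<otimes> u \<in> S" by simp
        have uS: "u \<in> S"
          using cay_stab_image[OF M diff_map_cay_stab[OF M g yM] AM] AS by (simp add: u_def)
        have comm: "y \<otimes> u = u \<otimes> y" using uS Sc by (intro m_comm) auto
        consider "u = y" | j where "u = ?A j" | j where "u = ?B j" | j where "u = ?C j"
          using SE[OF uS] by blast
        then show ?thesis
        proof cases
          case 1
          then have "cls (y \<otimes> u) 0 0" using cls_mult[OF cls(4,4)] by simp
          then have "y \<otimes> y = y" using S_cls_y[OF yu] 1 by simp
          then show ?thesis using y1 by simp
        next
          case (2 j)
          then have "y \<otimes> u = ?A (Suc j)" unfolding A_Suc using comm by simp
          then show ?thesis using \<open>g (?A i) = y \<otimes> u\<close> by metis
        next
          case (3 j)
          then have "cls (y \<otimes> u) 0 1" using cls_mult[OF cls(4,2), of j] by simp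
          then obtain q where "y \<otimes> u = ?B q" using S_cls_B[OF yu] by blast
          then show ?thesis using By 3 comm by metis
        next
          case (4 j)
          then have "cls (y \<otimes> u) 1 1" using cls_mult[OF cls(4,3), of j] by simp
          then obtain q where "y \<otimes> u = ?C q" using S_cls_C[OF yu] by blast
          then show ?thesis using Cy 4 comm by metis
        qed
      qed
      have gB: "\<exists>q. g (?B i) = ?B q" for i
      proof -
        have "\<not> N (g (?B i))" using gS(2)[OF BS] not_N by blast
        moreover have "g (?B i) \<noteq> y"
        proof
          assume "g (?B i) = y"
          then have "?B i = y" using inj[OF _ BS yS] gy by metis
          then show False using cls_eq[OF cls(4), of 0 1] cls(2)[of i] by simp
        qed
        ultimately show ?thesis using SE[OF gS(1)[OF BS]] NA NC by metis
      qed
      \<comment> \<open>Among the elements satisfying \<open>N\<close>, the orbit of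
        \<open>a \<otimes> b\<close> is what remains, because \<open>g\<close> already permutes the
        orbit of \<open>a\<close>.\<close>
      have gC: "\<exists>q. g (?C i) = ?C q" for i
      proof -
        have "g ` orb a \<subseteq> orb a" using gA by (auto simp: orb_def)
        moreover have "inj_on g (orb a)" using inj AS by (auto simp: inj_on_def orb_def)
        ultimately have onto: "g ` orb a = orb a" using orb_finite by (intro endo_inj_surj) auto
        have "g (?C i) \<noteq> ?A j" for j
        proof
          assume "g (?C i) = ?A j"
          moreover have "?A j \<in> g ` orb a" unfolding onto by simp
          then obtain m where "?A j = g (?A m)" by (auto elim: orb_E)
          ultimately have "?C i = ?A m" using inj[OF _ CS AS] by metis
          then show False using cls_eq[OF cls(3), of i 1 0] cls(1)[of m] by simp
        qed
        moreover have "N (g (?C i))" using gS(2)[OF CS] NC by blast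
        ultimately show ?thesis using SE[OF gS(1)[OF CS]] not_N by metis
      qed
      show ?thesis using gy gA gB gC by blast
    qed
    have Dfacts: "diff_map f x y = y" "\<exists>q. diff_map f x (?A i) = ?A q" "\<exists>q. diff_map f x (?B i) = ?B q"
      "\<exists>q. diff_map f x (?C i) = ?C q" if "x \<in> ?M" for x i
      using facts[OF diff_map_cay_stab[OF M f that]] by blast+
    \<comment> \<open>Two squares are used. With \<open>y\<close> and \<open>?A i\<close> the index
      in the orbit of \<open>a\<close> advances; with \<open>?A i\<close> and \<open>?B i\<close>,
      both ending at \<open>x \<otimes> ?C i\<close>, \<open>key\<close> forces equal
      indices.\<close>
    have step: "diff_map f x (?A (Suc i)) = ?A (Suc i + k) \<and> diff_map f x (?B i) = ?B (i + k) \<and>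
        diff_map f x (?C i) = ?C (i + k) \<and> diff_map f (x \<otimes> ?A i) (?B i) = ?B (i + k) \<and>
        diff_map f (x \<otimes> ?B i) (?A i) = ?A (i + k) \<and> diff_map f (x \<otimes> y) (?A i) = ?A (i + k)"
      if x: "x \<in> ?M" and eq: "diff_map f x (?A i) = ?A (i + k)" for x i k
    proof -
      have xA: "x \<otimes> ?A i \<in> ?M" and xB: "x \<otimes> ?B i \<in> ?M" and xy: "x \<otimes> y \<in> ?M"
        using x AM BM yM M by (auto intro: subgroup.m_closed)
      have 1: "diff_map f x (?A (Suc i)) = ?A (Suc i + k)"
        using diff_map_mult[OF M f x AM[of i] yM] Dfacts(1)[OF xA] eq A_Suc[of i] A_Suc[of "i + k"]
        by (simp only: add_Suc)
      obtain s where s: "diff_map f (x \<otimes> y) (?A i) = ?A s" using Dfacts(2)[OF xy] by blast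
      have "y \<otimes> ?A s = y \<otimes> ?A (i + k)"
      proof -
        have "diff_map f x (y \<otimes> ?A i) = y \<otimes> ?A s"
          using diff_map_mult[OF M f x yM AM[of i]] Dfacts(1)[OF x] s by simp
        moreover have "y \<otimes> ?A i = ?A (Suc i)" "y \<otimes> ?A (i + k) = ?A (Suc i + k)"
          using A_Suc[of i] A_Suc[of "i + k"] by (simp_all only: m_comm carr al_pow_carrier add_Suc)
        ultimately show ?thesis using 1 by metis
      qed
      then have 2: "diff_map f (x \<otimes> y) (?A i) = ?A (i + k)" using s by simp
      obtain q where q: "diff_map f x (?C i) = ?C q" using Dfacts(4)[OF x] by blast
      obtain r where r: "diff_map f (x \<otimes> ?A i) (?B i) = ?B r" using Dfacts(3)[OF xA] by blast
      obtain r' where r': "diff_map f x (?B i) = ?B r'" using Dfacts(3)[OF x] by blast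
      obtain t where t: "diff_map f (x \<otimes> ?B i) (?A i) = ?A t" using Dfacts(2)[OF xB] by blast
      have "?A (i + k) \<otimes> ?B r = ?C q"
        using diff_map_mult[OF M f x AM[of i] BM[of i]] eq q r C_eq[of i] by metis
      then have 3: "[q = i + k] (mod p)" "[r = i + k] (mod p)" using key by blast+
      have "?A t \<otimes> ?B r' = ?C q"
        using diff_map_mult[OF M f x BM[of i] AM[of i]] t q r' C_eq[of i]
          m_comm[of "?B i" "?A i"] m_comm[of "?B r'" "?A t"] carr al_pow_carrier by metis
      then have 4: "[q = t] (mod p)" "[r' = t] (mod p)" using key by blast+
      have 5: "[t = i + k] (mod p)" using 3(1) 4(1) by (metis cong_sym cong_trans)
      have 6: "[r' = i + k] (mod p)" using cong_trans[OF 4(2) 5] .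
      show ?thesis
        using 1 2 q r r' t al_pow_cong[OF ab 3(1)] al_pow_cong[OF carr(2) 3(2)]
          al_pow_cong[OF carr(2) 6] al_pow_cong[OF carr(1) 5] by simp
    qed
    have all: "diff_map f x (?A i) = ?A (i + k) \<and> diff_map f x (?B i) = ?B (i + k) \<and>
        diff_map f x (?C i) = ?C (i + k)"
      if x: "x \<in> ?M" and start: "diff_map f x (?A j) = ?A (j + k)" for x i j k
    proof -
      have "diff_map f x (?A i) = ?A (i + k)"
        by (rule al_pow_shift[where g = "diff_map f x", OF _ start]) (use step[OF x] in blast)
      then show ?thesis using step[OF x] by blast
    qed
    have R: "\<forall>s\<in>S. diff_map f x s = (al ^^ k) s"
      if x: "x \<in> ?M" and start: "diff_map f x (?A j) = ?A (j + k)" for x j k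
    proof
      fix s assume "s \<in> S"
      then consider "s = y" | i where "s = ?A i" | i where "s = ?B i" | i where "s = ?C i"
        using SE by blast
      then show "diff_map f x s = (al ^^ k) s"
        using all[OF x start] Dfacts(1)[OF x] by cases (simp_all only: al_pow_add aly)
    qed
    \<comment> \<open>As in the other base case, the exponent after an arc \<open>?A i\<close> is
      recovered from the image of \<open>?B i\<close>, which is known in two ways.\<close>
    have RA: "diff_map f (x \<otimes> ?A i) (?A j) = ?A (j + k)"
      if x: "x \<in> ?M" and start: "diff_map f x (?A j') = ?A (j' + k)" for x i j j' k
    proof -
      have xA: "x \<otimes> ?A i \<in> ?M" using x AM M by (auto intro: subgroup.m_closed)
      obtain l where l: "diff_map f (x \<otimes> ?A i) (?A 0) = ?A (0 + l)"
        using Dfacts(2)[OF xA] by (metis add_0)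
      have "diff_map f (x \<otimes> ?A i) (?B i) = ?B (i + l)" using all[OF xA l] by blast
      moreover have "diff_map f (x \<otimes> ?A i) (?B i) = ?B (i + k)"
        using step[OF x] all[OF x start] by blast
      ultimately have "[i + l = i + k] (mod p)" by (intro b_pow_inj) simp
      then have "[j + l = j + k] (mod p)" by (simp only: cong_add_lcancel_nat)
      then show ?thesis using all[OF xA l, of j] al_pow_cong[OF carr(1)] by metis
    qed
    obtain k where k: "diff_map f \<one> (?A 0) = ?A (0 + k)"
      using Dfacts(2)[OF subgroup.one_closed[OF M]] by (metis add_0)
    show ?thesis
    proof (intro exI[of _ k] cay_stab_eq_al_pow[OF Sc f])
      show "\<forall>s\<in>S. diff_map f \<one> s = (al ^^ k) s" by (rule R[OF subgroup.one_closed[OF M] k])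
    next
      fix x s assume x: "x \<in> ?M" and eq: "\<forall>s\<in>S. diff_map f x s = (al ^^ k) s" and s: "s \<in> S"
      have xs: "x \<otimes> s \<in> ?M" using x s SM M by (auto intro: subgroup.m_closed)
      have eqA: "diff_map f x (?A i) = ?A (i + k)" for i using eq AS by (simp add: al_pow_add)
      have "\<exists>j. diff_map f (x \<otimes> s) (?A j) = ?A (j + k)"
        using SE[OF s]
      proof (elim disjE exE)
        fix i assume "s = ?C i"
        \<comment> \<open>An arc given by \<open>?C i\<close> is split into the arcs
          \<open>?A i\<close> and \<open>?B i\<close>, for which the exponent is already known to
          persist.\<close>
        then have "x \<otimes> s = x \<otimes> ?A i \<otimes> ?B i"
          unfolding C_eq using subgroup.mem_carrier[OF M x] by (simp add: m_assoc)
        moreover have "x \<otimes> ?A i \<in> ?M" using x AM M by (auto intro: subgroup.m_closed)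
        ultimately show ?thesis using step RA[OF x eqA] by metis
      qed (use step[OF x eqA] RA[OF x eqA] in blast)+
      then show "\<forall>t\<in>S. diff_map f (x \<otimes> s) t = (al ^^ k) t" using R[OF xs] by blast
    qed
  qed
  have "good ?M S"
  proof (rule good_generate[OF Sc finS])
    show "a \<in> S" "b \<in> S" "al b \<in> S" "y \<in> S" using AS[of 0] BS[of 0] BS[of 1] yS by auto
    show "al ` S = S" using aly[of 1] by (simp add: S_def image_Un al_orb)
    have "card S \<le> card {y} + (card (orb a) + card (orb b) + card (orb (a \<otimes> b)))"
      unfolding S_def by (intro order_trans[OF card_Un_le] add_mono order_refl)
    then show "card S \<le> 3 * p + 1"
      using orb_card[OF carr(1)] orb_card[OF carr(2)] orb_card[OF ab] by simp
  next
    fix s assume "s \<in> S"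
    have "s \<noteq> \<one>"
    proof
      assume "s = \<one>"
      then show False using S_cls_y[OF \<open>s \<in> S\<close>] cls(5) y1 by simp
    qed
    then show "s \<noteq> \<one> \<and> ([\<phi> s = 0] (mod int p) \<or> [\<phi> s = 1] (mod int p))"
      using S_cls[OF \<open>s \<in> S\<close>] by (auto simp: cls_def)
  qed (rule stab)
  then show ?thesis by blast
qed

lemma good_carrier_exists: "\<exists>S. good (carrier G) S"
  using alternatives good_of_y_eq_b good_of_psi_y_zero good_carrier by blast

end

section \<open>The automorphism group of the digraph\<close>

context unipotent_data begin

text \<open>Restricted to the carrier because elements of \<open>aut_group\<close> are
  extensional.\<close>

definition affine :: "'a \<Rightarrow> nat \<Rightarrow> 'a \<Rightarrow> 'a" where
  "affine x k = (\<lambda>u\<in>carrier G. (al ^^ k) u \<otimes> x)"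

definition twist :: "'a \<Rightarrow> nat" where
  "twist x = nat (\<phi> x mod int p)"

lemma twist_cong: "[int (twist x) = \<phi> x] (mod int p)"
  using p3 by (simp add: twist_def cong_def)

lemma twist_eq: "[\<phi> x = int k] (mod int p) \<Longrightarrow> [twist x = k] (mod p)"
  unfolding cong_int_iff[symmetric] by (rule cong_trans[OF twist_cong])

lemma affine_cong: "[k = l] (mod p) \<Longrightarrow> affine x k = affine x l"
  unfolding affine_def by (intro restrict_ext) (simp add: al_pow_cong)

lemma al_pow_one: "(al ^^ k) \<one> = \<one>"
  by (induction k) (auto simp: hom_one[OF al_hom group_axioms group_axioms])

lemma al_pow_inv: "x \<in> carrier G \<Longrightarrow> (al ^^ k) (inv x) = inv ((al ^^ k) x)"
  using al_pow_mult[of "inv x" x k] by (intro inv_equality[symmetric]) (simp_all add: al_pow_one)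

lemma affine_Bij: "x \<in> carrier G \<Longrightarrow> affine x k \<in> Bij (carrier G)"
proof -
  assume x: "x \<in> carrier G"
  define l where "l = k * (p - 1)"
  have lk: "(al ^^ (l + k)) u = u" if "u \<in> carrier G" for u
  proof -
    have "l + k = k * p" using p3 by (cases p) (auto simp: l_def)
    then show ?thesis using al_pow_cong[OF that, of "l + k" 0] by (simp add: cong_def)
  qed
  have "bij_betw (affine x k) (carrier G) (carrier G)"
  proof (rule bij_betwI[where g = "\<lambda>u. (al ^^ l) (u \<otimes> inv x)"])
    fix u assume "u \<in> carrier G"
    then show "(al ^^ l) (affine x k u \<otimes> inv x) = u"
      using x lk[of u] by (simp add: affine_def m_assoc al_pow_add add.commute)
  next
    fix u assume "u \<in> carrier G"
    then show "affine x k ((al ^^ l) (u \<otimes> inv x)) = u"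
      using x lk[of "u \<otimes> inv x"] by (simp add: affine_def m_assoc al_pow_add)
  qed (use x in \<open>auto simp: affine_def\<close>)
  then show ?thesis by (simp add: Bij_def affine_def)
qed

context
  fixes S assumes S: "good (carrier G) S"
begin

abbreviation "A \<equiv> aut_group (cayley_digraph G S)"

lemma mem_A: "f \<in> carrier A \<longleftrightarrow> f \<in> Bij (carrier G) \<and>
    (\<forall>u\<in>carrier G. \<forall>v\<in>carrier G. v \<otimes> inv u \<in> S \<longleftrightarrow> f v \<otimes> inv (f u) \<in> S)"
proof -
  have "f v \<in> carrier G" if "f \<in> Bij (carrier G)" "v \<in> carrier G" for v
    using that by (auto simp: Bij_def bij_betw_def)
  then show ?thesis by (auto simp: carrier_aut_group cayley_digraph_def)
qed

lemma A_mult: "f \<in> carrier A \<Longrightarrow> g \<in> carrier A \<Longrightarrow> f \<otimes>\<^bsub>A\<^esub> g = compose (carrier G) f g"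
  by (simp add: mem_A) (simp add: aut_group_def BijGroup_def cayley_digraph_def)

lemma S_props: "S \<subseteq> carrier G - {\<one>}" "al ` S = S" "\<exists>s\<in>S. inv s \<notin> S"
  "\<And>f. f \<in> cay_stab (carrier G) S \<Longrightarrow> \<exists>k. \<forall>x\<in>carrier G. f x = (al ^^ k) x"
  using S by (auto simp: good_def)

lemma al_pow_S: "u \<in> carrier G \<Longrightarrow> (al ^^ k) u \<in> S \<longleftrightarrow> u \<in> S"
proof (induction k)
  case (Suc k)
  have "al w \<in> S \<longleftrightarrow> w \<in> S" if w: "w \<in> carrier G" for w
  proof
    assume "al w \<in> S"
    then obtain t where "t \<in> S" "al t = al w" using S_props(2) by (metis imageE)
    then show "w \<in> S" using inj_onD[OF al_inj, of t w] S_props(1) w by blast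
  qed (use S_props(2) in blast)
  then show ?case using Suc by simp
qed simp

lemma affine_mem: "x \<in> carrier G \<Longrightarrow> affine x k \<in> carrier A"
proof -
  assume x: "x \<in> carrier G"
  have "v \<otimes> inv u \<in> S \<longleftrightarrow> affine x k v \<otimes> inv (affine x k u) \<in> S"
    if "u \<in> carrier G" "v \<in> carrier G" for u v
  proof -
    have "affine x k v \<otimes> inv (affine x k u) = (al ^^ k) v \<otimes> inv ((al ^^ k) u) \<otimes> (x \<otimes> inv x)"
      using that x by (simp only: affine_def restrict_apply' inv_mult m_ac al_pow_carrier inv_closed m_closed)
    also have "\<dots> = (al ^^ k) (v \<otimes> inv u)"
      using that x by (simp add: al_pow_mult al_pow_inv)
    finally show ?thesis using that by (simp add: al_pow_S)
  qed
  then show ?thesis using affine_Bij[OF x] by (simp add: mem_A)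
qed

lemma affine_mult:
  assumes "x \<in> carrier G" "w \<in> carrier G"
  shows "affine x k \<otimes>\<^bsub>A\<^esub> affine w l = affine ((al ^^ k) w \<otimes> x) (l + k)"
proof -
  have "affine x k \<otimes>\<^bsub>A\<^esub> affine w l = compose (carrier G) (affine x k) (affine w l)"
    using assms affine_mem by (intro A_mult)
  also have "\<dots> = affine ((al ^^ k) w \<otimes> x) (l + k)"
    unfolding compose_def affine_def
    using assms by (intro restrict_ext) (simp add: al_pow_mult al_pow_add m_assoc)
  finally show ?thesis .
qed

lemma affine_one: "\<one>\<^bsub>A\<^esub> = affine \<one> 0"
  by (auto simp: aut_group_def BijGroup_def cayley_digraph_def affine_def intro!: restrict_ext)

text \<open>Following \<open>f\<close> by the translation that returns \<open>f \<one>\<close> to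
  the identity gives an element of the stabilizer, hence a power of \<open>al\<close>.\<close>

lemma A_eq_affine:
  assumes f: "f \<in> carrier A"
  shows "\<exists>k<p. f = affine (f \<one>) k"
proof -
  have fB: "bij_betw f (carrier G) (carrier G)" "f \<in> extensional (carrier G)"
    using f by (auto simp: mem_A Bij_def)
  have fc[simp]: "f x \<in> carrier G" if "x \<in> carrier G" for x
    using fB that by (auto simp: bij_betw_def)
  define g where "g = (\<lambda>x. f x \<otimes> inv (f \<one>))"
  have "bij_betw (\<lambda>x. x \<otimes> inv (f \<one>)) (carrier G) (carrier G)"
    by (rule bij_betwI[where g = "\<lambda>x. x \<otimes> f \<one>"]) (auto simp: m_assoc)
  from bij_betw_trans[OF fB(1) this] have "bij_betw g (carrier G) (carrier G)"
    by (simp add: g_def comp_def)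
  moreover have "g \<one> = \<one>" by (simp add: g_def)
  moreover have "s \<in> S \<longleftrightarrow> diff_map g x s \<in> S" if "x \<in> carrier G" "s \<in> carrier G" for x s
  proof -
    have "diff_map g x s = f (x \<otimes> s) \<otimes> inv (f x) \<otimes> (f \<one> \<otimes> inv (f \<one>))"
      using that by (simp only: diff_map_def g_def inv_mult inv_inv m_ac fc inv_closed m_closed one_closed)
    also have "\<dots> = f (x \<otimes> s) \<otimes> inv (f x)" using that by simp
    finally have "diff_map g x s = f (x \<otimes> s) \<otimes> inv (f x)" .
    moreover have "(x \<otimes> s) \<otimes> inv x = s" using that by (simp add: m_ac)
    moreover have "(x \<otimes> s) \<otimes> inv x \<in> S \<longleftrightarrow> f (x \<otimes> s) \<otimes> inv (f x) \<in> S"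
      using f that by (simp add: mem_A)
    ultimately show ?thesis by simp
  qed
  ultimately have "g \<in> cay_stab (carrier G) S" by (simp only: cay_stab_def mem_Collect_eq) blast
  then obtain k where k: "\<forall>x\<in>carrier G. g x = (al ^^ k) x" using S_props(4) by blast
  have f_eq: "f x = (al ^^ k) x \<otimes> f \<one>" if "x \<in> carrier G" for x
  proof -
    have "f x = g x \<otimes> f \<one>" using that by (simp add: g_def m_assoc)
    then show ?thesis using k that by simp
  qed
  have "f = affine (f \<one>) k"
  proof (rule extensionalityI[OF fB(2)])
    show "affine (f \<one>) k \<in> extensional (carrier G)" by (simp add: affine_def)
    show "f x = affine (f \<one>) k x" if "x \<in> carrier G" for x
      by (rule trans[OF f_eq[OF that]]) (simp add: affine_def that)
  qed
  also have "\<dots> = affine (f \<one>) (k mod p)" by (rule affine_cong) (simp add: cong_def)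
  finally have "f = affine (f \<one>) (k mod p)" .
  moreover have "k mod p < p" using p3 by simp
  ultimately show ?thesis by blast
qed

lemma affine_at_one: "x \<in> carrier G \<Longrightarrow> affine x k \<one> = x"
  by (simp add: affine_def al_pow_one)

text \<open>The pair (x, k) can be recovered from the map: its value at the identity is
  \<open>x\<close>, and its value at \<open>a\<close> then gives k modulo p, as \<open>a\<close> has
  p distinct images under the powers of \<open>al\<close>.\<close>

lemma order_A: "order A = card (carrier G) * p"
proof -
  have "bij_betw (\<lambda>(x, k). affine x k) (carrier G \<times> {..<p}) (carrier A)"
    unfolding bij_betw_def
  proof
    show "inj_on (\<lambda>(x, k). affine x k) (carrier G \<times> {..<p})"
    proof (rule inj_onI, clarsimp)
      fix x k w l assume xw: "x \<in> carrier G" "w \<in> carrier G" "k < p" "l < p" "affine x k = affine w l"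
      then have "x = w" using affine_at_one by metis
      moreover from this have "(al ^^ k) a \<otimes> x = (al ^^ l) a \<otimes> x"
        using fun_cong[OF xw(5), of a] by (simp add: affine_def)
      then have "[k = l] (mod p)" using xw by (intro a_pow_inj) simp
      ultimately show "x = w \<and> k = l" using xw by (simp add: cong_less_modulus_unique_nat)
    qed
    show "(\<lambda>(x, k). affine x k) ` (carrier G \<times> {..<p}) = carrier A"
    proof (intro equalityI subsetI)
      fix f assume f: "f \<in> carrier A"
      then obtain k where k: "k < p" "f = affine (f \<one>) k" using A_eq_affine by blast
      have "f \<one> \<in> carrier G" using f by (auto simp: mem_A Bij_def bij_betw_def)
      then have "(\<lambda>(x, k). affine x k) (f \<one>, k) \<in> (\<lambda>(x, k). affine x k) ` (carrier G \<times> {..<p})"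
        using k(1) by (intro imageI) simp
      then show "f \<in> (\<lambda>(x, k). affine x k) ` (carrier G \<times> {..<p})"
        by (simp only: prod.case k(2)[symmetric])
    qed (auto intro: affine_mem)
  qed
  from bij_betw_same_card[OF this] show ?thesis by (simp add: order_def card_cartesian_product)
qed

lemma cayley_index_eq: "cayley_index G S = p"
proof -
  have "card (right_translations G) = card (carrier G)"
    unfolding right_translations_def
  proof (rule card_image, rule inj_onI)
    fix x w assume xw: "x \<in> carrier G" "w \<in> carrier G"
      and eq: "(\<lambda>u\<in>carrier G. u \<otimes> x) = (\<lambda>u\<in>carrier G. u \<otimes> w)"
    show "x = w" using fun_cong[OF eq, of \<one>] xw by simp
  qed
  moreover have "card (carrier G) > 0" using fin card_gt_0_iff by blast
  ultimately show ?thesis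
    using group.lagrange[OF group_aut_group subgroup_right_translations, of S]
    by (simp add: cayley_index_def order_A)
qed

lemma proper_cayley_digraph: "proper_digraph (cayley_digraph G S)"
proof -
  obtain s where s: "s \<in> S" "inv s \<notin> S" "s \<in> carrier G" using S_props by blast
  then have "(\<one>, s) \<in> parcs (cayley_digraph G S)" "(s, \<one>) \<notin> parcs (cayley_digraph G S)"
    by (simp_all add: cayley_digraph_def)
  then show ?thesis unfolding proper_digraph_def by blast
qed

lemma regular_nonabelian:
  "\<exists>H. regular_subgroup H (cayley_digraph G S) \<and> \<not> comm_group (A\<lparr>carrier := H\<rparr>)"
proof -
  define h where "h x = affine x (twist x)" for x
  define H where "H = h ` carrier G"
  have HA: "H \<subseteq> carrier A" using affine_mem by (auto simp: H_def h_def)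
  have h_eq: "affine x k = h x" if "[\<phi> x = int k] (mod int p)" for x k
    unfolding h_def by (rule affine_cong[OF cong_sym[OF twist_eq[OF that]]])
  have h_mult: "h x \<otimes>\<^bsub>A\<^esub> h w = h ((al ^^ twist x) w \<otimes> x)" if "x \<in> carrier G" "w \<in> carrier G" for x w
  proof -
    have "[\<phi> ((al ^^ twist x) w \<otimes> x) = \<phi> w + \<phi> x] (mod int p)"
      using that by (intro phi_mult_cong phi_al_pow) auto
    also have "[\<phi> w + \<phi> x = int (twist w) + int (twist x)] (mod int p)"
      by (intro cong_add cong_sym[OF twist_cong])
    finally have "affine ((al ^^ twist x) w \<otimes> x) (twist w + twist x) = h ((al ^^ twist x) w \<otimes> x)"
      by (intro h_eq) simp
    then show ?thesis using that by (simp only: h_def affine_mult)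
  qed
  have one: "\<one>\<^bsub>A\<^esub> = h \<one>" unfolding affine_one using phi_one by (intro h_eq) simp
  have sub: "subgroup H A"
  proof (rule group.subgroupI[OF group_aut_group HA])
    show "H \<noteq> {}" by (auto simp: H_def)
    fix f assume "f \<in> H"
    then obtain x where x: "x \<in> carrier G" "f = h x" by (auto simp: H_def)
    \<comment> \<open>A natural number congruent to -\<phi>(x); the inverse map must undo this power
      of \<open>al\<close>, which determines \<open>w\<close>.\<close>
    define l where "l = twist x * (p - 1)"
    define w where "w = (al ^^ l) (inv x)"
    have l: "l + twist x = twist x * p" using p3 by (cases p) (auto simp: l_def)
    have wc: "w \<in> carrier G" using x by (simp add: w_def)
    have "[\<phi> (inv x) + \<phi> x = 0] (mod int p)"
      using cong_trans[OF cong_sym[OF phi_mult[of "inv x" x]], of 0] x phi_one by simp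
    then have "[\<phi> (inv x) + int (twist x) = 0] (mod int p)"
      by (rule cong_trans[OF cong_add[OF cong_refl twist_cong]])
    moreover have "[int l + int (twist x) = 0] (mod int p)"
      by (simp add: of_nat_add[symmetric] l cong_0_iff del: of_nat_add)
    ultimately have "[\<phi> (inv x) + int (twist x) = int l + int (twist x)] (mod int p)"
      by (rule cong_trans[OF _ cong_sym])
    then have "[\<phi> (inv x) = int l] (mod int p)" by (simp only: cong_add_rcancel)
    then have "[\<phi> w = int l] (mod int p)"
      unfolding w_def using x by (intro cong_trans[OF phi_al_pow]) auto
    then have hw: "h w = affine w l" by (rule h_eq[symmetric])
    have "h w \<otimes>\<^bsub>A\<^esub> f = affine ((al ^^ l) x \<otimes> w) (twist x + l)"
      unfolding hw x(2) h_def[of x] using x wc by (intro affine_mult)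
    also have "(al ^^ l) x \<otimes> w = \<one>" using x by (simp add: w_def al_pow_inv)
    also have "affine \<one> (twist x + l) = affine \<one> 0"
      using l by (intro affine_cong) (simp add: add.commute cong_def)
    finally have "inv\<^bsub>A\<^esub> f = h w"
      using HA x wc affine_one by (intro group.inv_equality[OF group_aut_group]) (auto simp: H_def)
    then show "inv\<^bsub>A\<^esub> f \<in> H" using wc by (simp add: H_def)
  next
    fix f g assume "f \<in> H" "g \<in> H"
    then obtain x w where "x \<in> carrier G" "w \<in> carrier G" "f = h x" "g = h w" by (auto simp: H_def)
    then show "f \<otimes>\<^bsub>A\<^esub> g \<in> H" by (simp add: h_mult H_def)
  qed
  have pv: "pverts (cayley_digraph G S) = carrier G" by (simp add: cayley_digraph_def)
  have act: "group_action (A\<lparr>carrier := H\<rparr>) (carrier G) (\<lambda>h. h)"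
  proof (intro group_action.intro group_hom.intro group_hom_axioms.intro)
    show "group (A\<lparr>carrier := H\<rparr>)" by (rule group.subgroup_imp_group[OF group_aut_group sub])
    show "group (BijGroup (carrier G))" by (rule group_BijGroup)
    show "(\<lambda>h. h) \<in> hom (A\<lparr>carrier := H\<rparr>) (BijGroup (carrier G))"
      using HA by (auto simp: hom_def aut_group_def pv BijGroup_def)
  qed
  have "regular_action (A\<lparr>carrier := H\<rparr>) (carrier G) (\<lambda>h. h)"
  proof (intro regular_action.intro transitive_action.intro act
      transitive_action_axioms.intro regular_action_axioms.intro)
    fix x w assume xw: "x \<in> carrier G" "w \<in> carrier G"
    \<comment> \<open>Since \<phi> is invariant under \<open>al\<close>, a map indexed by
      \<open>v\<close> that takes \<open>x\<close> to \<open>w\<close> must have \<phi>(v) =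
      \<phi>(w) - \<phi>(x). The exponent is thus known in advance, and the equation can be solved
      for \<open>v\<close>.\<close>
    define k where "k = nat ((\<phi> w - \<phi> x) mod int p)"
    define v where "v = inv ((al ^^ k) x) \<otimes> w"
    have k: "[int k = \<phi> w - \<phi> x] (mod int p)" using p3 by (simp add: k_def cong_def)
    have vc: "v \<in> carrier G" using xw by (simp add: v_def)
    have eq: "(al ^^ k) x \<otimes> v = w" using xw by (simp add: v_def m_assoc[symmetric])
    have "[\<phi> x + \<phi> v = \<phi> w] (mod int p)"
      unfolding eq[symmetric] using xw vc
      by (intro cong_sym[OF phi_mult_cong] phi_al_pow) auto
    then have "[\<phi> v + \<phi> x = int k + \<phi> x] (mod int p)"
      using cong_trans[OF _ cong_sym[OF cong_add[OF k cong_refl[of "\<phi> x"]]]] by (simp add: add.commute)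
    then have "[\<phi> v = int k] (mod int p)" by (simp only: cong_add_rcancel)
    then have "h v = affine v k" by (rule h_eq[symmetric])
    then have "h v x = w" using eq xw by (simp add: affine_def)
    then show "\<exists>g\<in>carrier (A\<lparr>carrier := H\<rparr>). g x = w" using vc by (auto simp: H_def)
  next
    fix x assume x: "x \<in> carrier G"
    have "f = \<one>\<^bsub>A\<^esub>" if f: "f \<in> H" "f x = x" for f
    proof -
      obtain w where w: "w \<in> carrier G" "f = h w" using f by (auto simp: H_def)
      have fx: "(al ^^ twist w) x \<otimes> w = x" using f(2) x w by (simp add: h_def affine_def)
      \<comment> \<open>Applying \<phi> to the fixed-point equation gives \<phi>(w) = 0, so the map
        is a plain translation, which fixes a point only if it is trivial.\<close>
      have "[\<phi> ((al ^^ twist w) x \<otimes> w) = \<phi> x + \<phi> w] (mod int p)"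
        using x w by (intro phi_mult_cong phi_al_pow) auto
      then have "[\<phi> x + 0 = \<phi> x + \<phi> w] (mod int p)" unfolding fx by simp
      then have "[\<phi> w = int 0] (mod int p)" by (simp only: cong_add_lcancel of_nat_0 cong_sym_eq)
      then have hw: "h w = affine w 0" by (rule h_eq[symmetric])
      then have "x \<otimes> w = x" using f(2) w x by (simp add: affine_def)
      then have "w = \<one>" using x w by simp
      then show ?thesis using hw w affine_one by simp
    qed
    moreover have "\<one>\<^bsub>A\<^esub> \<in> H" unfolding one H_def by simp
    moreover have "\<one>\<^bsub>A\<^esub> x = x" unfolding affine_one using x by (simp add: affine_def)
    ultimately have "{f \<in> H. f x = x} = {\<one>\<^bsub>A\<^esub>}" by blast
    then show "stabilizer (A\<lparr>carrier := H\<rparr>) (\<lambda>h. h) x = {\<one>\<^bsub>A\<lparr>carrier := H\<rparr>\<^esub>}"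
      by (simp add: stabilizer_def)
  qed
  then have "regular_subgroup H (cayley_digraph G S)"
    unfolding regular_subgroup_def pv using sub by blast
  moreover have "\<not> comm_group (A\<lparr>carrier := H\<rparr>)"
  proof
    assume "comm_group (A\<lparr>carrier := H\<rparr>)"
    then have "h a \<otimes>\<^bsub>A\<^esub> h b = h b \<otimes>\<^bsub>A\<^esub> h a"
      using comm_monoid.m_comm[of "A\<lparr>carrier := H\<rparr>" "h a" "h b"]
      by (simp add: comm_group_def H_def)
    moreover have "h a = affine a 1" "h b = affine b 0"
      using h_eq[of a 1] h_eq[of b 0] phi_vals by simp_all
    \<comment> \<open>At the identity the two products take the values
      \<open>al b \<otimes> a\<close> and \<open>a \<otimes> b\<close>, so commuting would mean that
      \<open>al\<close> fixes \<open>b\<close>.\<close>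
    ultimately have "affine ((al ^^ 1) b \<otimes> a) (0 + 1) = affine ((al ^^ 0) a \<otimes> b) (1 + 0)"
      by (simp only: affine_mult carr)
    then have "affine ((al ^^ 1) b \<otimes> a) 1 \<one> = affine ((al ^^ 0) a \<otimes> b) 1 \<one>" by simp
    then have "(al ^^ 1) b \<otimes> a = (al ^^ 0) a \<otimes> b"
      by (simp only: affine_at_one m_closed al_pow_carrier carr)
    then have "(al ^^ 1) b = (al ^^ 0) b" by (simp add: m_comm[of a b])
    then have "[1 = 0] (mod p)" by (rule b_pow_inj)
    then show False using p3 by (simp add: cong_def)
  qed
  ultimately show ?thesis by blast
qed

end
end

section \<open>Existence of the homomorphisms\<close>

context comm_group begin

definition adjoin :: "'a set \<Rightarrow> 'a \<Rightarrow> 'a set" where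
  "adjoin K x = {m \<otimes> x [^] (i::int) | m i. m \<in> K}"

lemma adjoin_subgroup:
  assumes K: "subgroup K G" and x: "x \<in> carrier G"
  shows "subgroup (adjoin K x) G"
proof (rule subgroupI)
  have [simp]: "m \<in> K \<Longrightarrow> m \<in> carrier G" for m using K by (rule subgroup.mem_carrier)
  show "adjoin K x \<subseteq> carrier G" using x by (auto simp: adjoin_def)
  show "adjoin K x \<noteq> {}" using subgroup.one_closed[OF K] by (auto simp: adjoin_def)
  fix u assume "u \<in> adjoin K x"
  then obtain m i where u: "m \<in> K" "u = m \<otimes> x [^] (i::int)" by (auto simp: adjoin_def)
  then have "inv u = inv m \<otimes> x [^] (- i)" using x by (simp add: inv_mult int_pow_neg)
  then show "inv u \<in> adjoin K x" using subgroup.m_inv_closed[OF K u(1)] by (auto simp: adjoin_def)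
  fix v assume "v \<in> adjoin K x"
  then obtain n j where v: "n \<in> K" "v = n \<otimes> x [^] (j::int)" by (auto simp: adjoin_def)
  have "u \<otimes> v = (m \<otimes> n) \<otimes> x [^] (i + j)" using u v x by (simp add: int_pow_mult m_ac)
  then show "u \<otimes> v \<in> adjoin K x" using subgroup.m_closed[OF K u(1) v(1)] by (auto simp: adjoin_def)
qed

lemma adjoin_superset: "x \<in> carrier G \<Longrightarrow> subgroup K G \<Longrightarrow> K \<subseteq> adjoin K x"
proof
  fix k assume "subgroup K G" "k \<in> K"
  then have "k = k \<otimes> x [^] (0::int)" by (simp add: subgroup.mem_carrier)
  then show "k \<in> adjoin K x" using \<open>k \<in> K\<close> unfolding adjoin_def by blast
qed

lemma adjoin_self: "x \<in> carrier G \<Longrightarrow> subgroup K G \<Longrightarrow> x \<in> adjoin K x"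
proof -
  assume "x \<in> carrier G" "subgroup K G"
  then have "x = \<one> \<otimes> x [^] (1::int)" by simp
  then show "x \<in> adjoin K x" using subgroup.one_closed[OF \<open>subgroup K G\<close>] unfolding adjoin_def by blast
qed

lemma int_pow_coprime_mem:
  assumes K: "subgroup K G" and x: "x \<in> carrier G" "x [^] (m::int) \<in> K" "x [^] (i::int) \<in> K"
    and cop: "coprime i m"
  shows "x \<in> K"
proof -
  obtain u v where uv: "u * i + v * m = 1" using cop bezout_int[of i m] by auto
  have "x = x [^] (i * u + m * v)" using x uv by (simp add: mult.commute)
  also have "\<dots> = (x [^] i) [^] u \<otimes> (x [^] m) [^] v"
    using x by (simp add: int_pow_mult int_pow_pow)
  finally show ?thesis
    using K x by (metis subgroup.m_closed subgroup_int_pow_closed)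
qed

text \<open>Steinitz exchange: the quotient by \<open>K\<close> has exponent dividing p, so it is a
  vector space over the field with p elements.\<close>

lemma adjoin_exchange:
  fixes p :: nat
  assumes K: "subgroup K G" and pow: "\<And>x. x \<in> carrier G \<Longrightarrow> x [^] p \<in> K" and p: "Factorial_Ring.prime p"
    and x: "x \<in> carrier G" and g: "g \<in> adjoin K x" "g \<notin> K"
  shows "x \<in> adjoin K g"
proof -
  have [simp]: "m \<in> K \<Longrightarrow> m \<in> carrier G" for m using K by (rule subgroup.mem_carrier)
  obtain m i where mi: "m \<in> K" "g = m \<otimes> x [^] (i::int)" using g by (auto simp: adjoin_def)
  have gc: "g \<in> carrier G" using mi x by simp
  have xp: "x [^] int p \<in> K" using pow[OF x] by (simp add: int_pow_int)
  have "\<not> int p dvd i"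
  proof
    assume "int p dvd i"
    then obtain k where "i = int p * k" by auto
    then have "x [^] i \<in> K" using xp x K by (simp add: int_pow_pow[symmetric] subgroup_int_pow_closed)
    then show False using g mi K by (simp add: subgroup.m_closed)
  qed
  then have "coprime (int p) i" using p by (intro prime_imp_coprime) auto
  then have cop: "coprime i (int p)" by (simp add: coprime_commute)
  have sub: "subgroup (adjoin K g) G" by (rule adjoin_subgroup[OF K gc])
  have "x [^] i = inv m \<otimes> g" using mi x by (simp add: m_assoc[symmetric])
  moreover have "inv m \<otimes> g \<in> adjoin K g"
    using sub adjoin_self[OF gc K] adjoin_superset[OF gc K] mi
    by (intro subgroup.m_closed subgroup.m_inv_closed) auto
  ultimately have "x [^] i \<in> adjoin K g" by simp
  moreover have "x [^] int p \<in> adjoin K g" using xp adjoin_superset[OF gc K] by auto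
  ultimately show ?thesis using int_pow_coprime_mem[OF sub x] cop by blast
qed

text \<open>A subgroup \<open>M\<close> of maximal size that contains \<open>K\<close> and avoids
  \<open>g\<close> is a hyperplane: by exchange, \<open>M\<close> and \<open>g\<close> generate
  everything. The homomorphism is the exponent of \<open>g\<close> modulo \<open>M\<close>.\<close>

lemma exists_mod_hom:
  fixes p :: nat
  assumes fin: "finite (carrier G)" and p: "Factorial_Ring.prime p"
    and K: "subgroup K G" and pow: "\<And>x. x \<in> carrier G \<Longrightarrow> x [^] p \<in> K"
    and g: "g \<in> carrier G" "g \<notin> K"
  shows "\<exists>f::'a \<Rightarrow> int. (\<forall>x\<in>carrier G. \<forall>w\<in>carrier G. [f (x \<otimes> w) = f x + f w] (mod int p)) \<and>
    (\<forall>x\<in>K. [f x = 0] (mod int p)) \<and> [f g = 1] (mod int p)"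
proof -
  define C where "C = {M. subgroup M G \<and> K \<subseteq> M \<and> g \<notin> M}"
  have "C \<subseteq> Pow (carrier G)" by (auto simp: C_def dest: subgroup.mem_carrier)
  then have "finite C" using fin by (simp add: finite_subset)
  moreover have "K \<in> C" using K g by (simp add: C_def)
  ultimately have "Max (card ` C) \<in> card ` C" by (intro Max_in) auto
  then obtain M where M: "M \<in> C" "card M = Max (card ` C)" by auto
  have max: "card N \<le> card M" if "N \<in> C" for N
    unfolding M(2) using that \<open>finite C\<close> by (intro Max_ge) auto
  have sM: "subgroup M G" "K \<subseteq> M" "g \<notin> M" using M(1) by (auto simp: C_def)
  have [simp]: "m \<in> M \<Longrightarrow> m \<in> carrier G" for m using sM(1) by (rule subgroup.mem_carrier)
  have powM: "x [^] p \<in> M" if "x \<in> carrier G" for x using pow[OF that] sM by auto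
  have "x \<in> adjoin M g" if x: "x \<in> carrier G" for x
  proof (cases "x \<in> M")
    case True
    then show ?thesis using adjoin_superset[OF g(1) sM(1)] by auto
  next
    case False
    have sub: "subgroup (adjoin M x) G" by (rule adjoin_subgroup[OF sM(1) x])
    have "M \<subset> adjoin M x" using adjoin_superset[OF x sM(1)] adjoin_self[OF x sM(1)] False by auto
    moreover have "finite (adjoin M x)" using subgroup.subset[OF sub] fin by (rule finite_subset)
    ultimately have "card M < card (adjoin M x)" by (rule psubset_card_mono[rotated])
    then have "adjoin M x \<notin> C" using max by (meson not_le)
    then have "g \<in> adjoin M x" using sub \<open>M \<subset> adjoin M x\<close> sM by (auto simp: C_def)
    then show ?thesis using adjoin_exchange[OF sM(1) powM p x] sM(3) by blast
  qed
  then have ex: "\<exists>i::int. \<exists>m\<in>M. x = m \<otimes> g [^] i" if "x \<in> carrier G" for x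
    using that unfolding adjoin_def by blast
  \<comment> \<open>An arbitrary representative; the exponent is determined only modulo p, which is
    why all laws are congruences.\<close>
  define f where "f x = (SOME i::int. \<exists>m\<in>M. x = m \<otimes> g [^] i)" for x
  have f: "\<exists>m\<in>M. x = m \<otimes> g [^] f x" if "x \<in> carrier G" for x
    unfolding f_def by (rule someI_ex[OF ex[OF that]])
  have dvd: "int p dvd k" if k: "g [^] (k::int) \<in> M" for k
  proof (rule ccontr)
    assume "\<not> int p dvd k"
    then have "coprime (int p) k" using p by (intro prime_imp_coprime) auto
    then have "coprime k (int p)" by (simp add: coprime_commute)
    moreover have "g [^] int p \<in> M" using powM[OF g(1)] by (simp add: int_pow_int)
    ultimately show False using int_pow_coprime_mem[OF sM(1) g(1)] k sM(3) by blast
  qed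
  have uniq: "[f x = i] (mod int p)" if x: "x \<in> carrier G" and m: "m \<in> M" "x = m \<otimes> g [^] i" for x m i
  proof -
    obtain n where n: "n \<in> M" "x = n \<otimes> g [^] f x" using f[OF x] by blast
    have "g [^] (f x - i) = (inv n \<otimes> x) \<otimes> inv (inv m \<otimes> x)"
    proof -
      have "inv n \<otimes> x = g [^] f x" by (subst n(2)) (use n(1) g in \<open>simp add: m_assoc[symmetric]\<close>)
      moreover have "inv m \<otimes> x = g [^] i" by (subst m(2)) (use m(1) g in \<open>simp add: m_assoc[symmetric]\<close>)
      ultimately show ?thesis using g by (simp add: int_pow_diff)
    qed
    also have "\<dots> = inv n \<otimes> m"
    proof -
      have "x \<otimes> (inv x \<otimes> m) = m" using m(1) x by (simp add: m_assoc[symmetric])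
      then show ?thesis using n(1) m(1) x by (simp add: inv_mult_group m_assoc)
    qed
    also have "\<dots> \<in> M" using n m sM(1) by (intro subgroup.m_closed subgroup.m_inv_closed)
    finally show ?thesis using dvd by (simp add: cong_iff_dvd_diff)
  qed
  have "[f (x \<otimes> w) = f x + f w] (mod int p)" if xw: "x \<in> carrier G" "w \<in> carrier G" for x w
  proof -
    obtain m n where mn: "m \<in> M" "n \<in> M" "x = m \<otimes> g [^] f x" "w = n \<otimes> g [^] f w" using f xw by meson
    have "x \<otimes> w = (m \<otimes> g [^] f x) \<otimes> (n \<otimes> g [^] f w)" using mn(3,4) by simp
    also have "\<dots> = (m \<otimes> n) \<otimes> g [^] (f x + f w)" using mn(1,2) g by (simp add: int_pow_mult m_ac)
    finally show ?thesis using xw mn(1,2) g subgroup.m_closed[OF sM(1)] by (intro uniq[of _ "m \<otimes> n"]) auto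
  qed
  moreover have "[f x = 0] (mod int p)" if "x \<in> K" for x
    using that sM by (intro uniq[of _ x]) auto
  moreover have "[f g = 1] (mod int p)"
    using g subgroup.one_closed[OF sM(1)] by (intro uniq[of _ \<one>]) auto
  ultimately show ?thesis by blast
qed

section \<open>Roots and elements of order p in the Sylow subgroup\<close>

lemma prime_order_int_pow:
  fixes p :: nat
  assumes p: "Factorial_Ring.prime p" and x: "x \<in> carrier G" "x [^] p = \<one>" "x \<noteq> \<one>" "x [^] (i::int) = \<one>"
  shows "int p dvd i"
proof -
  have "ord x dvd p" using x by (simp add: pow_eq_id)
  then have "ord x = 1 \<or> ord x = p" using p by (auto simp: prime_nat_iff)
  moreover have "ord x \<noteq> 1" using x pow_eq_id[of x 1] by auto
  ultimately show ?thesis using x int_pow_eq_id[of x i] by simp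
qed

lemma prime_order_power:
  fixes p :: nat
  assumes w: "w \<in> carrier G" "w \<noteq> \<one>" "w [^] (p ^ n) = \<one>"
  shows "\<exists>k::nat. w [^] k \<noteq> \<one> \<and> (w [^] k) [^] p = \<one>"
proof -
  define e where "e = (LEAST e. w [^] (p ^ e) = \<one>)"
  have e: "w [^] (p ^ e) = \<one>" unfolding e_def by (rule LeastI[of _ n]) (rule w)
  then have "e \<noteq> 0" using w by (intro notI) simp
  then obtain d where d: "e = Suc d" by (cases e) auto
  have "w [^] (p ^ d) \<noteq> \<one>" using not_less_Least[of d "\<lambda>e. w [^] (p ^ e) = \<one>"] d by (simp add: e_def)
  moreover have "(w [^] (p ^ d)) [^] p = \<one>" using e w by (simp add: nat_pow_pow d mult.commute)
  ultimately show ?thesis by blast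
qed

lemma subgroup_cyclicI:
  assumes P: "subgroup P G" and g: "g \<in> P" and gen: "\<And>x. x \<in> P \<Longrightarrow> \<exists>i::int. x = g [^] i"
  shows "cyclic_group (G\<lparr>carrier := P\<rparr>)"
proof -
  interpret P: group "G\<lparr>carrier := P\<rparr>" by (rule subgroup_imp_group[OF P])
  have "P = range (\<lambda>i::int. g [^] i)" using gen subgroup_int_pow_closed[OF P g] by blast
  then show ?thesis
    unfolding P.cyclic_group using g int_pow_consistent[OF P g] by (intro bexI[of _ g]) auto
qed

lemma subgroup_pow_card:
  assumes P: "subgroup P G" and x: "x \<in> P"
  shows "x [^] card P = \<one>"
proof -
  interpret P: group "G\<lparr>carrier := P\<rparr>" by (rule subgroup_imp_group[OF P])
  show ?thesis using P.pow_order_eq_1[of x] x by (simp add: order_def nat_pow_consistent[of x _ P])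
qed

text \<open>The quotient by \<open>P\<close> has order q prime to p, so the q-th power of
  \<open>x\<close> lies in \<open>P\<close>; together with the p-th power this gives
  \<open>x\<close> by Bezout.\<close>

lemma sylow_pow_mem:
  assumes fin: "finite (carrier G)" and p: "Factorial_Ring.prime p" and P: "sylow_subgroup p P G"
    and x: "x \<in> carrier G" "x [^] p \<in> P"
  shows "x \<in> P"
proof -
  have sub: "subgroup P G" and card: "card P = p ^ multiplicity p (order G)"
    using P by (auto simp: sylow_subgroup_def)
  obtain q where q: "order G = p ^ multiplicity p (order G) * q" "\<not> p dvd q"
    using multiplicity_decompose'[of "order G" p] fin p
    by (metis order_gt_0_iff_finite not_prime_unit not_gr_zero)
  interpret N: normal P G using subgroup_imp_normal[OF sub] .
  interpret Q: group "G Mod P" by (rule N.factorgroup_is_group)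
  have "card P > 0" using card p by (simp add: prime_gt_0_nat)
  moreover have "card (rcosets P) * card P = order G" by (rule lagrange[OF sub])
  moreover have "order G = card P * q" using q(1) card by simp
  ultimately have "card (rcosets P) = q" by (metis mult.commute mult_cancel_left less_not_refl)
  then have "order (G Mod P) = q" by (simp add: order_def FactGroup_def)
  moreover have Px: "P #> x \<in> carrier (G Mod P)" using x by (auto simp: FactGroup_def RCOSETS_def)
  ultimately have "(P #> x) [^]\<^bsub>G Mod P\<^esub> q = \<one>\<^bsub>G Mod P\<^esub>"
    using Q.pow_order_eq_1[OF Px] by simp
  then have "P #> (x [^] int q) = P"
    using N.FactGroup_int_pow[OF x(1), of "int q"] by (simp add: int_pow_int FactGroup_def)
  then have xq: "x [^] int q \<in> P"
    using x rcos_self[OF _ sub, of "x [^] int q"] by simp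
  have "coprime (int q) (int p)"
    using q(2) p by (metis coprime_commute coprime_int_iff prime_imp_coprime)
  then show ?thesis using int_pow_coprime_mem[OF sub x(1) _ xq, of "int p"] x(2) by (simp add: int_pow_int)
qed

definition p_powers :: "nat \<Rightarrow> 'a set" where
  "p_powers p = (\<lambda>x. x [^] p) ` carrier G"

lemma p_powers_subgroup: "subgroup (p_powers p) G"
proof (rule subgroupI)
  show "p_powers p \<subseteq> carrier G" "p_powers p \<noteq> {}" by (auto simp: p_powers_def)
  fix u assume "u \<in> p_powers p"
  then obtain x where x: "x \<in> carrier G" "u = x [^] p" by (auto simp: p_powers_def)
  then have "inv u = (inv x) [^] p" by (simp add: nat_pow_inv)
  then show "inv u \<in> p_powers p" using x by (auto simp: p_powers_def)
  fix v assume "v \<in> p_powers p"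
  then obtain w where w: "w \<in> carrier G" "v = w [^] p" by (auto simp: p_powers_def)
  then have "u \<otimes> v = (x \<otimes> w) [^] p" using x by (simp add: nat_pow_distrib)
  then show "u \<otimes> v \<in> p_powers p" using x w by (auto simp: p_powers_def)
qed

lemma p_powers_mem: "x \<in> carrier G \<Longrightarrow> x [^] p \<in> p_powers p"
  by (simp add: p_powers_def)

text \<open>If \<open>P\<close> lies in \<open>\<langle>g\<rangle> G\<^sup>p\<close>, iteration puts it in \<open>\<langle>g\<rangle> P\<^sup>q\<close> for every power \<open>q\<close> of \<open>p\<close>.\<close>

lemma cyclic_if_subset_adjoin_p_powers:
  assumes P: "subgroup P G" and card: "card P = p ^ n"
    and root: "\<And>x. x \<in> carrier G \<Longrightarrow> x [^] p \<in> P \<Longrightarrow> x \<in> P"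
    and g: "g \<in> P" and sub: "P \<subseteq> adjoin (p_powers p) g"
  shows "cyclic_group (G\<lparr>carrier := P\<rparr>)"
proof (rule subgroup_cyclicI[OF P g])
  have [simp]: "m \<in> P \<Longrightarrow> m \<in> carrier G" for m using P by (rule subgroup.mem_carrier)
  have step: "\<exists>i::int. \<exists>w\<in>P. x = w [^] (p ^ k) \<otimes> g [^] i" if x: "x \<in> P" for x k
  proof (induction k)
    case 0
    show ?case using x by (intro exI[of _ 0] bexI[of _ x]) auto
  next
    case (Suc k)
    then obtain i w where w: "w \<in> P" "x = w [^] (p ^ k) \<otimes> g [^] (i::int)" by blast
    then obtain v j where v: "v \<in> carrier G" "w = v [^] p \<otimes> g [^] (j::int)"
      using sub by (auto simp: adjoin_def p_powers_def)
    \<comment> \<open>Elements of \<open>p_powers p\<close> are powers of elements of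
      \<open>G\<close>. The root hypothesis puts \<open>v\<close> back into \<open>P\<close>, which
      lets the iteration go on.\<close>
    have "v [^] p = w \<otimes> g [^] (- j)" using v g by (simp add: m_assoc int_pow_neg)
    also have "\<dots> \<in> P" using P w(1) subgroup_int_pow_closed[OF P g] by (intro subgroup.m_closed)
    finally have vP: "v \<in> P" using root v(1) by blast
    have "w [^] (p ^ k) = (v [^] p) [^] (p ^ k) \<otimes> (g [^] j) [^] (p ^ k)"
      unfolding v(2) using v(1) g by (intro nat_pow_distrib) auto
    also have "\<dots> = v [^] (p ^ Suc k) \<otimes> g [^] (j * int (p ^ k))"
      using v(1) g by (simp add: nat_pow_pow int_pow_int[symmetric] int_pow_pow)
    finally have "x = v [^] (p ^ Suc k) \<otimes> g [^] (j * int (p ^ k)) \<otimes> g [^] i" using w(2) by simp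
    also have "\<dots> = v [^] (p ^ Suc k) \<otimes> g [^] (j * int (p ^ k) + i)"
      using v(1) g by (simp only: int_pow_mult m_assoc nat_pow_closed int_pow_closed \<open>\<And>m. m \<in> P \<Longrightarrow> m \<in> carrier G\<close>)
    finally show ?case using vP by blast
  qed
  fix x assume "x \<in> P"
  then obtain i w where w: "w \<in> P" "x = w [^] (p ^ n) \<otimes> g [^] (i::int)" using step by blast
  then have "x = g [^] i" using subgroup_pow_card[OF P w(1)] g by (simp add: card)
  then show "\<exists>i::int. x = g [^] i" by blast
qed

text \<open>A finite abelian p-group with only one subgroup of order p is cyclic, generated by any
  element of maximal order. Here \<open>g\<close> has maximal order and \<open>y\<close> is its
  power of order p.\<close>

lemma two_independent_of_order_p:
  assumes p: "Factorial_Ring.prime p" and P: "subgroup P G" and card: "card P = p ^ n"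
    and nc: "\<not> cyclic_group (G\<lparr>carrier := P\<rparr>)"
  shows "\<exists>y\<in>P. \<exists>z\<in>P. y [^] p = \<one> \<and> z [^] p = \<one> \<and>
    (\<forall>i j :: int. y [^] i \<otimes> z [^] j = \<one> \<longrightarrow> int p dvd i \<and> int p dvd j)"
proof -
  have [simp]: "m \<in> P \<Longrightarrow> m \<in> carrier G" for m using P by (rule subgroup.mem_carrier)
  define e where "e = (LEAST e. \<forall>x\<in>P. x [^] (p ^ e) = \<one>)"
  have e: "\<forall>x\<in>P. x [^] (p ^ e) = \<one>"
    unfolding e_def using subgroup_pow_card[OF P] card
    by (intro LeastI[of "\<lambda>e. \<forall>x\<in>P. x [^] (p ^ e) = \<one>" n]) simp
  have "e \<noteq> 0"
  proof
    assume "e = 0"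
    have "cyclic_group (G\<lparr>carrier := P\<rparr>)"
    proof (rule subgroup_cyclicI[OF P subgroup.one_closed[OF P]])
      fix x assume "x \<in> P"
      then have "x [^] (p ^ e) = \<one>" using e by blast
      then have "x = \<one> [^] (0::int)" using \<open>e = 0\<close> \<open>x \<in> P\<close> by simp
      then show "\<exists>i::int. x = \<one> [^] i" by blast
    qed
    then show False using nc by blast
  qed
  then obtain d where d: "e = Suc d" by (cases e) auto
  obtain g where g: "g \<in> P" "g [^] (p ^ d) \<noteq> \<one>"
    using not_less_Least[of d "\<lambda>e. \<forall>x\<in>P. x [^] (p ^ e) = \<one>"] d by (auto simp: e_def)
  define y where "y = g [^] (p ^ d)"
  have yP: "y \<in> P" using subgroup_int_pow_closed[OF P g(1), of "int (p ^ d)"] by (simp only: y_def int_pow_int)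
  have y1: "y \<noteq> \<one>" using g by (simp add: y_def)
  have yp: "y [^] p = \<one>" using e g(1) by (simp add: y_def nat_pow_pow d mult.commute)
  have "\<exists>z\<in>P. z [^] p = \<one> \<and> (\<forall>i::int. z \<noteq> y [^] i)"
  proof (rule ccontr)
    assume "\<not> ?thesis"
    then have all: "\<exists>i::int. z = y [^] i" if "z \<in> P" "z [^] p = \<one>" for z using that by blast
    have yg: "y [^] (i::int) = g [^] (int (p ^ d) * i)" for i
      using g(1) unfolding y_def by (simp only: int_pow_int[symmetric] int_pow_pow \<open>\<And>m. m \<in> P \<Longrightarrow> m \<in> carrier G\<close>)
    have gen: "\<exists>i::int. x = g [^] i" if "x \<in> P" "x [^] (p ^ k) = \<one>" for x k
      using that
    proof (induction k arbitrary: x)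
      case 0
      then show ?case by (intro exI[of _ 0]) simp
    next
      case (Suc k)
      have "x [^] p \<in> P" using subgroup_int_pow_closed[OF P Suc.prems(1), of "int p"] by (simp only: int_pow_int)
      moreover have "(x [^] p) [^] (p ^ k) = \<one>" using Suc.prems by (simp add: nat_pow_pow)
      ultimately obtain i where i: "x [^] p = g [^] (i::int)" using Suc.IH by blast
      show ?case
      proof (cases "int p dvd i")
        case True
        then obtain l where l: "i = int p * l" by auto
        \<comment> \<open>The p-th power of \<open>u\<close> is trivial, so \<open>u\<close> is a
          power of \<open>y\<close> and hence of \<open>g\<close>.\<close>
        define u where "u = x \<otimes> g [^] (- l)"
        have uP: "u \<in> P" unfolding u_def using P Suc.prems(1) subgroup_int_pow_closed[OF P g(1)] by (intro subgroup.m_closed)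
        have "u [^] p = x [^] p \<otimes> (g [^] (- l)) [^] p"
          unfolding u_def using Suc.prems(1) g(1) by (intro nat_pow_distrib) auto
        also have "(g [^] (- l)) [^] p = g [^] (- i)"
          using g(1) by (simp add: int_pow_int[symmetric] int_pow_pow l mult.commute del: int_pow_neg)
        also have "x [^] p \<otimes> g [^] (- i) = \<one>" unfolding i using g(1) by (simp add: int_pow_neg)
        finally obtain j where "u = y [^] (j::int)" using all uP by blast
        then have "u = g [^] (int (p ^ d) * j)" by (simp only: yg)
        moreover have "x = u \<otimes> g [^] l" using Suc.prems(1) g(1) by (simp add: u_def m_assoc int_pow_neg)
        ultimately have "x = g [^] (int (p ^ d) * j + l)" using g(1) by (simp add: int_pow_mult)
        then show ?thesis by blast
      next
        case False
        \<comment> \<open>In this case \<open>g\<close> would be a power of the p-th power of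
          \<open>x\<close>. As \<open>p ^ e\<close> annihilates \<open>x\<close>, already
          \<open>p ^ d\<close> would annihilate \<open>g\<close>, against its choice.\<close>
        then have "coprime (int p) i" using p by (intro prime_imp_coprime) auto
        then have cop: "coprime i (int (p ^ e))" by (simp add: coprime_commute)
        have P': "subgroup (range (\<lambda>j::int. (x [^] p) [^] j)) G"
        proof -
          have "range (\<lambda>j::int. (x [^] p) [^] j) = adjoin {\<one>} (x [^] p)"
            using Suc.prems(1) by (auto simp: adjoin_def)
          then show ?thesis using adjoin_subgroup[OF triv_subgroup, of "x [^] p"] Suc.prems(1) by simp
        qed
        have "g [^] i \<in> range (\<lambda>j::int. (x [^] p) [^] j)"
          unfolding i[symmetric] using Suc.prems(1) by (intro image_eqI[of _ _ 1]) auto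
        moreover have "g [^] int (p ^ e) \<in> range (\<lambda>j::int. (x [^] p) [^] j)"
          using e g(1) subgroup.one_closed[OF P'] by (simp only: int_pow_int)
        ultimately have "g \<in> range (\<lambda>j::int. (x [^] p) [^] j)"
          using int_pow_coprime_mem[OF P' _ _ _ cop] g(1) by simp
        then obtain j where j: "g = (x [^] p) [^] (j::int)" by blast
        have "g [^] int (p ^ d) = (x [^] int (p ^ e)) [^] j"
          unfolding j using Suc.prems(1)
          by (simp add: int_pow_int[symmetric] int_pow_pow d mult_ac del: of_nat_power)
        also have "\<dots> = \<one>" using e Suc.prems(1) by (simp only: int_pow_int) simp
        finally show ?thesis using g(2) by (simp only: int_pow_int)
      qed
    qed
    then have "cyclic_group (G\<lparr>carrier := P\<rparr>)" using e by (intro subgroup_cyclicI[OF P g(1)]) blast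
    then show False using nc by blast
  qed
  then obtain z where z: "z \<in> P" "z [^] p = \<one>" "\<And>i::int. z \<noteq> y [^] i" by blast
  have "int p dvd i \<and> int p dvd j" if eq: "y [^] i \<otimes> z [^] j = \<one>" for i j :: int
  proof -
    have dj: "int p dvd j"
    proof (rule ccontr)
      assume "\<not> int p dvd j"
      then have "coprime (int p) j" using p by (intro prime_imp_coprime) auto
      then have cop: "coprime j (int p)" by (simp add: coprime_commute)
      have Y: "subgroup (adjoin {\<one>} y) G" using adjoin_subgroup[OF triv_subgroup, of y] yP by simp
      have "z [^] j = \<one> \<otimes> y [^] (- i)"
        using eq yP z(1) inv_equality[of "y [^] i" "z [^] j"] by (simp add: int_pow_neg inv_equality[symmetric] m_comm)
      then have "z [^] j \<in> adjoin {\<one>} y" unfolding adjoin_def by blast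
      moreover have "z [^] int p \<in> adjoin {\<one>} y"
        using z(2) subgroup.one_closed[OF Y] by (simp add: int_pow_int)
      ultimately have "z \<in> adjoin {\<one>} y" using int_pow_coprime_mem[OF Y _ _ _ cop] z(1) by simp
      then show False using z(3) yP by (auto simp: adjoin_def)
    qed
    then obtain k where "j = int p * k" by auto
    then have "z [^] j = \<one>" using z by (simp add: int_pow_pow[symmetric] int_pow_int)
    then have "y [^] i = \<one>" using eq yP by simp
    then show ?thesis using prime_order_int_pow[OF p _ yp y1] yP dj by simp
  qed
  then show ?thesis using yP z yp by blast
qed

lemma exists_unipotent_data:
  assumes fin: "finite (carrier G)" and p: "Factorial_Ring.prime p" and odd: "odd p"
    and P: "sylow_subgroup p P G" and nc: "\<not> cyclic_group (G\<lparr>carrier := P\<rparr>)"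
    and nea: "\<not> elementary_abelian p 2 (G\<lparr>carrier := P\<rparr>)"
  shows "\<exists>\<phi> \<psi> a b y z. unipotent_data G p \<phi> \<psi> a b y z"
proof -
  define n where "n = multiplicity p (order G)"
  let ?F = "p_powers p"
  have sub: "subgroup P G" and card: "card P = p ^ n"
    using P by (auto simp: sylow_subgroup_def n_def)
  have Pc[simp]: "m \<in> P \<Longrightarrow> m \<in> carrier G" for m using sub by (rule subgroup.mem_carrier)
  have root: "x \<in> P" if "x \<in> carrier G" "x [^] p \<in> P" for x by (rule sylow_pow_mem[OF fin p P that])
  have F: "subgroup ?F G" by (rule p_powers_subgroup)
  have powF: "x [^] p \<in> ?F" if "x \<in> carrier G" for x using that by (rule p_powers_mem)
  \<comment> \<open>Modulo p-th powers of \<open>G\<close>, a noncyclic \<open>P\<close> is not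
    spanned by one element; this is the source of \<open>a\<close> and \<open>b\<close>.\<close>
  have outside: "\<exists>x\<in>P. x \<notin> adjoin ?F g" if "g \<in> P" for g
    using cyclic_if_subset_adjoin_p_powers[OF sub card root that] nc by blast
  have powA: "x [^] p \<in> adjoin ?F g" if "x \<in> carrier G" "g \<in> carrier G" for x g
    using powF[OF that(1)] adjoin_superset[OF that(2) F] by blast
  show ?thesis
  proof (cases "\<exists>y\<in>P. y [^] p = \<one> \<and> y \<notin> ?F")
    case True
    then obtain y where y: "y \<in> P" "y [^] p = \<one>" "y \<notin> ?F" by blast
    have yc: "y \<in> carrier G" using y by simp
    have adj: "subgroup (adjoin ?F y) G" by (rule adjoin_subgroup[OF F yc])
    obtain \<psi> :: "'a \<Rightarrow> int" where psi: "\<And>x w. x \<in> carrier G \<Longrightarrow> w \<in> carrier G \<Longrightarrow> [\<psi> (x \<otimes> w) = \<psi> x + \<psi> w] (mod int p)"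
      "[\<psi> y = 1] (mod int p)"
      using exists_mod_hom[OF fin p F powF yc y(3)] by blast
    obtain a0 where a0: "a0 \<in> P" "a0 \<notin> adjoin ?F y" using outside[OF y(1)] by blast
    \<comment> \<open>Correction by a power of \<open>y\<close> arranges \<psi>(a) = 0, as \<psi>(y)
      = 1, without changing the class modulo \<open>adjoin ?F y\<close>.\<close>
    define a where "a = a0 \<otimes> y [^] (- \<psi> a0)"
    have yi: "y [^] (i::int) \<in> P" "y [^] i \<in> adjoin ?F y" for i
      using subgroup_int_pow_closed[OF sub y(1)] subgroup_int_pow_closed[OF adj adjoin_self[OF yc F]] by auto
    have aP: "a \<in> P" unfolding a_def using a0(1) yi(1) by (rule subgroup.m_closed[OF sub])
    have aF: "a \<notin> adjoin ?F y"
    proof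
      assume "a \<in> adjoin ?F y"
      then have "a \<otimes> y [^] \<psi> a0 \<in> adjoin ?F y" using yi(2) by (rule subgroup.m_closed[OF adj])
      moreover have "a \<otimes> y [^] \<psi> a0 = a0" using a0(1) yc by (simp add: a_def m_assoc int_pow_neg)
      ultimately show False using a0(2) by simp
    qed
    have "[\<psi> a = \<psi> a0 + - \<psi> a0 * 1] (mod int p)"
      unfolding a_def using a0(1) yc psi
      by (intro cong_trans[OF psi(1)] cong_add cong_refl cong_trans[OF mod_hom_int_pow[OF psi(1)]] cong_mult) auto
    then have psia: "[\<psi> a = 0] (mod int p)" by simp
    obtain \<phi> :: "'a \<Rightarrow> int" where phi: "\<And>x w. x \<in> carrier G \<Longrightarrow> w \<in> carrier G \<Longrightarrow> [\<phi> (x \<otimes> w) = \<phi> x + \<phi> w] (mod int p)"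
      "\<And>x. x \<in> adjoin ?F y \<Longrightarrow> [\<phi> x = 0] (mod int p)" "[\<phi> a = 1] (mod int p)"
      using exists_mod_hom[OF fin p adj powA[OF _ yc] Pc[OF aP] aF] by blast
    have phiy: "[\<phi> y = 0] (mod int p)" by (rule phi(2)[OF adjoin_self[OF yc F]])
    have phi_pow: "[\<phi> (x [^] i) = i * \<phi> x] (mod int p)"
      and psi_pow: "[\<psi> (x [^] i) = i * \<psi> x] (mod int p)" if "x \<in> carrier G" for x and i :: int
      by (rule mod_hom_int_pow; use phi(1) psi(1) that in blast)+
    \<comment> \<open>Otherwise \<phi> and \<psi> together would embed \<open>P\<close> into Z_p x
      Z_p. The images of \<open>a\<close> and \<open>y\<close> are the two unit vectors, so this
      would be an isomorphism, which is excluded.\<close>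
    have "\<exists>w\<in>P. w \<noteq> \<one> \<and> [\<phi> w = 0] (mod int p) \<and> [\<psi> w = 0] (mod int p)"
    proof (rule ccontr)
      assume none: "\<not> ?thesis"
      let ?Z = "product_group {..<2::nat} (\<lambda>_. integer_mod_group p)"
      define h where "h x = (\<lambda>i\<in>{..<2::nat}. (if i = 0 then \<phi> x else \<psi> x) mod int p)" for x
      have p0: "p > 0" using p by (simp add: prime_gt_0_nat)
      have hom: "h \<in> hom (G\<lparr>carrier := P\<rparr>) ?Z"
      proof (rule homI)
        fix x assume "x \<in> carrier (G\<lparr>carrier := P\<rparr>)"
        show "h x \<in> carrier ?Z" using p0 by (auto simp: h_def carrier_integer_mod_group)
      next
        fix x w assume "x \<in> carrier (G\<lparr>carrier := P\<rparr>)" "w \<in> carrier (G\<lparr>carrier := P\<rparr>)"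
        then have "x \<in> carrier G" "w \<in> carrier G" by auto
        then have "\<phi> (x \<otimes> w) mod int p = (\<phi> x mod int p + \<phi> w mod int p) mod int p"
          "\<psi> (x \<otimes> w) mod int p = (\<psi> x mod int p + \<psi> w mod int p) mod int p"
          using phi(1) psi(1) by (auto simp: cong_def mod_simps)
        then show "h (x \<otimes>\<^bsub>G\<lparr>carrier := P\<rparr>\<^esub> w) = h x \<otimes>\<^bsub>?Z\<^esub> h w"
          by (auto simp: h_def intro!: restrict_ext)
      qed
      have "inj_on h P"
      proof (rule inj_onI)
        fix x w assume xw: "x \<in> P" "w \<in> P" "h x = h w"
        have eq: "[\<phi> x = \<phi> w] (mod int p)" "[\<psi> x = \<psi> w] (mod int p)"
          using fun_cong[OF xw(3), of 0] fun_cong[OF xw(3), of 1] by (simp_all add: h_def cong_def)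
        have ex: "[f (x \<otimes> inv w) = f x + - 1 * f w] (mod int p)"
          if f: "\<And>u v. u \<in> carrier G \<Longrightarrow> v \<in> carrier G \<Longrightarrow> [f (u \<otimes> v) = f u + f v] (mod int p)" for f
        proof -
          have "inv w = w [^] (- 1 :: int)" using xw(2) by (simp add: int_pow_neg)
          then show ?thesis
            using xw f mod_hom_int_pow[OF f, of w "- 1"]
            by (intro cong_trans[OF f] cong_add cong_refl) auto
        qed
        have "[\<phi> (x \<otimes> inv w) = 0] (mod int p)" "[\<psi> (x \<otimes> inv w) = 0] (mod int p)"
          using cong_trans[OF ex[OF phi(1)] cong_add[OF eq(1) cong_refl]]
            cong_trans[OF ex[OF psi(1)] cong_add[OF eq(2) cong_refl]] by auto
        moreover have "x \<otimes> inv w \<in> P" using xw(1) subgroup.m_inv_closed[OF sub xw(2)] by (rule subgroup.m_closed[OF sub])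
        ultimately have "x \<otimes> inv w = \<one>" using none by blast
        then have "inv (inv w) = x" using xw by (intro inv_equality) auto
        then show "x = w" using xw by simp
      qed
      moreover have "h ` P = carrier ?Z"
      proof
        show "h ` P \<subseteq> carrier ?Z" using hom by (auto simp: hom_def)
        show "carrier ?Z \<subseteq> h ` P"
        proof
          fix t assume t: "t \<in> carrier ?Z"
          define x where "x = a [^] t 0 \<otimes> y [^] t 1"
          have xP: "x \<in> P" unfolding x_def using subgroup_int_pow_closed[OF sub aP] yi(1) by (rule subgroup.m_closed[OF sub])
          have "[\<phi> x = t 0 * 1 + t 1 * 0] (mod int p)"
            unfolding x_def using aP yc phi(3) phiy phi(1)
            by (intro cong_trans[OF phi(1)] cong_add cong_trans[OF phi_pow] cong_mult cong_refl) auto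
          moreover have "[\<psi> x = t 0 * 0 + t 1 * 1] (mod int p)"
            unfolding x_def using aP yc psi(2) psia psi(1)
            by (intro cong_trans[OF psi(1)] cong_add cong_trans[OF psi_pow] cong_mult cong_refl) auto
          moreover have "t i mod int p = t i" if "i < 2" for i
            using t that p0 by (auto simp: carrier_integer_mod_group PiE_iff)
          ultimately have *: "\<phi> x mod int p = t 0" "\<psi> x mod int p = t 1" by (auto simp: cong_def)
          have "h x = t"
          proof
            fix i :: nat
            show "h x i = t i"
              using * t by (cases "i < 2") (auto simp: h_def PiE_iff extensional_def less_2_cases_iff)
          qed
          then show "t \<in> h ` P" using xP by blast
        qed
      qed
      ultimately have "h \<in> iso (G\<lparr>carrier := P\<rparr>) ?Z" using hom by (simp add: iso_iff)
      then show False using nea is_isoI unfolding elementary_abelian_def by blast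
    qed
    then obtain w where w: "w \<in> P" "w \<noteq> \<one>" "[\<phi> w = 0] (mod int p)" "[\<psi> w = 0] (mod int p)" by blast
    \<comment> \<open>A power of \<open>w\<close> has order p and stays in both kernels.\<close>
    obtain k :: nat where k: "w [^] k \<noteq> \<one>" "(w [^] k) [^] p = \<one>"
      using prime_order_power[of w p n] subgroup_pow_card[OF sub w(1)] w card by auto
    define z where "z = w [^] int k"
    have z: "z \<in> carrier G" "z \<noteq> \<one>" "z [^] p = \<one>" using w k by (auto simp: z_def int_pow_int)
    have "[\<phi> z = int k * 0] (mod int p)"
      unfolding z_def by (rule cong_trans[OF phi_pow[OF Pc[OF w(1)]] cong_mult[OF cong_refl w(3)]])
    moreover have "[\<psi> z = int k * 0] (mod int p)"
      unfolding z_def by (rule cong_trans[OF psi_pow[OF Pc[OF w(1)]] cong_mult[OF cong_refl w(4)]])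
    ultimately have phiz: "[\<phi> z = 0] (mod int p)" and psiz: "[\<psi> z = 0] (mod int p)" by simp_all
    have indep: "int p dvd i \<and> int p dvd j" if eq: "y [^] i \<otimes> z [^] j = \<one>" for i j :: int
    proof -
      have "[\<psi> (y [^] i \<otimes> z [^] j) = i * 1 + j * 0] (mod int p)"
        using yc z(1) psi(2) psiz psi(1)
        by (intro cong_trans[OF psi(1)] cong_add cong_trans[OF psi_pow] cong_mult cong_refl) auto
      moreover have "[\<psi> \<one> = 0] (mod int p)" using psi_pow[of y 0] yc by simp
      ultimately have "[i = 0] (mod int p)" unfolding eq using cong_trans[OF cong_sym] by fastforce
      then have di: "int p dvd i" by (simp add: cong_0_iff)
      then obtain l where "i = int p * l" by auto
      then have "y [^] i = \<one>" using yc y(2) by (simp add: int_pow_pow[symmetric] int_pow_int)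
      then have "z [^] j = \<one>" using eq z by simp
      then show ?thesis using prime_order_int_pow[OF p z(1,3,2)] di by blast
    qed
    have "unipotent_data G p \<phi> \<psi> a y y z"
      by unfold_locales (use fin p odd aP yc z phi psi phiy phiz psiz psia y(2) indep in auto)
    then show ?thesis by blast
  next
    case False
    obtain b where b: "b \<in> P" "b \<notin> adjoin ?F \<one>" using outside[OF subgroup.one_closed[OF sub]] by blast
    have bF: "b \<notin> ?F" using b(2) adjoin_superset[OF one_closed F] by blast
    obtain a where a: "a \<in> P" "a \<notin> adjoin ?F b" using outside[OF b(1)] by blast
    have ac: "a \<in> carrier G" and bc: "b \<in> carrier G" using a b by auto
    \<comment> \<open>The functional \<psi> has to vanish on \<open>a\<close> and not on
      \<open>b\<close>; exchange makes the independence of \<open>a\<close> and \<open>b\<close>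
      modulo p-th powers symmetric.\<close>
    have ba: "b \<notin> adjoin ?F a" using adjoin_exchange[OF F powF p ac _ bF] a(2) by blast
    obtain \<phi> :: "'a \<Rightarrow> int" where phi: "\<And>x w. x \<in> carrier G \<Longrightarrow> w \<in> carrier G \<Longrightarrow> [\<phi> (x \<otimes> w) = \<phi> x + \<phi> w] (mod int p)"
      "\<And>x. x \<in> adjoin ?F b \<Longrightarrow> [\<phi> x = 0] (mod int p)" "[\<phi> a = 1] (mod int p)"
      using exists_mod_hom[OF fin p adjoin_subgroup[OF F bc] powA[OF _ bc] ac a(2)] by blast
    obtain \<psi> :: "'a \<Rightarrow> int" where psi: "\<And>x w. x \<in> carrier G \<Longrightarrow> w \<in> carrier G \<Longrightarrow> [\<psi> (x \<otimes> w) = \<psi> x + \<psi> w] (mod int p)"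
      "\<And>x. x \<in> adjoin ?F a \<Longrightarrow> [\<psi> x = 0] (mod int p)" "[\<psi> b = 1] (mod int p)"
      using exists_mod_hom[OF fin p adjoin_subgroup[OF F ac] powA[OF _ ac] bc ba] by blast
    obtain y z where yz: "y \<in> P" "z \<in> P" "y [^] p = \<one>" "z [^] p = \<one>"
      "\<And>i j :: int. y [^] i \<otimes> z [^] j = \<one> \<Longrightarrow> int p dvd i \<and> int p dvd j"
      using two_independent_of_order_p[OF p sub card nc] by blast
    have "y \<in> ?F" "z \<in> ?F" using False yz by auto
    then have "y \<in> adjoin ?F a" "z \<in> adjoin ?F a" "y \<in> adjoin ?F b" "z \<in> adjoin ?F b"
      using adjoin_superset[OF ac F] adjoin_superset[OF bc F] by auto
    then have "unipotent_data G p \<phi> \<psi> a b y z"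
      by unfold_locales
        (use fin p odd ac bc yz phi psi adjoin_self[OF ac F] adjoin_self[OF bc F] in auto)
    then show ?thesis by blast
  qed
qed

end

theorem theorem4p1:
  fixes G :: "('a, 'b) monoid_scheme" and p :: nat and P :: "'a set"
  assumes "comm_group G" and "finite (carrier G)"
    and "Factorial_Ring.prime p" and "odd p"
    and "sylow_subgroup p P G"
    and "\<not> cyclic_group (G\<lparr>carrier := P\<rparr>)"
    and "\<not> elementary_abelian p 2 (G\<lparr>carrier := P\<rparr>)"
  shows "\<exists>S \<subseteq> carrier G - {\<one>\<^bsub>G\<^esub>}.
    proper_digraph (cayley_digraph G S) \<and>
    cayley_index G S = p \<and>
    (\<exists>H. regular_subgroup H (cayley_digraph G S) \<and>
         \<not> comm_group (aut_group (cayley_digraph G S)\<lparr>carrier := H\<rparr>))"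
proof -
  obtain \<phi> \<psi> a b y z where "unipotent_data G p \<phi> \<psi> a b y z"
    using comm_group.exists_unipotent_data[OF assms] by blast
  then interpret unipotent_data G p \<phi> \<psi> a b y z .
  obtain S where S: "good (carrier G) S" using good_carrier_exists by blast
  show ?thesis
    using S_props(1)[OF S] proper_cayley_digraph[OF S] cayley_index_eq[OF S] regular_nonabelian[OF S] by blast
qed

end
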